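(* Let $n\ge 2$, let $\mu$ be a pluriharmonic measure on $\mathbb{T}^n$, and let $\mu_\zeta$ denote the slice measure of $\mu$ at $\zeta$, which is defined for $m_n$-a.e. $\zeta\in\mathbb{T}^n$. Then $\mu=\int_{\mathbb{T}^n}\mu_\zeta\,dm_n(\zeta)$ in the following weak sense: \[ \int_{\mathbb{T}^n} f\,d\mu=\int_{\mathbb{T}^n}\int_{\mathbb{T}^n} f\,d\mu_\zeta\,dm_n(\zeta) \] for all $f\in C(\mathbb{T}^n)$.
   Context: $\mathbb{D}$ is the open unit disc of $\mathbb{C}$ and $\mathbb{T}=\partial\mathbb{D}$. $m_n$ is the normalized Lebesgue measure on $\mathbb{T}^n$. $M(\mathbb{T}^n)$ is the space of complex Borel measures on $\mathbb{T}^n$. The Poisson kernel of $\mathbb{D}^n$ is $P(z,\zeta)=\prod_{j=1}^n\frac{1-|z_j|^2}{|1-z_j\overline{\zeta_j}|^2}$ for $z\in\mathbb{D}^n$, $\zeta\in\mathbb{T}^n$, and for $\mu\in M(\mathbb{T}^n)$ the Poisson integral is $P[\mu](z)=\int_{\mathbb{T}^n}P(z,\zeta)\,d\mu(\zeta)$, $z\in\mathbb{D}^n$. For $n\ge2$, a measure $\mu\in M(\mathbb{T}^n)$ is called pluriharmonic if $P[\mu]$ is a pluriharmonic function on $\mathbb{D}^n$ (equivalently, the Fourier coefficients of $\mu$ vanish outside $(-\mathbb{Z}_+^n)\cup\mathbb{Z}_+^n$). Slice measures: let $\mu$ be pluriharmonic and $u=P[\mu]$. For $\zeta\in\mathbb{T}^n$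 let $u_\zeta(\lambda)=u(\lambda\zeta)$, $\lambda\in\mathbb{D}$; this is a harmonic function on $\mathbb{D}$. For $m_n$-a.e. $\zeta\in\mathbb{T}^n$ one has $\sup_{0<r<1}\int_{\mathbb{T}}|u_\zeta(r\xi)|\,dm_1(\xi)<\infty$, and for such $\zeta$ the slice measure $\mu_\zeta$ is the unique measure in $M(\mathbb{T}^n)$ supported on the circle $\mathbb{T}\zeta=\{\xi\zeta:\xi\in\mathbb{T}\}\subset\mathbb{T}^n$ whose Poisson integral, under the identification $\xi\leftrightarrow\xi\zeta$ of $\mathbb{T}$ with $\mathbb{T}\zeta$, is $u_\zeta$; that is, \[ u_\zeta(\lambda)=\int_{\mathbb{T}\zeta}\frac{1-|\lambda|^2}{|\xi-\lambda|^2}\,d\mu_\zeta(\xi\zeta),\qquad \lambda\in\mathbb{D}. \] *)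

theory Defs
  imports "HOL-Analysis.Analysis"
begin

text \<open>
  A complex measure is a countably additive complex set function on the sigma-algebra of
  \<open>M\<close>; only \<open>space M\<close> and \<open>sets M\<close> are used here, never the measure carried by \<open>M\<close>.
  The value off \<open>sets M\<close> is normalised to 0, so that equality of functions is equality of
  measures. Taking the constant family of empty sets gives \<open>\<mu> {} = 0\<close>.
\<close>
definition complex_measure :: "'a measure \<Rightarrow> ('a set \<Rightarrow> complex) \<Rightarrow> bool" where
  "complex_measure M \<mu> \<longleftrightarrow>
     (\<forall>A. A \<notin> sets M \<longrightarrow> \<mu> A = 0) \<and>
     (\<forall>A :: nat \<Rightarrow> 'a set. range A \<subseteq> sets M \<longrightarrow> disjoint_family A \<longrightarrow>
        (\<lambda>i. \<mu> (A i)) sums \<mu> (\<Union>i. A i))"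

text \<open>
  The positive part in the Jordan decomposition of a finite signed measure \<open>\<nu>\<close>:
  \<open>\<nu>\<^sup>+ A\<close> is the supremum of \<open>\<nu> B\<close> over measurable \<open>B \<subseteq> A\<close>. The coercion \<open>ennreal\<close> sends
  negative values to 0, which does not change the supremum because \<open>\<nu> {} = 0\<close>.
\<close>
definition positive_part :: "'a measure \<Rightarrow> ('a set \<Rightarrow> real) \<Rightarrow> 'a measure" where
  "positive_part M \<nu> =
     measure_of (space M) (sets M) (\<lambda>A. SUP B \<in> {B \<in> sets M. B \<subseteq> A}. ennreal (\<nu> B))"

definition complex_measure_integral ::
    "'a measure \<Rightarrow> ('a set \<Rightarrow> complex) \<Rightarrow> ('a \<Rightarrow> complex) \<Rightarrow> complex" where
  "complex_measure_integral M \<mu> f =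
     ((\<integral>x. f x \<partial>positive_part M (\<lambda>A. Re (\<mu> A))) -
      (\<integral>x. f x \<partial>positive_part M (\<lambda>A. - Re (\<mu> A)))) +
     \<i> * ((\<integral>x. f x \<partial>positive_part M (\<lambda>A. Im (\<mu> A))) -
          (\<integral>x. f x \<partial>positive_part M (\<lambda>A. - Im (\<mu> A))))"

definition polydisc :: "(complex ^ 'n) set" where
  "polydisc = {z. \<forall>j. norm (z $ j) < 1}"

definition torus :: "(complex ^ 'n) set" where
  "torus = {\<zeta>. \<forall>j. norm (\<zeta> $ j) = 1}"

abbreviation torus_borel :: "(complex ^ 'n) measure" where
  "torus_borel \<equiv> restrict_space borel torus"

abbreviation circle_borel :: "complex measure" where
  "circle_borel \<equiv> restrict_space borel (sphere 0 1)"

definition torus_lebesgue :: "(complex ^ 'n) measure" where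
  "torus_lebesgue =
     distr (uniform_measure lborel (cbox 0 (\<chi> j. 2 * pi))) torus_borel
       (\<lambda>t :: real ^ 'n. \<chi> j. cis (t $ j))"

definition circle_lebesgue :: "complex measure" where
  "circle_lebesgue = distr (uniform_measure lborel {0..2 * pi}) circle_borel cis"

definition C2_on :: "'a::real_normed_vector set \<Rightarrow> ('a \<Rightarrow> 'b::real_normed_vector) \<Rightarrow> bool" where
  "C2_on S u \<longleftrightarrow>
     (\<exists>(u' :: 'a \<Rightarrow> 'a \<Rightarrow>\<^sub>L 'b) (u'' :: 'a \<Rightarrow> 'a \<Rightarrow>\<^sub>L ('a \<Rightarrow>\<^sub>L 'b)).
        (\<forall>x\<in>S. (u has_derivative blinfun_apply (u' x)) (at x)) \<and>
        (\<forall>x\<in>S. (u' has_derivative blinfun_apply (u'' x)) (at x)) \<and>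
        continuous_on S u'')"

definition directional_deriv ::
    "complex ^ 'n \<Rightarrow> (complex ^ 'n \<Rightarrow> complex) \<Rightarrow> complex ^ 'n \<Rightarrow> complex" where
  "directional_deriv v u z = vector_derivative (\<lambda>t :: real. u (z + t *\<^sub>R v)) (at 0)"

text \<open>
  The Wirtinger derivatives in the \<open>j\<close>-th variable \<open>z\<^sub>j = x\<^sub>j + i y\<^sub>j\<close>:
  \<open>(\<partial>/\<partial>x\<^sub>j - i \<partial>/\<partial>y\<^sub>j) / 2\<close> and \<open>(\<partial>/\<partial>x\<^sub>j + i \<partial>/\<partial>y\<^sub>j) / 2\<close>.
\<close>
definition wirtinger :: "'n \<Rightarrow> (complex ^ 'n \<Rightarrow> complex) \<Rightarrow> complex ^ 'n \<Rightarrow> complex" where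
  "wirtinger j u z =
     (directional_deriv (axis j 1) u z - \<i> * directional_deriv (axis j \<i>) u z) / 2"

definition wirtinger_bar :: "'n \<Rightarrow> (complex ^ 'n \<Rightarrow> complex) \<Rightarrow> complex ^ 'n \<Rightarrow> complex" where
  "wirtinger_bar j u z =
     (directional_deriv (axis j 1) u z + \<i> * directional_deriv (axis j \<i>) u z) / 2"

text \<open>Meaningful for open \<open>S\<close> only.\<close>
definition pluriharmonic_on ::
    "(complex ^ 'n) set \<Rightarrow> (complex ^ 'n \<Rightarrow> complex) \<Rightarrow> bool" where
  "pluriharmonic_on S u \<longleftrightarrow>
     C2_on S u \<and> (\<forall>z\<in>S. \<forall>j k. wirtinger j (wirtinger_bar k u) z = 0)"

definition poisson_kernel :: "complex ^ 'n \<Rightarrow> complex ^ 'n \<Rightarrow> real" where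
  "poisson_kernel z \<zeta> =
     (\<Prod>j\<in>UNIV. (1 - (norm (z $ j))\<^sup>2) / (norm (1 - z $ j * cnj (\<zeta> $ j)))\<^sup>2)"

definition poisson_integral ::
    "((complex ^ 'n) set \<Rightarrow> complex) \<Rightarrow> complex ^ 'n \<Rightarrow> complex" where
  "poisson_integral \<mu> z =
     complex_measure_integral torus_borel \<mu> (\<lambda>\<zeta>. of_real (poisson_kernel z \<zeta>))"

definition pluriharmonic_measure :: "((complex ^ 'n) set \<Rightarrow> complex) \<Rightarrow> bool" where
  "pluriharmonic_measure \<mu> \<longleftrightarrow>
     complex_measure torus_borel \<mu> \<and> pluriharmonic_on polydisc (poisson_integral \<mu>)"

definition slice_function ::
    "((complex ^ 'n) set \<Rightarrow> complex) \<Rightarrow> complex ^ 'n \<Rightarrow> complex \<Rightarrow> complex" where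
  "slice_function \<mu> \<zeta> w = poisson_integral \<mu> (w *s \<zeta>)"

definition slice_bounded ::
    "((complex ^ 'n) set \<Rightarrow> complex) \<Rightarrow> complex ^ 'n \<Rightarrow> bool" where
  "slice_bounded \<mu> \<zeta> \<longleftrightarrow>
     (SUP r \<in> {0<..<1 :: real}.
        \<integral>\<^sup>+\<xi>. ennreal (norm (slice_function \<mu> \<zeta> (of_real r * \<xi>))) \<partial>circle_lebesgue) < \<infinity>"

text \<open>
  The set function \<open>\<lambda>B. \<nu> ((\<lambda>\<xi>. \<xi> *s \<zeta>) ` B)\<close> is the measure on the unit circle which corresponds
  to \<open>\<nu>\<close> under the identification of \<open>\<xi>\<close> with \<open>\<xi> *s \<zeta>\<close>.
\<close>
definition is_slice_measure ::
    "((complex ^ 'n) set \<Rightarrow> complex) \<Rightarrow> complex ^ 'n \<Rightarrow> ((complex ^ 'n) set \<Rightarrow> complex) \<Rightarrow> bool" where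
  "is_slice_measure \<mu> \<zeta> \<nu> \<longleftrightarrow>
     complex_measure torus_borel \<nu> \<and>
     (\<forall>A. A \<inter> (\<lambda>\<xi>. \<xi> *s \<zeta>) ` sphere 0 1 = {} \<longrightarrow> \<nu> A = 0) \<and>
     (\<forall>w\<in>ball 0 1. slice_function \<mu> \<zeta> w =
        complex_measure_integral circle_borel (\<lambda>B. \<nu> ((\<lambda>\<xi>. \<xi> *s \<zeta>) ` B))
          (\<lambda>\<xi>. of_real ((1 - (norm w)\<^sup>2) / (norm (\<xi> - w))\<^sup>2)))"

text \<open>The zero measure stands in where the slice measure is not defined.\<close>
definition slice_measure ::
    "((complex ^ 'n) set \<Rightarrow> complex) \<Rightarrow> complex ^ 'n \<Rightarrow> (complex ^ 'n) set \<Rightarrow> complex" where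
  "slice_measure \<mu> \<zeta> =
     (if slice_bounded \<mu> \<zeta> then (THE \<nu>. is_slice_measure \<mu> \<zeta> \<nu>) else (\<lambda>_. 0))"

end

theory Submission
  imports Defs "HOL-Probability.Probability" "HOL-Complex_Analysis.Complex_Analysis"
begin

text \<open>
  Write \<open>u\<close> for the Poisson integral of \<open>\<mu>\<close>. For continuous \<open>f\<close>, the integral of \<open>f\<close> against \<open>\<mu>\<close> is the
  limit of the integrals of \<open>f(\<zeta>) u(r\<zeta>)\<close> over the torus as \<open>r \<rightarrow> 1\<close>, and by rotation invariance each of
  these is the average over \<open>\<zeta>\<close> of the integrals of \<open>f(\<xi>\<zeta>) u(r\<xi>\<zeta>)\<close> over the circle. As \<open>u\<close> is
  pluriharmonic, every slice \<open>w \<mapsto> u(w\<zeta>)\<close> is harmonic, so its circular \<open>L\<^sup>1\<close> means increase with the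
  radius; by monotone convergence their supremum is integrable in \<open>\<zeta>\<close>, hence finite almost everywhere.
  Where it is finite, the Herglotz theorem yields the slice measure, to which the circle integrals
  converge, and the supremum is the dominating function that lets the limit pass under the average.
\<close>

section \<open>Jordan decomposition of complex measures\<close>

text \<open>Integration against a complex measure is defined through the positive parts of its real
  and imaginary parts. These are minimal, and minimality need not survive push-forwards or weak
  limits. Everything is therefore carried out for arbitrary quadruples of finite measures with
  coefficients \<open>\<i> ^ k\<close>, once the integral is known not to depend on the quadruple.

  All convergence at the boundary rests on one estimate, shared by circle and torus: the second
  moment of the kernel about its pole tends to 0. On the circle the squared distance to a fixed
  point is the restriction of a harmonic function, so the Poisson formula computes its moment
  exactly; on the torus the squared distance splits into coordinates.

  Slice measures are given only by a description, so nothing is known beforehand about how they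
  depend on \<zeta>. Measurability of their integrals comes at the very end: they are pointwise
  limits of circle integrals where the supremum of the circle means is finite, and 0
  elsewhere.\<close>

lemma sets_positive_part [simp]: "sets (positive_part M \<nu>) = sets M"
  by (simp add: positive_part_def)

lemma space_positive_part [simp]: "space (positive_part M \<nu>) = space M"
  by (simp add: positive_part_def)

locale finite_signed_measure =
  fixes M :: "'a measure" and \<nu> :: "'a set \<Rightarrow> real"
  assumes sums: "range A \<subseteq> sets M \<Longrightarrow> disjoint_family A \<Longrightarrow> (\<lambda>i. \<nu> (A i)) sums \<nu> (\<Union>i. A i)"
begin

lemma empty [simp]: "\<nu> {} = 0"
proof -
  have "(\<lambda>i::nat. \<nu> {}) sums \<nu> (\<Union>i::nat. {})"
    by (rule sums) (auto simp: disjoint_family_on_def)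
  then have "(\<lambda>i::nat. \<nu> {}) \<longlonglongrightarrow> 0"
    by (blast intro: summable_LIMSEQ_zero sums_summable)
  then show ?thesis
    by (simp add: LIMSEQ_const_iff)
qed

lemma Un:
  assumes "A \<in> sets M" "B \<in> sets M" "A \<inter> B = {}"
  shows "\<nu> (A \<union> B) = \<nu> A + \<nu> B"
proof -
  have "(\<lambda>i. \<nu> (binaryset A B i)) sums \<nu> (\<Union>i. binaryset A B i)"
    using assms by (intro sums) (auto simp: range_binaryset_eq disjoint_family_on_def binaryset_def)
  moreover have "(\<lambda>i. \<nu> (binaryset A B i)) sums (\<nu> A + \<nu> B)"
    by (intro binaryset_sums) simp
  ultimately show ?thesis
    by (simp add: UN_binaryset_eq sums_unique2)
qed

lemma Diff:
  assumes "A \<in> sets M" "B \<in> sets M" "B \<subseteq> A"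
  shows "\<nu> (A - B) = \<nu> A - \<nu> B"
proof -
  have "B \<union> (A - B) = A"
    using assms by auto
  then show ?thesis
    using Un[of B "A - B"] assms by auto
qed

lemma uminus: "finite_signed_measure M (\<lambda>A. - \<nu> A)"
  by unfold_locales (intro sums_minus sums)

text \<open>If \<open>\<nu>\<close> were unbounded, repeatedly splitting the space would give disjoint sets of
  measure at least 1 in absolute value, against the convergence of the series.\<close>
lemma bounded: "\<exists>K. \<forall>A\<in>sets M. \<bar>\<nu> A\<bar> \<le> K"
proof -
  define good where "good E \<longleftrightarrow> (\<exists>K. \<forall>B\<in>sets M. B \<subseteq> E \<longrightarrow> \<bar>\<nu> B\<bar> \<le> K)" for E
  have step: "\<exists>A. (A \<in> sets M \<and> \<not> good A) \<and> A \<subseteq> E \<and> \<bar>\<nu> (E - A)\<bar> > 1"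
    if E: "E \<in> sets M" "\<not> good E" for E
  proof -
    \<comment> \<open>The margin \<open>\<bar>\<nu> E\<bar> + 1\<close> makes both \<open>B\<close>
      and \<open>E - B\<close> exceed 1 in absolute value. Whichever of the two is still unbounded
      can then be kept, the other being the piece that is split off.\<close>
    obtain B where B: "B \<in> sets M" "B \<subseteq> E" "\<bar>\<nu> B\<bar> > \<bar>\<nu> E\<bar> + 1"
      using E(2) unfolding good_def by (meson linorder_not_le)
    have D: "\<bar>\<nu> (E - B)\<bar> > 1" "E - (E - B) = B"
      using Diff[of E B] B E by auto
    have "\<not> good B \<or> \<not> good (E - B)"
    proof (rule ccontr)
      assume "\<not> ?thesis"
      then have "good B" "good (E - B)"
        by auto
      obtain K where K: "\<And>C. C \<in> sets M \<Longrightarrow> C \<subseteq> B \<Longrightarrow> \<bar>\<nu> C\<bar> \<le> K"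
        using \<open>good B\<close> unfolding good_def by metis
      obtain L where L: "\<And>C. C \<in> sets M \<Longrightarrow> C \<subseteq> E - B \<Longrightarrow> \<bar>\<nu> C\<bar> \<le> L"
        using \<open>good (E - B)\<close> unfolding good_def by metis
      have "\<bar>\<nu> C\<bar> \<le> K + L" if C: "C \<in> sets M" "C \<subseteq> E" for C
      proof -
        have "\<nu> ((C \<inter> B) \<union> (C - B)) = \<nu> (C \<inter> B) + \<nu> (C - B)"
          using B C by (intro Un) auto
        moreover have "(C \<inter> B) \<union> (C - B) = C"
          by auto
        ultimately show ?thesis
          using K[of "C \<inter> B"] L[of "C - B"] B C by fastforce
      qed
      then show False
        using E(2) unfolding good_def by blast
    qed
    then show ?thesis
    proof
      assume "\<not> good B"
      then show ?thesis
        using B D by blast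
    next
      assume "\<not> good (E - B)"
      moreover have "\<bar>\<nu> (E - (E - B))\<bar> > 1"
        using B(3) D(2) by simp
      ultimately show ?thesis
        using B(1) E(1) by blast
    qed
  qed
  have "good (space M)"
  proof (rule ccontr)
    assume "\<not> good (space M)"
    then have "\<exists>E. \<forall>n. (E n \<in> sets M \<and> \<not> good (E n)) \<and> (E (Suc n) \<subseteq> E n \<and> \<bar>\<nu> (E n - E (Suc n))\<bar> > 1)"
      by (intro dependent_nat_choice[of "\<lambda>_ E. E \<in> sets M \<and> \<not> good E" "\<lambda>_ E A. A \<subseteq> E \<and> \<bar>\<nu> (E - A)\<bar> > 1"])
        (blast, rule step, blast, blast)
    then obtain E where E: "\<And>n. E n \<in> sets M" "\<And>n. E (Suc n) \<subseteq> E n" "\<And>n. \<bar>\<nu> (E n - E (Suc n))\<bar> > 1"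
      by blast
    have anti: "antimono E"
      using E(2) by (simp add: decseq_Suc_iff)
    have disj: "disjoint_family (\<lambda>n. E n - E (Suc n))"
      unfolding disjoint_family_on_def
    proof safe
      fix m n :: nat and x assume "m \<noteq> n" "x \<in> E m" "x \<notin> E (Suc m)" "x \<in> E n" "x \<notin> E (Suc n)"
      then show "x \<in> {}"
      proof (induction m n rule: linorder_wlog)
        case (le a b)
        then have "E b \<subseteq> E (Suc a)"
          by (intro antimonoD[OF anti]) simp
        with le show ?case by blast
      next
        case (sym a b)
        then show ?case by blast
      qed
    qed
    have "(\<lambda>n. \<nu> (E n - E (Suc n))) sums \<nu> (\<Union>n. E n - E (Suc n))"
      using E(1) disj by (intro sums) auto
    then have "(\<lambda>n. \<nu> (E n - E (Suc n))) \<longlonglongrightarrow> 0"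
      by (blast intro: summable_LIMSEQ_zero sums_summable)
    from LIMSEQ_D[OF this zero_less_one] obtain n where "\<bar>\<nu> (E n - E (Suc n))\<bar> < 1"
      by auto
    then show False
      using E(3)[of n] by linarith
  qed
  then obtain K where "\<forall>B\<in>sets M. B \<subseteq> space M \<longrightarrow> \<bar>\<nu> B\<bar> \<le> K"
    unfolding good_def ..
  then show ?thesis
    by (intro exI[of _ K]) (simp add: sets.sets_into_space)
qed

abbreviation pos :: "'a set \<Rightarrow> ennreal" where
  "pos A \<equiv> SUP B \<in> {B \<in> sets M. B \<subseteq> A}. ennreal (\<nu> B)"

lemma pos_upper: "B \<in> sets M \<Longrightarrow> B \<subseteq> A \<Longrightarrow> ennreal (\<nu> B) \<le> pos A"
  by (intro SUP_upper) auto

text \<open>Competitors inside disjoint sets can be united. This is the superadditive half of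
  additivity.\<close>

lemma pos_add_le:
  assumes "A \<in> sets M" "B \<in> sets M" "A \<inter> B = {}"
  shows "pos A + pos B \<le> pos (A \<union> B)"
proof -
  have "ennreal (\<nu> C) + ennreal (\<nu> D) \<le> pos (A \<union> B)"
    if "C \<in> sets M" "C \<subseteq> A" "D \<in> sets M" "D \<subseteq> B" for C D
  proof -
    \<comment> \<open>\<open>ennreal\<close> truncates negative values to 0. Replacing a set of
      negative value by the empty set has the same effect and leaves two nonnegative values, which
      add without truncation.\<close>
    define C' D' where "C' = (if \<nu> C \<ge> 0 then C else {})" and "D' = (if \<nu> D \<ge> 0 then D else {})"
    have "ennreal (\<nu> C) + ennreal (\<nu> D) = ennreal (\<nu> C') + ennreal (\<nu> D')"
      by (auto simp: C'_def D'_def ennreal_neg)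
    also have "\<dots> = ennreal (\<nu> C' + \<nu> D')"
      by (auto simp: C'_def D'_def)
    also have "\<nu> C' + \<nu> D' = \<nu> (C' \<union> D')"
      using that assms by (intro Un[symmetric]) (auto simp: C'_def D'_def)
    also have "ennreal \<dots> \<le> pos (A \<union> B)"
      using that assms by (intro pos_upper) (auto simp: C'_def D'_def)
    finally show ?thesis .
  qed
  then have "(SUP D \<in> {D \<in> sets M. D \<subseteq> B}. SUP C \<in> {C \<in> sets M. C \<subseteq> A}. ennreal (\<nu> C) + ennreal (\<nu> D)) \<le> pos (A \<union> B)"
    by (intro SUP_least) auto
  moreover have "{C \<in> sets M. C \<subseteq> E} \<noteq> {}" for E
    by blast
  ultimately show ?thesis
    by (simp only: ennreal_SUP_add_left[symmetric] ennreal_SUP_add_right not_False_eq_True)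
qed

text \<open>\<open>measure_of\<close> has the intended values only once countable additivity is
  known. One inequality is superadditivity on finite unions; for the other, a competitor
  \<open>B\<close> inside the union is cut along the sets \<open>A i\<close>.\<close>

lemma emeasure_positive_part:
  assumes A: "A \<in> sets M"
  shows "emeasure (positive_part M \<nu>) A = pos A"
proof (rule emeasure_measure_of[OF positive_part_def])
  show "sets M \<subseteq> Pow (space M)"
    by (rule sets.space_closed)
  show "A \<in> sets (positive_part M \<nu>)"
    using A by (simp add: positive_part_def)
  show "positive (sets (positive_part M \<nu>)) pos"
    by (simp add: positive_def)
  show "countably_additive (sets (positive_part M \<nu>)) pos"
    unfolding countably_additive_def
  proof safe
    fix A :: "nat \<Rightarrow> 'a set"
    assume "range A \<subseteq> sets (positive_part M \<nu>)" and disj: "disjoint_family A"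
    then have A: "range A \<subseteq> sets M"
      by (simp add: positive_part_def)
    have "(\<Sum>i<n. pos (A i)) \<le> pos (\<Union>i<n. A i)" for n
    proof (induction n)
      case (Suc n)
      have "(\<Sum>i<Suc n. pos (A i)) \<le> pos (\<Union>i<n. A i) + pos (A n)"
        using Suc by (simp add: add_right_mono)
      also have "\<dots> \<le> pos ((\<Union>i<n. A i) \<union> A n)"
      proof (intro pos_add_le)
        show "(\<Union>i<n. A i) \<in> sets M" "A n \<in> sets M"
          using A by auto
        have "A i \<inter> A n = {}" if "i < n" for i
          using disj that by (intro disjoint_family_onD[OF disj]) auto
        then show "(\<Union>i<n. A i) \<inter> A n = {}"
          by blast
      qed
      also have "(\<Union>i<n. A i) \<union> A n = (\<Union>i<Suc n. A i)"
        by (auto simp: less_Suc_eq)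
      finally show ?case .
    qed simp
    also have "pos (\<Union>i<n. A i) \<le> pos (\<Union>i. A i)" for n
      by (intro SUP_subset_mono) auto
    finally have le: "(\<Sum>i. pos (A i)) \<le> pos (\<Union>i. A i)"
      by (intro suminf_le_const) auto
    have "ennreal (\<nu> B) \<le> (\<Sum>i. pos (A i))" if B: "B \<in> sets M" "B \<subseteq> (\<Union>i. A i)" for B
    proof -
      have "(\<lambda>i. \<nu> (B \<inter> A i)) sums \<nu> (\<Union>i. B \<inter> A i)"
      proof (rule sums)
        show "disjoint_family (\<lambda>i. B \<inter> A i)"
          using disj unfolding disjoint_family_on_def by blast
      qed (use A B in auto)
      also have "(\<Union>i. B \<inter> A i) = B"
        using B by auto
      finally have "(\<lambda>n. ennreal (\<Sum>i<n. \<nu> (B \<inter> A i))) \<longlonglongrightarrow> ennreal (\<nu> B)"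
        unfolding sums_def by (rule tendsto_ennrealI)
      moreover have "ennreal (\<Sum>i<n. \<nu> (B \<inter> A i)) \<le> (\<Sum>i. pos (A i))" for n
      proof -
        \<comment> \<open>Dropping the negative terms of the real sum matches the truncation of each
          summand by \<open>ennreal\<close>.\<close>
        have "ennreal (\<Sum>i<n. \<nu> (B \<inter> A i)) \<le> ennreal (\<Sum>i<n. max 0 (\<nu> (B \<inter> A i)))"
          by (intro ennreal_leI sum_mono) auto
        also have "\<dots> = (\<Sum>i<n. ennreal (\<nu> (B \<inter> A i)))"
          by (simp add: sum_ennreal[symmetric] del: sum_ennreal)
        also have "\<dots> \<le> (\<Sum>i<n. pos (A i))"
          using A B by (intro sum_mono pos_upper) auto
        also have "\<dots> \<le> (\<Sum>i. pos (A i))"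
          by (intro sum_le_suminf) auto
        finally show ?thesis .
      qed
      ultimately show ?thesis
        by (intro LIMSEQ_le_const2) auto
    qed
    then show "(\<Sum>i. pos (A i)) = pos (\<Union>i. A i)"
      by (intro antisym le SUP_least) auto
  qed
qed

lemma finite_measure_positive_part: "finite_measure (positive_part M \<nu>)"
proof
  obtain K where K: "\<forall>A\<in>sets M. \<bar>\<nu> A\<bar> \<le> K"
    using bounded ..
  have "pos (space M) \<le> ennreal K"
  proof (intro SUP_least ennreal_leI)
    fix B assume "B \<in> {B \<in> sets M. B \<subseteq> space M}"
    with K show "\<nu> B \<le> K" by (auto intro: order_trans[OF abs_ge_self])
  qed
  then show "emeasure (positive_part M \<nu>) (space (positive_part M \<nu>)) \<noteq> \<infinity>"
    by (simp only: emeasure_positive_part sets.top space_positive_part) (auto simp only: top_unique ennreal_neq_top infinity_ennreal_def)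
qed

text \<open>For \<open>B \<subseteq> A\<close> one has
  \<open>\<nu> B = \<nu> A - \<nu> (A - B)\<close>, and \<open>- \<nu> (A - B)\<close> is at most
  the negative part of \<open>A\<close>; take the supremum over \<open>B\<close>. Applied to \<nu>
  and to its negative, this gives the Jordan decomposition without a Hahn set.\<close>

lemma measure_positive_part_le:
  assumes A: "A \<in> sets M"
  shows "measure (positive_part M \<nu>) A \<le> \<nu> A + measure (positive_part M (\<lambda>A. - \<nu> A)) A"
proof -
  interpret neg: finite_signed_measure M "\<lambda>A. - \<nu> A"
    by (rule uminus)
  interpret P: finite_measure "positive_part M \<nu>"
    by (rule finite_measure_positive_part)
  interpret N: finite_measure "positive_part M (\<lambda>A. - \<nu> A)"
    by (rule neg.finite_measure_positive_part)
  let ?N = "measure (positive_part M (\<lambda>A. - \<nu> A)) A"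
  have le: "- \<nu> C \<le> ?N" if "C \<in> sets M" "C \<subseteq> A" for C
  proof -
    have "ennreal (- \<nu> C) \<le> emeasure (positive_part M (\<lambda>A. - \<nu> A)) A"
      using that A neg.pos_upper[of C A] by (simp add: neg.emeasure_positive_part)
    then show ?thesis
      by (simp add: N.emeasure_eq_measure)
  qed
  have "pos A \<le> ennreal (\<nu> A + ?N)"
  proof (intro SUP_least ennreal_leI)
    fix B assume B: "B \<in> {B \<in> sets M. B \<subseteq> A}"
    then show "\<nu> B \<le> \<nu> A + ?N"
      using le[of "A - B"] Diff[of A B] A by auto
  qed
  moreover have "0 \<le> \<nu> A + ?N"
    using le[of A] A by simp
  ultimately show ?thesis
    using A by (simp add: emeasure_positive_part[symmetric] P.emeasure_eq_measure)
qed

lemma Jordan_decomposition: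
  assumes A: "A \<in> sets M"
  shows "\<nu> A = measure (positive_part M \<nu>) A - measure (positive_part M (\<lambda>A. - \<nu> A)) A"
proof -
  interpret neg: finite_signed_measure M "\<lambda>A. - \<nu> A"
    by (rule uminus)
  show ?thesis
    using measure_positive_part_le[OF A] neg.measure_positive_part_le[OF A] by simp
qed

end

section \<open>Integration against complex measures\<close>

lemma sum_lessThan_4: "(\<Sum>k<4. g k) = g 0 + g 1 + g 2 + g (3::nat)" for g :: "nat \<Rightarrow> 'a::comm_monoid_add"
  by (simp add: eval_nat_numeral ac_simps)

lemma integrable_bounded:
  fixes f :: "'a \<Rightarrow> 'b::{banach, second_countable_topology}"
  assumes "finite_measure M" "f \<in> borel_measurable N" "sets M = sets N"
    "\<And>x. x \<in> space N \<Longrightarrow> norm (f x) \<le> B"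
  shows "integrable M f"
proof -
  have "f \<in> borel_measurable M"
    using assms(2,3) measurable_cong_sets by blast
  then show ?thesis
    using assms(1,4) sets_eq_imp_space_eq[OF assms(3)]
    by (intro finite_measure.integrable_const_bound[of _ _ B]) auto
qed

text \<open>An identity between combinations of measures extends to simple functions through their
  level sets, and then to bounded functions by dominated convergence. It makes integrals independent
  of the positive measures that represent a complex one.\<close>

lemma integral_linear_combination_eqI:
  fixes f :: "'a \<Rightarrow> complex" and p :: "'i \<Rightarrow> 'a measure" and q :: "'j \<Rightarrow> 'a measure"
  assumes p: "\<And>i. i \<in> I \<Longrightarrow> finite_measure (p i) \<and> sets (p i) = sets M"
    and q: "\<And>j. j \<in> J \<Longrightarrow> finite_measure (q j) \<and> sets (q j) = sets M"
    and eq: "\<And>A. A \<in> sets M \<Longrightarrow>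
      (\<Sum>i\<in>I. c i * of_real (measure (p i) A)) = (\<Sum>j\<in>J. d j * of_real (measure (q j) A))"
    and f: "f \<in> borel_measurable M" and B: "\<And>x. x \<in> space M \<Longrightarrow> norm (f x) \<le> B"
  shows "(\<Sum>i\<in>I. c i * (\<integral>x. f x \<partial>p i)) = (\<Sum>j\<in>J. d j * (\<integral>x. f x \<partial>q j))"
proof -
  \<comment> \<open>The simple functions are only known to stay within twice the distance of
    \<open>f\<close> from 0, whence the dominating constant \<open>2 * B\<close>.\<close>
  obtain F where F: "\<And>n. simple_function M (F n)" "\<And>x. x \<in> space M \<Longrightarrow> (\<lambda>n. F n x) \<longlonglongrightarrow> f x"
      "\<And>n x. x \<in> space M \<Longrightarrow> dist (F n x) 0 \<le> 2 * dist (f x) 0"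
    using borel_measurable_implies_sequence_metric[OF f] by blast
  have simple: "(\<integral>x. F n x \<partial>r) = (\<Sum>y\<in>F n ` space M. of_real (measure r {x\<in>space M. F n x = y}) * y)"
    if r: "finite_measure r" "sets r = sets M" for r n
  proof -
    have "simple_function r (F n)"
      using F(1)[of n] r(2) simple_function_cong_algebra sets_eq_imp_space_eq by blast
    then have "Bochner_Integration.simple_bochner_integrable r (F n)"
      using finite_measure.emeasure_finite[OF r(1)]
      by (simp add: Bochner_Integration.simple_bochner_integrable.simps)
    then have "(\<integral>x. F n x \<partial>r) = Bochner_Integration.simple_bochner_integral r (F n)"
      by (rule simple_bochner_integrable_eq_integral[symmetric])
    then show ?thesis
      by (simp add: Bochner_Integration.simple_bochner_integral_def sets_eq_imp_space_eq[OF r(2)] scaleR_conv_of_real)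
  qed
  have lim: "(\<lambda>n. \<integral>x. F n x \<partial>r) \<longlonglongrightarrow> (\<integral>x. f x \<partial>r)"
    if r: "finite_measure r" "sets r = sets M" for r
  proof (rule integral_dominated_convergence[where w = "\<lambda>x. 2 * B"])
    show "f \<in> borel_measurable r" "F n \<in> borel_measurable r" for n
      using f borel_measurable_simple_function[OF F(1)[of n]] measurable_cong_sets[OF r(2) refl] by blast+
    show "integrable r (\<lambda>x. 2 * B)"
      using r(1) by (rule finite_measure.integrable_const)
    show "AE x in r. (\<lambda>n. F n x) \<longlonglongrightarrow> f x"
      using F(2) sets_eq_imp_space_eq[OF r(2)] by auto
    have "norm (F n x) \<le> 2 * B" if "x \<in> space M" for n x
      using F(3)[OF that, of n] B[OF that] by simp
    then show "AE x in r. norm (F n x) \<le> 2 * B" for n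
      using sets_eq_imp_space_eq[OF r(2)] by auto
  qed
  have "(\<Sum>i\<in>I. c i * (\<integral>x. F n x \<partial>p i)) = (\<Sum>j\<in>J. d j * (\<integral>x. F n x \<partial>q j))" for n
  proof -
    have m: "{x \<in> space M. F n x = y} \<in> sets M" for y
    proof -
      have "F n -` {y} \<inter> space M \<in> sets M"
        by (rule simple_functionD(2)[OF F(1)])
      also have "F n -` {y} \<inter> space M = {x \<in> space M. F n x = y}"
        by auto
      finally show ?thesis .
    qed
    have "(\<Sum>i\<in>I. c i * (\<integral>x. F n x \<partial>p i)) =
        (\<Sum>y\<in>F n ` space M. (\<Sum>i\<in>I. c i * of_real (measure (p i) {x\<in>space M. F n x = y})) * y)"
      using p by (simp add: simple sum_distrib_left sum_distrib_right mult.assoc sum.swap[of _ "F n ` space M"])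
    also have "\<dots> = (\<Sum>y\<in>F n ` space M. (\<Sum>j\<in>J. d j * of_real (measure (q j) {x\<in>space M. F n x = y})) * y)"
      using m by (simp add: eq)
    also have "\<dots> = (\<Sum>j\<in>J. d j * (\<integral>x. F n x \<partial>q j))"
      using q by (simp add: simple sum_distrib_left sum_distrib_right mult.assoc sum.swap[of _ "F n ` space M"])
    finally show ?thesis .
  qed
  moreover have "(\<lambda>n. \<Sum>i\<in>I. c i * (\<integral>x. F n x \<partial>p i)) \<longlonglongrightarrow> (\<Sum>i\<in>I. c i * (\<integral>x. f x \<partial>p i))"
    using p by (intro tendsto_sum tendsto_mult tendsto_const lim) auto
  moreover have "(\<lambda>n. \<Sum>j\<in>J. d j * (\<integral>x. F n x \<partial>q j)) \<longlonglongrightarrow> (\<Sum>j\<in>J. d j * (\<integral>x. f x \<partial>q j))"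
    using q by (intro tendsto_sum tendsto_mult tendsto_const lim) auto
  ultimately show ?thesis
    using LIMSEQ_unique by auto
qed

text \<open>The four measures need not be mutually singular or minimal, so the notion is stable
  under images and can be established from any explicit construction. Powers of \<i> as coefficients
  replace four separate cases by one sum.\<close>

definition jordan_parts :: "'a measure \<Rightarrow> (nat \<Rightarrow> 'a measure) \<Rightarrow> ('a set \<Rightarrow> complex) \<Rightarrow> bool" where
  "jordan_parts M p \<nu> \<longleftrightarrow> (\<forall>k<4. finite_measure (p k) \<and> sets (p k) = sets M) \<and>
     (\<forall>A\<in>sets M. \<nu> A = (\<Sum>k<4. \<i> ^ k * of_real (measure (p k) A)))"

lemma jordan_partsD:
  assumes "jordan_parts M p \<nu>"
  shows "k < 4 \<Longrightarrow> finite_measure (p k)" "k < 4 \<Longrightarrow> sets (p k) = sets M" "k < 4 \<Longrightarrow> space (p k) = space M"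
    "A \<in> sets M \<Longrightarrow> \<nu> A = (\<Sum>k<4. \<i> ^ k * of_real (measure (p k) A))"
  using assms sets_eq_imp_space_eq[of "p k" M] unfolding jordan_parts_def by auto

lemma jordan_parts_sums:
  assumes p: "jordan_parts M p \<nu>" and A: "range A \<subseteq> sets M" "disjoint_family A"
  shows "(\<lambda>i. \<nu> (A i)) sums \<nu> (\<Union>i. A i)"
proof -
  have "(\<lambda>i. \<Sum>k<4. \<i> ^ k * complex_of_real (measure (p k) (A i))) sums
      (\<Sum>k<4. \<i> ^ k * of_real (measure (p k) (\<Union>i. A i)))"
    using A jordan_partsD[OF p]
    by (intro sums_sum sums_mult sums_of_real finite_measure.finite_measure_UNION) auto
  moreover have "A i \<in> sets M" for i
    using A by auto
  ultimately show ?thesis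
    using jordan_partsD(4)[OF p] by (simp add: sets.countable_UN)
qed

lemma complex_measureI:
  assumes "jordan_parts M p \<nu>" "\<And>A. A \<notin> sets M \<Longrightarrow> \<nu> A = 0"
  shows "complex_measure M \<nu>"
  unfolding complex_measure_def using assms jordan_parts_sums by blast

text \<open>Division by \<open>\<i> ^ k\<close> turns the real part into \<open>Re\<close>,
  \<open>Im\<close>, \<open>- Re\<close>, \<open>- Im\<close> for \<open>k = 0, 1, 2, 3\<close>, so
  these are exactly the four measures inside \<open>complex_measure_integral\<close>.\<close>

definition canonical_parts :: "'a measure \<Rightarrow> ('a set \<Rightarrow> complex) \<Rightarrow> nat \<Rightarrow> 'a measure" where
  "canonical_parts M \<nu> k = positive_part M (\<lambda>A. Re (\<nu> A / \<i> ^ k))"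

lemma jordan_parts_canonical:
  assumes "\<And>A. range A \<subseteq> sets M \<Longrightarrow> disjoint_family A \<Longrightarrow> (\<lambda>i. \<nu> (A i)) sums \<nu> (\<Union>i. A i)"
  shows "jordan_parts M (canonical_parts M \<nu>) \<nu>"
  unfolding jordan_parts_def
proof (intro conjI allI impI ballI)
  have signed: "finite_signed_measure M (\<lambda>A. Re (\<nu> A / \<i> ^ k))" for k
    using assms by (auto intro!: finite_signed_measure.intro sums_Re sums_divide)
  show "finite_measure (canonical_parts M \<nu> k)" for k
    unfolding canonical_parts_def by (intro finite_signed_measure.finite_measure_positive_part signed)
  show "sets (canonical_parts M \<nu> k) = sets M" for k
    by (simp add: canonical_parts_def)
  fix A assume A: "A \<in> sets M"
  show "\<nu> A = (\<Sum>k<4. \<i> ^ k * of_real (measure (canonical_parts M \<nu> k) A))"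
    using finite_signed_measure.Jordan_decomposition[OF signed[of 0] A]
      finite_signed_measure.Jordan_decomposition[OF signed[of 1] A]
    by (simp add: sum_lessThan_4 canonical_parts_def complex_eq_iff power3_eq_cube)
qed

lemma complex_measure_jordan_parts:
  assumes "complex_measure M \<nu>"
  obtains p where "jordan_parts M p \<nu>"
  using assms jordan_parts_canonical that unfolding complex_measure_def by metis

text \<open>The canonical parts and \<open>p\<close> represent the same set function, hence give the
  same integral of a bounded function. Later computations may use whichever parts are at
  hand.\<close>

lemma complex_measure_integral_eq:
  assumes p: "jordan_parts M p \<nu>" and f: "f \<in> borel_measurable M" "\<And>x. x \<in> space M \<Longrightarrow> norm (f x) \<le> B"
  shows "complex_measure_integral M \<nu> f = (\<Sum>k<4. \<i> ^ k * (\<integral>x. f x \<partial>p k))"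
proof -
  have q: "jordan_parts M (canonical_parts M \<nu>) \<nu>"
    using p by (intro jordan_parts_canonical jordan_parts_sums)
  have "complex_measure_integral M \<nu> f = (\<Sum>k<4. \<i> ^ k * (\<integral>x. f x \<partial>canonical_parts M \<nu> k))"
    by (simp add: complex_measure_integral_def canonical_parts_def sum_lessThan_4 power3_eq_cube algebra_simps)
  also have "\<dots> = (\<Sum>k<4. \<i> ^ k * (\<integral>x. f x \<partial>p k))"
    using jordan_partsD[OF p] jordan_partsD[OF q] f
    by (intro integral_linear_combination_eqI[where M = M and B = B]) auto
  finally show ?thesis .
qed

lemma jordan_parts_distr:
  assumes p: "jordan_parts M p \<nu>" and g: "g \<in> measurable M N"
    and \<kappa>: "\<And>B. B \<in> sets N \<Longrightarrow> \<kappa> B = \<nu> (g -` B \<inter> space M)"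
  shows "jordan_parts N (\<lambda>k. distr (p k) N g) \<kappa>"
proof -
  have g': "g \<in> measurable (p k) N" if "k < 4" for k
    using g measurable_cong_sets[OF jordan_partsD(2)[OF p that] refl] by blast
  show ?thesis
    unfolding jordan_parts_def
  proof (intro conjI allI impI ballI)
    show "finite_measure (distr (p k) N g)" if "k < 4" for k
      using that jordan_partsD(1)[OF p] g' by (intro finite_measure.finite_measure_distr)
    fix B assume B: "B \<in> sets N"
    then have "g -` B \<inter> space M \<in> sets M"
      using g by (rule measurable_sets[rotated])
    then show "\<kappa> B = (\<Sum>k<4. \<i> ^ k * of_real (measure (distr (p k) N g) B))"
      using B g' jordan_partsD(3,4)[OF p] by (simp add: \<kappa> measure_distr)
  qed simp
qed

lemma complex_measure_integral_distr:
  assumes p: "jordan_parts M p \<nu>" and g: "g \<in> measurable M N"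
    and \<kappa>: "\<And>B. B \<in> sets N \<Longrightarrow> \<kappa> B = \<nu> (g -` B \<inter> space M)"
    and f: "f \<in> borel_measurable N" "\<And>x. x \<in> space N \<Longrightarrow> norm (f x) \<le> B"
  shows "complex_measure_integral N \<kappa> f = complex_measure_integral M \<nu> (\<lambda>x. f (g x))"
proof -
  have g': "g \<in> measurable (p k) N" if "k < 4" for k
    using g measurable_cong_sets[OF jordan_partsD(2)[OF p that] refl] by blast
  have "complex_measure_integral N \<kappa> f = (\<Sum>k<4. \<i> ^ k * (\<integral>x. f x \<partial>distr (p k) N g))"
    by (rule complex_measure_integral_eq[OF jordan_parts_distr[OF p g \<kappa>] f])
  also have "\<dots> = (\<Sum>k<4. \<i> ^ k * (\<integral>x. f (g x) \<partial>p k))"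
    using g' f(1) by (intro sum.cong) (auto simp: integral_distr)
  also have "\<dots> = complex_measure_integral M \<nu> (\<lambda>x. f (g x))"
    using f measurable_compose[OF g f(1)] measurable_space[OF g]
    by (intro complex_measure_integral_eq[OF p, symmetric]) auto
  finally show ?thesis .
qed

section \<open>Complex measures on compact sets and continuous test functions\<close>

lemma compact_bounded_continuous:
  fixes f :: "'a::metric_space \<Rightarrow> 'b::real_normed_vector"
  assumes "compact X" "continuous_on X f"
  obtains B where "B > 0" "\<And>x. x \<in> X \<Longrightarrow> norm (f x) \<le> B"
proof -
  have "bounded (f ` X)"
    using assms compact_continuous_image compact_imp_bounded by blast
  then show ?thesis
    using that unfolding bounded_pos by blast
qed

text \<open>Closed subsets of \<open>X\<close> form an intersection-stable generator, and the
  indicator of a closed set is the bounded pointwise limit of the continuous functions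
  \<open>max 0 (1 - n * infdist x A)\<close>.\<close>

lemma complex_measure_eqI_continuous:
  fixes X :: "'a::metric_space set"
  assumes X: "compact X"
    and p: "jordan_parts (restrict_space borel X) p \<nu>" and q: "jordan_parts (restrict_space borel X) q \<nu>'"
    and eq: "\<And>f :: 'a \<Rightarrow> complex. continuous_on X f \<Longrightarrow>
      (\<Sum>k<4. \<i> ^ k * (\<integral>x. f x \<partial>p k)) = (\<Sum>k<4. \<i> ^ k * (\<integral>x. f x \<partial>q k))"
    and A: "A \<in> sets (restrict_space borel X)"
  shows "\<nu> A = \<nu>' A"
proof -
  let ?M = "restrict_space borel X"
  have Xb: "X \<in> sets borel"
    using X by (simp add: compact_imp_closed)
  define G where "G = (\<inter>) X ` Collect closed"
  have sets: "sets ?M = sigma_sets X G"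
    using sigma_sets_Int[of X UNIV "Collect closed"] Xb
    by (simp add: G_def sets_restrict_space borel_eq_closed)
  have "Int_stable G"
  proof (rule Int_stableI)
    fix a b assume "a \<in> G" "b \<in> G"
    then obtain c d where "closed c" "closed d" "a = X \<inter> c" "b = X \<inter> d"
      by (auto simp: G_def)
    then have "closed (c \<inter> d)" "a \<inter> b = X \<inter> (c \<inter> d)"
      by (auto simp: closed_Int)
    then show "a \<inter> b \<in> G"
      by (auto simp: G_def)
  qed
  moreover have "G \<subseteq> Pow X"
    by (auto simp: G_def)
  moreover have "A \<in> sigma_sets X G"
    using A sets by simp
  ultimately show ?thesis
  proof (induction rule: sigma_sets_induct_disjoint)
    case (basic A)
    then have clA: "closed A" "A \<subseteq> X"
      using X by (auto simp: G_def compact_imp_closed)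
    have AM: "A \<in> sets ?M"
      using clA Xb by (simp add: sets_restrict_space_iff)
    show ?case
    \<comment> \<open>The empty set is treated apart because \<open>infdist x {}\<close> is 0: the
      approximating functions would be constantly 1.\<close>
    proof (cases "A = {}")
      case True
      then show ?thesis
        using jordan_partsD(4)[OF p, of A] jordan_partsD(4)[OF q, of A] by simp
    next
      case False
      define \<phi> where "\<phi> n x = complex_of_real (max 0 (1 - real n * infdist x A))" for n x
      have cont: "continuous_on X (\<phi> n)" for n
        unfolding \<phi>_def by (intro continuous_intros)
      have lim: "(\<lambda>n. \<integral>x. \<phi> n x \<partial>r) \<longlonglongrightarrow> of_real (measure r A)"
        if r: "finite_measure r" "sets r = sets ?M" for r
      proof -
        have "(\<lambda>n. \<integral>x. \<phi> n x \<partial>r) \<longlonglongrightarrow> (\<integral>x. indicator A x \<partial>r)"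
        proof (rule integral_dominated_convergence[where w = "\<lambda>x. 1"])
          show "(indicator A :: 'a \<Rightarrow> complex) \<in> borel_measurable r"
            using AM r(2) by simp
          have "\<phi> n \<in> borel_measurable ?M" for n
            using cont by (rule borel_measurable_continuous_on_restrict)
          then show "\<phi> n \<in> borel_measurable r" for n
            using measurable_cong_sets[OF r(2) refl] by blast
          show "integrable r (\<lambda>x. 1 :: real)"
            using r(1) by (rule finite_measure.integrable_const)
          have "(\<lambda>n. \<phi> n x) \<longlonglongrightarrow> indicator A x" for x
          proof (cases "x \<in> A")
            case True
            then show ?thesis
              by (simp add: \<phi>_def)
          next
            case False
            then have pos: "infdist x A > 0"
              using clA \<open>A \<noteq> {}\<close> in_closed_iff_infdist_zero[of A x] infdist_nonneg[of x A] by force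
            obtain N where N: "1 < real N * infdist x A"
              using reals_Archimedean3[OF pos] by blast
            have "\<phi> n x = 0" if "n \<ge> N" for n
            proof -
              have "real N * infdist x A \<le> real n * infdist x A"
                using that pos by (intro mult_right_mono) auto
              then show ?thesis
                using N by (simp add: \<phi>_def)
            qed
            then have "\<forall>\<^sub>F n in sequentially. \<phi> n x = indicator A x"
              using False by (auto simp: eventually_sequentially)
            then show ?thesis
              by (rule tendsto_eventually)
          qed
          then show "AE x in r. (\<lambda>n. \<phi> n x) \<longlonglongrightarrow> indicator A x"
            by simp
          have "norm (\<phi> n x) \<le> 1" for n x
            unfolding \<phi>_def norm_of_real using infdist_nonneg[of x A] by (auto simp: max_def)
          then show "AE x in r. norm (\<phi> n x) \<le> 1" for n
            by simp
        qed
        also have "(\<integral>x. indicator A x \<partial>r) = (\<integral>x. complex_of_real (indicator A x) \<partial>r)"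
          by (intro Bochner_Integration.integral_cong) (auto simp: indicator_def)
        also have "\<dots> = complex_of_real (measure r A)"
          using AM r(2) by (simp add: sets.Int_space_eq2)
        finally show ?thesis .
      qed
      have "(\<lambda>n. \<Sum>k<4. \<i> ^ k * (\<integral>x. \<phi> n x \<partial>p k)) \<longlonglongrightarrow> (\<Sum>k<4. \<i> ^ k * of_real (measure (p k) A))"
        using jordan_partsD[OF p] by (intro tendsto_sum tendsto_mult tendsto_const lim) auto
      moreover have "(\<lambda>n. \<Sum>k<4. \<i> ^ k * (\<integral>x. \<phi> n x \<partial>q k)) \<longlonglongrightarrow> (\<Sum>k<4. \<i> ^ k * of_real (measure (q k) A))"
        using jordan_partsD[OF q] by (intro tendsto_sum tendsto_mult tendsto_const lim) auto
      ultimately show ?thesis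
        using LIMSEQ_unique AM by (simp add: eq[OF cont] jordan_partsD(4)[OF p] jordan_partsD(4)[OF q])
    qed
  next
    case empty
    then show ?case
      using jordan_partsD(4)[OF p, of "{}"] jordan_partsD(4)[OF q, of "{}"] by simp
  next
    case (compl A)
    have space: "space ?M = X"
      by (simp add: space_restrict_space)
    \<comment> \<open>Complements need equal total masses, which come from the test function
      1.\<close>
    have X_eq: "\<nu> X = \<nu>' X"
    proof -
      have "(\<integral>x. 1 \<partial>r) = complex_of_real (measure r X)" if "space r = space ?M" for r
        using that space by (simp add: scaleR_conv_of_real)
      then show ?thesis
        using eq[of "\<lambda>_. 1"] jordan_partsD(3,4)[OF p] jordan_partsD(3,4)[OF q] sets.top[of ?M] space
        by simp
    qed
    have compl_eq: "\<rho> (X - A) = \<rho> X - \<rho> A" if r: "jordan_parts ?M r \<rho>" for r \<rho>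
    proof -
      have m: "measure (r k) (X - A) = measure (r k) X - measure (r k) A" if "k < 4" for k
        using that jordan_partsD(1-3)[OF r that] compl.hyps sets space
        by (metis finite_measure.finite_measure_compl)
      have "X \<in> sets ?M" "A \<in> sets ?M" "X - A \<in> sets ?M"
        using compl.hyps sets space sets.top[of ?M] by (auto intro: sets.Diff)
      then show ?thesis
        using m by (simp add: jordan_partsD(4)[OF r] sum_subtractf right_diff_distrib)
    qed
    show ?case
      using compl_eq[OF p] compl_eq[OF q] X_eq compl.IH by simp
  next
    case (union A)
    have "(\<lambda>i. \<nu> (A i)) sums \<nu> (\<Union>i. A i)" "(\<lambda>i. \<nu>' (A i)) sums \<nu>' (\<Union>i. A i)"
      using union.hyps sets by (auto intro!: jordan_parts_sums[OF p] jordan_parts_sums[OF q])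
    then show ?case
      using union.IH sums_unique2 by simp
  qed
qed

lemma complex_measure_integral_continuous:
  fixes X :: "'a::metric_space set"
  assumes p: "jordan_parts (restrict_space borel X) p \<nu>" and X: "compact X" and f: "continuous_on X f"
  shows "complex_measure_integral (restrict_space borel X) \<nu> f = (\<Sum>k<4. \<i> ^ k * (\<integral>x. f x \<partial>p k))"
proof -
  obtain B where "\<And>x. x \<in> X \<Longrightarrow> norm (f x) \<le> B"
    using compact_bounded_continuous[OF X f] by metis
  then show ?thesis
    by (intro complex_measure_integral_eq[OF p borel_measurable_continuous_on_restrict[OF f], of B])
      (simp add: space_restrict_space)
qed

lemma jordan_parts_additive:
  assumes p: "jordan_parts M p \<nu>" and "A \<in> sets M" "B \<in> sets M" "A \<inter> B = {}"
  shows "\<nu> (A \<union> B) = \<nu> A + \<nu> B"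
proof -
  have "measure (p k) (A \<union> B) = measure (p k) A + measure (p k) B" if "k < 4" for k
    using assms jordan_partsD[OF p] that by (intro finite_measure.finite_measure_Union) auto
  then show ?thesis
    using assms by (simp add: jordan_partsD(4)[OF p] sum.distrib distrib_left)
qed

section \<open>The Poisson kernel of the disc\<close>

lemma cis_measurable: "cis \<in> measurable borel circle_borel"
  by (intro measurable_restrict_space2 borel_measurable_continuous_onI continuous_intros) auto

lemma sets_circle_lebesgue [measurable_cong]: "sets circle_lebesgue = sets circle_borel"
  by (simp add: circle_lebesgue_def)

lemma space_circle_lebesgue [simp]: "space circle_lebesgue = sphere 0 1"
  by (simp add: circle_lebesgue_def space_restrict_space)

lemma prob_space_circle_lebesgue: "prob_space circle_lebesgue"
  unfolding circle_lebesgue_def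
proof (rule prob_space.prob_space_distr)
  show "prob_space (uniform_measure lborel {0..2 * pi})"
    by (rule prob_space_uniform_measure) auto
qed (use cis_measurable in simp)

lemma nn_integral_circle_lebesgue:
  assumes [measurable]: "g \<in> borel_measurable circle_borel"
  shows "(\<integral>\<^sup>+\<xi>. g \<xi> \<partial>circle_lebesgue) = (\<integral>\<^sup>+t. g (cis t) * indicator {0..2*pi} t \<partial>lborel) / ennreal (2 * pi)"
proof -
  have [measurable]: "cis \<in> measurable borel circle_borel"
    by (rule cis_measurable)
  show ?thesis
    unfolding circle_lebesgue_def
    by (simp add: nn_integral_distr nn_integral_uniform_measure)
qed

text \<open>A bridge from contour integration, which yields gauge integrals over the parameter
  interval, to the normalised measure on the circle; hence the factor \<open>2 * pi\<close>.\<close>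

lemma integral_circle_lebesgue:
  fixes g :: "complex \<Rightarrow> complex" and I :: complex
  assumes g: "continuous_on (sphere 0 1) g" and I: "((\<lambda>t. g (cis t)) has_integral 2 * pi * I) {0..2 * pi}"
  shows "(\<integral>\<xi>. g \<xi> \<partial>circle_lebesgue) = I"
proof -
  have [measurable]: "cis \<in> measurable borel circle_borel"
    by (rule cis_measurable)
  have [measurable]: "g \<in> borel_measurable circle_borel"
    by (rule borel_measurable_continuous_on_restrict[OF g])
  have gm: "(\<lambda>t. g (cis t)) \<in> borel_measurable borel"
    by measurable
  have cont: "continuous_on UNIV (\<lambda>t. g (cis t))"
    by (intro continuous_on_compose2[OF g] continuous_intros) auto
  have int: "set_integrable lborel {0..2*pi} (\<lambda>t. g (cis t))"
    by (intro borel_integrable_atLeastAtMost' continuous_on_subset[OF cont]) auto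
  have "(\<integral>\<xi>. g \<xi> \<partial>circle_lebesgue) = (\<integral>t. g (cis t) \<partial>uniform_measure lborel {0..2 * pi})"
    unfolding circle_lebesgue_def by (subst integral_distr) auto
  also have "\<dots> = (\<integral>t. (indicator {0..2*pi} t / (2 * pi)) *\<^sub>R g (cis t) \<partial>lborel)"
  proof -
    have "uniform_measure lborel {0..2*pi} = density lborel (\<lambda>t::real. ennreal (indicator {0..2*pi} t / (2 * pi)))"
      unfolding uniform_measure_def
      by (intro density_cong) (auto simp: indicator_def divide_ennreal[symmetric])
    then show ?thesis
      using gm by (simp add: integral_density)
  qed
  also have "\<dots> = (1 / (2 * pi)) *\<^sub>R (LINT t:{0..2*pi}|lborel. g (cis t))"
    unfolding set_lebesgue_integral_def by (simp flip: integral_scaleR_right)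
  also have "(LINT t:{0..2*pi}|lborel. g (cis t)) = 2 * pi * I"
    using set_borel_integral_eq_integral(2)[OF int] I by (simp add: integral_unique)
  finally show ?thesis
    by (simp add: scaleR_conv_of_real)
qed

text \<open>The form of the kernel used in \<open>is_slice_measure\<close>; by
  \<open>disc_kernel_alt\<close> it coincides on the circle with the factors of
  \<open>poisson_kernel\<close>.\<close>

definition disc_kernel :: "complex \<Rightarrow> complex \<Rightarrow> real" where
  "disc_kernel w \<xi> = (1 - (norm w)\<^sup>2) / (norm (\<xi> - w))\<^sup>2"

lemma disc_kernel_alt:
  assumes "norm \<xi> = 1"
  shows "(1 - (norm w)\<^sup>2) / (norm (1 - w * cnj \<xi>))\<^sup>2 = disc_kernel w \<xi>"
proof -
  have "\<xi> - w = \<xi> * (1 - w * cnj \<xi>)"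
    using assms complex_norm_square[of \<xi>] by (simp add: right_diff_distrib mult.left_commute[of \<xi> w])
  then have "norm (\<xi> - w) = norm \<xi> * norm (1 - w * cnj \<xi>)"
    by (metis norm_mult)
  then show ?thesis
    using assms by (simp add: disc_kernel_def)
qed

text \<open>For unit vectors both squared distances expand to the same expression in the inner
  product of \<xi> and \<eta>. This lets the integration variable move from the dilated slot to the
  boundary slot.\<close>

lemma disc_kernel_sym:
  assumes "norm \<xi> = 1" "norm \<eta> = 1"
  shows "disc_kernel (of_real r * \<xi>) \<eta> = disc_kernel (of_real r * \<eta>) \<xi>"
proof -
  have "\<xi> \<bullet> \<xi> = 1" "\<eta> \<bullet> \<eta> = 1"
    using assms by (simp_all add: dot_square_norm)
  then have "(norm (\<eta> - of_real r * \<xi>))\<^sup>2 = (norm (\<xi> - of_real r * \<eta>))\<^sup>2"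
    by (simp add: power2_norm_eq_inner inner_diff inner_commute flip: scaleR_conv_of_real)
  then show ?thesis
    using assms by (simp add: disc_kernel_def norm_mult)
qed

lemma disc_kernel_rotate:
  assumes "norm \<eta> = 1"
  shows "disc_kernel (\<eta> * w) (\<eta> * \<xi>) = disc_kernel w \<xi>"
proof -
  have "norm (\<eta> * \<xi> - \<eta> * w) = norm (\<xi> - w)"
    using assms by (simp add: norm_mult flip: right_diff_distrib)
  then show ?thesis
    using assms by (simp add: disc_kernel_def norm_mult)
qed

lemma disc_kernel_nonneg: "norm w < 1 \<Longrightarrow> disc_kernel w \<xi> \<ge> 0"
  by (simp add: disc_kernel_def power_le_one)

lemma continuous_on_disc_kernel [continuous_intros]:
  assumes "continuous_on S f" "continuous_on S g" "\<And>x. x \<in> S \<Longrightarrow> norm (f x) < 1" "\<And>x. x \<in> S \<Longrightarrow> norm (g x) = 1"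
  shows "continuous_on S (\<lambda>x. disc_kernel (f x) (g x))"
  unfolding disc_kernel_def using assms by (intro continuous_intros) force+

text \<open>Cauchy's formula is applied not to \<phi> but to its product with
  \<open>(1 - (norm w)\<^sup>2) / (1 - cnj w * \<xi>)\<close>. This factor is holomorphic in \<xi>,
  equals 1 at \<open>w\<close>, and turns the Cauchy kernel on the circle into the Poisson kernel,
  because there \<open>cnj \<xi>\<close> is the inverse of \<xi>.\<close>

lemma poisson_formula_holomorphic:
  assumes \<phi>: "continuous_on (cball 0 1) \<phi>" "\<phi> holomorphic_on ball 0 1" and w: "norm w < 1"
  shows "(\<integral>\<xi>. of_real (disc_kernel w \<xi>) * \<phi> \<xi> \<partial>circle_lebesgue) = \<phi> w"
proof (rule integral_circle_lebesgue)
  show "continuous_on (sphere 0 1) (\<lambda>\<xi>. of_real (disc_kernel w \<xi>) * \<phi> \<xi>)"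
    using w by (intro continuous_intros continuous_on_subset[OF \<phi>(1)]) auto
  define g where "g \<xi> = \<phi> \<xi> * (of_real (1 - (norm w)\<^sup>2) / (1 - cnj w * \<xi>))" for \<xi>
  have nz: "1 - cnj w * \<xi> \<noteq> 0" if "norm \<xi> \<le> 1" for \<xi>
  proof
    assume "1 - cnj w * \<xi> = 0"
    then have "norm (cnj w * \<xi>) = 1"
      by (metis eq_iff_diff_eq_0 norm_one)
    moreover have "norm w * norm \<xi> \<le> norm w"
      using that by (simp add: mult_left_le)
    ultimately show False
      using w by (simp add: norm_mult)
  qed
  have "((\<lambda>u. g u / (u - w)) has_contour_integral (2 * of_real pi * \<i> * g w)) (circlepath 0 1)"
  proof (rule Cauchy_integral_circlepath)
    show "continuous_on (cball 0 1) g"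
      unfolding g_def using nz by (intro continuous_intros \<phi>) auto
    show "g holomorphic_on ball 0 1"
      unfolding g_def using nz by (intro holomorphic_intros \<phi>) auto
  qed (use w in simp)
  then have "((\<lambda>t. g (cis t) / (cis t - w) * \<i> * cis t) has_integral (2 * of_real pi * \<i> * g w)) {0..2 * pi}"
    by (simp add: circlepath_def has_contour_integral_part_circlepath_iff)
  from has_integral_mult_left[OF this, of "- \<i>"]
  have "((\<lambda>t. g (cis t) / (cis t - w) * cis t) has_integral (2 * of_real pi * g w)) {0..2 * pi}"
    by (simp add: algebra_simps)
  moreover have "g w = \<phi> w"
  proof -
    have "1 - cnj w * w = of_real (1 - (norm w)\<^sup>2)"
      by (simp add: complex_norm_square mult.commute del: of_real_power)
    then show ?thesis
      using nz[of w] w by (simp add: g_def)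
  qed
  moreover have "g (cis t) / (cis t - w) * cis t = of_real (disc_kernel w (cis t)) * \<phi> (cis t)" for t
  proof -
    let ?z = "cis t"
    have "?z * (cnj ?z - cnj w) = 1 - cnj w * ?z"
      by (simp add: algebra_simps cis_cnj cis_mult)
    then have "of_real ((norm (?z - w))\<^sup>2) * ?z = (?z - w) * (1 - cnj w * ?z)"
      by (simp only: complex_norm_square complex_cnj_diff) (simp add: algebra_simps)
    moreover have nz': "?z - w \<noteq> 0" "1 - cnj w * ?z \<noteq> 0" "of_real ((norm (?z - w))\<^sup>2) \<noteq> (0 :: complex)"
      using w nz[of ?z] by auto
    ultimately have "?z / ((?z - w) * (1 - cnj w * ?z)) = 1 / of_real ((norm (?z - w))\<^sup>2)"
      by (simp add: frac_eq_eq mult.commute[of "cis t" "of_real _"] del: of_real_power)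
    then have "\<phi> ?z * of_real (1 - (norm w)\<^sup>2) * (?z / ((?z - w) * (1 - cnj w * ?z)))
        = \<phi> ?z * of_real (1 - (norm w)\<^sup>2) * (1 / of_real ((norm (?z - w))\<^sup>2))"
      by (rule arg_cong)
    then show ?thesis
      unfolding g_def disc_kernel_def of_real_divide by (simp only: times_divide_eq_right times_divide_eq_left divide_divide_eq_left mult_1_right mult_1_left ac_simps)
  qed
  ultimately show "((\<lambda>t. of_real (disc_kernel w (cis t)) * \<phi> (cis t)) has_integral 2 * pi * \<phi> w) {0..2 * pi}"
    by simp
qed

lemma poisson_formula_harmonic:
  assumes G: "continuous_on (cball 0 1) G" "G holomorphic_on ball 0 1"
    and H: "continuous_on (cball 0 1) H" "H holomorphic_on ball 0 1" and w: "norm w < 1"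
  shows "(\<integral>\<xi>. of_real (disc_kernel w \<xi>) * (G \<xi> + cnj (H \<xi>)) \<partial>circle_lebesgue) = G w + cnj (H w)"
proof -
  interpret prob_space circle_lebesgue
    by (rule prob_space_circle_lebesgue)
  have int: "integrable circle_lebesgue (\<lambda>\<xi>. of_real (disc_kernel w \<xi>) * \<phi> \<xi>)"
    if "continuous_on (cball 0 1) \<phi>" for \<phi> :: "complex \<Rightarrow> complex"
  proof -
    have c: "continuous_on (sphere 0 1) (\<lambda>\<xi>. of_real (disc_kernel w \<xi>) * \<phi> \<xi>)"
      using w by (intro continuous_intros continuous_on_subset[OF that]) auto
    then have "bounded ((\<lambda>\<xi>. of_real (disc_kernel w \<xi>) * \<phi> \<xi>) ` sphere 0 1)"
      by (intro compact_imp_bounded compact_continuous_image) auto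
    then obtain B where "\<And>\<xi>. \<xi> \<in> sphere 0 1 \<Longrightarrow> norm (of_real (disc_kernel w \<xi>) * \<phi> \<xi>) \<le> B"
      unfolding bounded_iff by blast
    then show ?thesis
      using borel_measurable_continuous_on_restrict[OF c] sets_circle_lebesgue
      by (intro integrable_const_bound[of _ B]) (auto simp: measurable_cong_sets[OF sets_circle_lebesgue refl])
  qed
  have "(\<integral>\<xi>. of_real (disc_kernel w \<xi>) * cnj (H \<xi>) \<partial>circle_lebesgue)
      = cnj (\<integral>\<xi>. of_real (disc_kernel w \<xi>) * H \<xi> \<partial>circle_lebesgue)"
    using Bochner_Integration.integral_cnj[of circle_lebesgue "\<lambda>\<xi>. of_real (disc_kernel w \<xi>) * H \<xi>"] by simp
  then show ?thesis
    using int[OF G(1)] int[of "\<lambda>z. cnj (H z)"] H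
    by (simp add: distrib_left poisson_formula_holomorphic[OF G w] poisson_formula_holomorphic[OF H w]
        continuous_on_cnj)
qed

lemma nn_integral_disc_kernel:
  assumes w: "norm w < 1"
  shows "(\<integral>\<^sup>+\<xi>. ennreal (disc_kernel w \<xi>) \<partial>circle_lebesgue) = 1"
proof -
  interpret prob_space circle_lebesgue
    by (rule prob_space_circle_lebesgue)
  have "complex_of_real (\<integral>\<xi>. disc_kernel w \<xi> \<partial>circle_lebesgue) = 1"
    using poisson_formula_holomorphic[of "\<lambda>_. 1" w] w by simp
  then have 1: "(\<integral>\<xi>. disc_kernel w \<xi> \<partial>circle_lebesgue) = 1"
    by (metis of_real_eq_1_iff)
  \<comment> \<open>A Bochner integral with value 1 cannot be the default value 0 of a
    non-integrable function.\<close>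
  then have "integrable circle_lebesgue (disc_kernel w)"
    using not_integrable_integral_eq by fastforce
  then show ?thesis
    using 1 w by (subst nn_integral_eq_integral) (auto simp: disc_kernel_nonneg)
qed

text \<open>On the circle the squared distance from \<xi> to \<eta> is
  \<open>2 - 2 * Re (\<xi> * cnj \<eta>)\<close>, which extends harmonically in \<xi>. The Poisson
  formula evaluates the extension at \<open>of_real r * \<eta>\<close>.\<close>

lemma nn_integral_disc_kernel_dist:
  assumes \<eta>: "norm \<eta> = 1" and r: "0 \<le> r" "r < 1"
  shows "(\<integral>\<^sup>+\<xi>. ennreal (disc_kernel (of_real r * \<eta>) \<xi> * (dist \<xi> \<eta>)\<^sup>2) \<partial>circle_lebesgue) = ennreal (2 - 2 * r)"
proof -
  interpret prob_space circle_lebesgue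
    by (rule prob_space_circle_lebesgue)
  let ?w = "of_real r * \<eta>"
  have w: "norm ?w < 1"
    using \<eta> r by (simp add: norm_mult)
  have "(\<integral>\<xi>. of_real (disc_kernel ?w \<xi>) * (2 - \<xi> * cnj \<eta> + cnj (- \<xi> * cnj \<eta>)) \<partial>circle_lebesgue)
      = (2 - ?w * cnj \<eta> + cnj (- ?w * cnj \<eta>))"
    using w by (intro poisson_formula_harmonic continuous_intros holomorphic_intros) auto
  also have "\<dots> = of_real (2 - 2 * r)"
    using \<eta> complex_norm_square[of \<eta>] by (simp add: algebra_simps)
  also have "(\<integral>\<xi>. of_real (disc_kernel ?w \<xi>) * (2 - \<xi> * cnj \<eta> + cnj (- \<xi> * cnj \<eta>)) \<partial>circle_lebesgue)
      = (\<integral>\<xi>. of_real (disc_kernel ?w \<xi> * (dist \<xi> \<eta>)\<^sup>2) \<partial>circle_lebesgue)"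
  proof (intro Bochner_Integration.integral_cong refl)
    fix \<xi> assume "\<xi> \<in> space circle_lebesgue"
    then have "norm \<xi> = 1"
      by simp
    then have "2 - \<xi> * cnj \<eta> + cnj (- \<xi> * cnj \<eta>) = of_real ((dist \<xi> \<eta>)\<^sup>2)"
      using complex_norm_square[of \<xi>] complex_norm_square[of \<eta>] complex_norm_square[of "\<xi> - \<eta>"] \<eta>
      by (simp add: dist_norm algebra_simps)
    then show "of_real (disc_kernel ?w \<xi>) * (2 - \<xi> * cnj \<eta> + cnj (- \<xi> * cnj \<eta>))
        = complex_of_real (disc_kernel ?w \<xi> * (dist \<xi> \<eta>)\<^sup>2)"
      by simp
  qed
  finally have "complex_of_real (\<integral>\<xi>. disc_kernel ?w \<xi> * (dist \<xi> \<eta>)\<^sup>2 \<partial>circle_lebesgue) = of_real (2 - 2 * r)"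
    by (simp only: integral_complex_of_real)
  then have 1: "(\<integral>\<xi>. disc_kernel ?w \<xi> * (dist \<xi> \<eta>)\<^sup>2 \<partial>circle_lebesgue) = 2 - 2 * r"
    by (metis of_real_eq_iff)
  \<comment> \<open>Integrability again follows from a nonzero value, here because
    \<open>r < 1\<close>.\<close>
  then have "integrable circle_lebesgue (\<lambda>\<xi>. disc_kernel ?w \<xi> * (dist \<xi> \<eta>)\<^sup>2)"
    using not_integrable_integral_eq r by fastforce
  then show ?thesis
    using 1 w by (subst nn_integral_eq_integral) (auto simp: disc_kernel_nonneg)
qed

section \<open>Approximate identities\<close>

text \<open>By second countability the Borel sets of the product space are the product
  sigma-algebra, and since \<open>X \<times> Y\<close> is closed the function may be extended by 0
  without losing measurability.\<close>

lemma borel_measurable_continuous_on_Times: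
  fixes g :: "'a::{metric_space, second_countable_topology} \<times> 'b::{metric_space, second_countable_topology} \<Rightarrow> 'c::real_normed_vector"
  assumes X: "compact X" and Y: "compact Y" and g: "continuous_on (X \<times> Y) g"
  shows "g \<in> borel_measurable (restrict_space borel X \<Otimes>\<^sub>M restrict_space borel Y)"
proof -
  let ?P = "restrict_space borel X \<Otimes>\<^sub>M restrict_space borel Y"
  have "X \<times> Y \<in> sets borel"
    using X Y by (intro borel_closed closed_Times compact_imp_closed)
  then have g': "(\<lambda>p. indicator (X \<times> Y) p *\<^sub>R g p) \<in> borel_measurable borel"
    using g by (rule borel_measurable_continuous_on_indicator)
  have "(\<lambda>p. (fst p, snd p)) \<in> measurable ?P (borel \<Otimes>\<^sub>M borel)"
    by (intro measurable_Pair measurable_compose[OF measurable_fst measurable_restrict_space1[OF measurable_ident_sets]]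
        measurable_compose[OF measurable_snd measurable_restrict_space1[OF measurable_ident_sets]] refl)
  then have "(\<lambda>p. p) \<in> measurable ?P borel"
    by (simp add: borel_prod)
  from measurable_compose[OF this g'] show ?thesis
    by (rule measurable_cong[THEN iffD1, rotated]) (auto simp: space_pair_measure space_restrict_space)
qed

lemma norm_integral_le:
  fixes f :: "'a \<Rightarrow> 'b::{banach, second_countable_topology}"
  assumes "integrable M f" "integrable M g" "\<And>x. x \<in> space M \<Longrightarrow> norm (f x) \<le> g x"
  shows "norm (\<integral>x. f x \<partial>M) \<le> (\<integral>x. g x \<partial>M)"
proof -
  have "norm (\<integral>x. f x \<partial>M) \<le> (\<integral>x. norm (f x) \<partial>M)"
    by (rule Bochner_Integration.integral_norm_bound)
  also have "\<dots> \<le> (\<integral>x. g x \<partial>M)"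
    using assms by (intro integral_mono) auto
  finally show ?thesis .
qed

text \<open>The second moment \<open>K_dist\<close> replaces the usual condition that the mass away
  from the diagonal vanishes; for Poisson kernels it can be computed in closed form. Mass and moment
  refer to the first variable, over which \<open>N\<close> integrates; the second one carries the
  measure to be approximated.\<close>

locale approximate_identity = prob_space N
  for N :: "'a::{metric_space, second_countable_topology} measure" +
  fixes X :: "'a set" and K :: "nat \<Rightarrow> 'a \<Rightarrow> 'a \<Rightarrow> real" and \<delta> :: "nat \<Rightarrow> real"
  assumes compact: "compact X"
    and sets_N: "sets N = sets (restrict_space borel X)"
    and K_continuous: "continuous_on (X \<times> X) (\<lambda>(x, y). K n x y)"
    and K_nonneg: "x \<in> X \<Longrightarrow> y \<in> X \<Longrightarrow> 0 \<le> K n x y"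
    and K_mass: "y \<in> X \<Longrightarrow> (\<integral>\<^sup>+x. ennreal (K n x y) \<partial>N) = 1"
    and K_dist: "y \<in> X \<Longrightarrow> (\<integral>\<^sup>+x. ennreal (K n x y * (dist x y)\<^sup>2) \<partial>N) \<le> ennreal (\<delta> n)"
    and \<delta>_nonneg: "0 \<le> \<delta> n"
    and \<delta>_tendsto: "\<delta> \<longlonglongrightarrow> 0"
begin

lemma space_N: "space N = X"
  using sets_eq_imp_space_eq[OF sets_N] by (simp add: space_restrict_space)

lemma continuous_measurable:
  "continuous_on X f \<Longrightarrow> f \<in> borel_measurable N"
  using borel_measurable_continuous_on_restrict measurable_cong_sets[OF sets_N refl] by blast

lemma continuous_integrable:
  fixes f :: "'a \<Rightarrow> 'b::{banach, second_countable_topology}"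
  assumes f: "continuous_on X f"
  shows "integrable N f"
proof -
  obtain B where "\<And>x. x \<in> X \<Longrightarrow> norm (f x) \<le> B"
    using compact_bounded_continuous[OF compact f] by metis
  then show ?thesis
    using continuous_measurable[OF f] by (intro integrable_const_bound[of _ B]) (auto simp: space_N)
qed

lemma K_continuous_1: "y \<in> X \<Longrightarrow> continuous_on X (\<lambda>x. K n x y)"
proof -
  assume "y \<in> X"
  then have "continuous_on X (\<lambda>x. case (x, y) of (x, y) \<Rightarrow> K n x y)"
    by (intro continuous_on_compose2[OF K_continuous] continuous_intros) auto
  then show ?thesis
    by simp
qed

lemma K_continuous_2: "x \<in> X \<Longrightarrow> continuous_on X (\<lambda>y. K n x y)"
proof -
  assume "x \<in> X"
  then have "continuous_on X (\<lambda>y. case (x, y) of (x, y) \<Rightarrow> K n x y)"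
    by (intro continuous_on_compose2[OF K_continuous] continuous_intros) auto
  then show ?thesis
    by simp
qed

lemma K_mass': "y \<in> X \<Longrightarrow> (\<integral>x. K n x y \<partial>N) = 1"
  using K_nonneg[of _ y n]
  by (subst integral_eq_nn_integral) (auto simp: K_mass space_N intro!: continuous_measurable K_continuous_1)

lemma K_dist':
  assumes y: "y \<in> X"
  shows "(\<integral>x. K n x y * (dist x y)\<^sup>2 \<partial>N) \<le> \<delta> n"
proof -
  have "continuous_on X (\<lambda>x. K n x y * (dist x y)\<^sup>2)"
    using y by (intro continuous_intros K_continuous_1)
  then have "(\<integral>x. K n x y * (dist x y)\<^sup>2 \<partial>N) = enn2real (\<integral>\<^sup>+x. ennreal (K n x y * (dist x y)\<^sup>2) \<partial>N)"
    using K_nonneg[of _ y n] y by (intro integral_eq_nn_integral continuous_measurable) (auto simp: space_N)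
  also have "\<dots> \<le> enn2real (ennreal (\<delta> n))"
    using K_dist[OF y] by (intro enn2real_mono) auto
  finally show ?thesis
    using \<delta>_nonneg by simp
qed

text \<open>Uniform continuity gives \<open>|f x - f y| \<le> \<epsilon> + C d(x,y)\<^sup>2\<close>, so the second moments control the
  convergence (Korovkin's argument).\<close>
lemma pointwise_approximation:
  fixes f :: "'a \<Rightarrow> complex"
  assumes f: "continuous_on X f" and y: "y \<in> X"
  shows "(\<lambda>n. \<integral>x. f x * of_real (K n x y) \<partial>N) \<longlonglongrightarrow> f y"
proof (rule LIMSEQ_I)
  fix \<epsilon> :: real assume \<epsilon>: "\<epsilon> > 0"
  obtain B where B: "B > 0" "\<And>x. x \<in> X \<Longrightarrow> norm (f x) \<le> B"
    using compact_bounded_continuous[OF compact f] by metis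
  have "uniformly_continuous_on X f"
    using compact_uniformly_continuous[OF f compact] .
  then obtain d where d: "d > 0" "\<And>x. x \<in> X \<Longrightarrow> dist x y < d \<Longrightarrow> dist (f x) (f y) < \<epsilon> / 2"
    using \<epsilon> y unfolding uniformly_continuous_on_def by (metis half_gt_zero dist_commute)
  \<comment> \<open>Chosen so that \<open>C * d\<^sup>2 = 2 * B\<close>, the largest possible
    oscillation of \<open>f\<close>: beyond distance \<open>d\<close> the quadratic term suffices
    alone.\<close>
  define C where "C = 2 * B / d\<^sup>2"
  have C: "C \<ge> 0"
    using B d by (simp add: C_def)
  have bound: "norm (f x - f y) \<le> \<epsilon> / 2 + C * (dist x y)\<^sup>2" if x: "x \<in> X" for x
  proof (cases "dist x y < d")
    case True
    then show ?thesis
      using d(2)[OF x] C by (simp add: dist_norm add_increasing2 less_imp_le)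
  next
    case False
    have "norm (f x - f y) \<le> norm (f x) + norm (f y)"
      by (rule norm_triangle_ineq4)
    also have "\<dots> \<le> 2 * B"
      using B(2)[OF x] B(2)[OF y] by simp
    also have "2 * B = C * d\<^sup>2"
      using d by (simp add: C_def)
    also have "\<dots> \<le> C * (dist x y)\<^sup>2"
      using False d C by (intro mult_left_mono power_mono) auto
    finally show ?thesis
      using \<epsilon> by simp
  qed
  have est: "norm ((\<integral>x. f x * of_real (K n x y) \<partial>N) - f y) \<le> \<epsilon> / 2 + C * \<delta> n" for n
  proof -
    have i1: "integrable N (\<lambda>x. (f x - f y) * of_real (K n x y))" "integrable N (\<lambda>x. f y * of_real (K n x y))"
      using y by (auto intro!: continuous_integrable continuous_intros f K_continuous_1)
    have i2: "integrable N (\<lambda>x. K n x y)" "integrable N (\<lambda>x. K n x y * (dist x y)\<^sup>2)"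
      using y by (auto intro!: continuous_integrable continuous_intros f K_continuous_1)
    have "(\<integral>x. f x * of_real (K n x y) \<partial>N) = (\<integral>x. (f x - f y) * of_real (K n x y) + f y * of_real (K n x y) \<partial>N)"
      by (simp add: left_diff_distrib)
    also have "\<dots> = (\<integral>x. (f x - f y) * of_real (K n x y) \<partial>N) + f y"
      using i1 K_mass'[OF y] by simp
    finally have "norm ((\<integral>x. f x * of_real (K n x y) \<partial>N) - f y) = norm (\<integral>x. (f x - f y) * of_real (K n x y) \<partial>N)"
      by simp
    also have "\<dots> \<le> (\<integral>x. \<epsilon> / 2 * K n x y + C * (K n x y * (dist x y)\<^sup>2) \<partial>N)"
    proof (rule norm_integral_le[OF i1(1)])
      show "integrable N (\<lambda>x. \<epsilon> / 2 * K n x y + C * (K n x y * (dist x y)\<^sup>2))"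
        using i2 by auto
      fix x assume "x \<in> space N"
      then have x: "x \<in> X"
        by (simp add: space_N)
      have "norm (f x - f y) * K n x y \<le> (\<epsilon> / 2 + C * (dist x y)\<^sup>2) * K n x y"
        using bound[OF x] K_nonneg[OF x y] by (rule mult_right_mono)
      then show "norm ((f x - f y) * of_real (K n x y)) \<le> \<epsilon> / 2 * K n x y + C * (K n x y * (dist x y)\<^sup>2)"
        unfolding norm_mult using K_nonneg[OF x y] by (simp add: distrib_right mult.assoc mult.commute[of "K n x y"])
    qed
    also have "\<dots> = \<epsilon> / 2 + C * (\<integral>x. K n x y * (dist x y)\<^sup>2 \<partial>N)"
      using i2 K_mass'[OF y] by simp
    also have "\<dots> \<le> \<epsilon> / 2 + C * \<delta> n"
      using C K_dist'[OF y] by (intro add_left_mono mult_left_mono)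
    finally show ?thesis .
  qed
  have "(\<lambda>n. \<epsilon> / 2 + C * \<delta> n) \<longlonglongrightarrow> \<epsilon> / 2 + C * 0"
    by (intro tendsto_intros \<delta>_tendsto)
  from order_tendstoD(2)[OF this, of \<epsilon>]
  have "\<forall>\<^sub>F n in sequentially. \<epsilon> / 2 + C * \<delta> n < \<epsilon>"
    using \<epsilon> by simp
  then obtain n0 where "\<And>n. n \<ge> n0 \<Longrightarrow> \<epsilon> / 2 + C * \<delta> n < \<epsilon>"
    unfolding eventually_sequentially by blast
  then show "\<exists>n0. \<forall>n\<ge>n0. norm ((\<integral>x. f x * of_real (K n x y) \<partial>N) - f y) < \<epsilon>"
    using est by (meson le_less_trans)
qed

context
  fixes p :: "'a measure"
  assumes p: "finite_measure p" and sets_p: "sets p = sets (restrict_space borel X)"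
begin

interpretation p: finite_measure p
  by (rule p)

interpretation pair_sigma_finite N p ..

lemma space_p: "space p = X"
  using sets_eq_imp_space_eq[OF sets_p] by (simp add: space_restrict_space)

lemma sets_pair: "sets (N \<Otimes>\<^sub>M p) = sets (restrict_space borel X \<Otimes>\<^sub>M restrict_space borel X)"
  by (intro sets_pair_measure_cong sets_N sets_p)

lemma pair_measurable:
  fixes h :: "'a \<times> 'a \<Rightarrow> 'b::real_normed_vector"
  assumes "continuous_on (X \<times> X) h"
  shows "h \<in> borel_measurable (N \<Otimes>\<^sub>M p)"
  using borel_measurable_continuous_on_Times[OF compact compact assms] measurable_cong_sets[OF sets_pair refl]
  by blast

lemma integral_kernel_swap:
  fixes f :: "'a \<Rightarrow> complex"
  assumes f: "continuous_on X f"
  shows "(\<integral>x. f x * (\<integral>y. of_real (K n x y) \<partial>p) \<partial>N) = (\<integral>y. (\<integral>x. f x * of_real (K n x y) \<partial>N) \<partial>p)"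
proof -
  have c: "continuous_on (X \<times> X) (\<lambda>z. f (fst z) * of_real (K n (fst z) (snd z)))"
    using K_continuous[of n] unfolding case_prod_unfold
    by (intro continuous_intros continuous_on_compose2[OF f]) auto
  obtain B where B: "\<And>z. z \<in> X \<times> X \<Longrightarrow> norm (f (fst z) * of_real (K n (fst z) (snd z))) \<le> B"
    using compact_bounded_continuous[OF compact_Times[OF compact compact] c] by metis
  have "finite_measure (N \<Otimes>\<^sub>M p)"
    by (intro finite_measure_pair_measure p) unfold_locales
  then have "integrable (N \<Otimes>\<^sub>M p) (\<lambda>z. f (fst z) * of_real (K n (fst z) (snd z)))"
    using pair_measurable[OF c] B
    by (intro finite_measure.integrable_const_bound[of _ _ B]) (auto simp: space_pair_measure space_N space_p)
  then have "(\<integral>y. (\<integral>x. f x * of_real (K n x y) \<partial>N) \<partial>p) = (\<integral>x. (\<integral>y. f x * of_real (K n x y) \<partial>p) \<partial>N)"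
    by (intro Fubini_integral) (simp add: case_prod_unfold)
  then show ?thesis
    by simp
qed

text \<open>After Fubini the kernel acts on \<open>f\<close> instead of on the measure. There it
  converges pointwise, and its mass 1 keeps the averages below the bound of \<open>f\<close>, so
  dominated convergence for the finite measure \<open>p\<close> applies.\<close>

lemma weak_approximation:
  fixes f :: "'a \<Rightarrow> complex"
  assumes f: "continuous_on X f"
  shows "(\<lambda>n. \<integral>x. f x * (\<integral>y. of_real (K n x y) \<partial>p) \<partial>N) \<longlonglongrightarrow> (\<integral>y. f y \<partial>p)"
proof -
  obtain B where B: "B > 0" "\<And>x. x \<in> X \<Longrightarrow> norm (f x) \<le> B"
    using compact_bounded_continuous[OF compact f] by metis
  show ?thesis
    unfolding integral_kernel_swap[OF f]
  proof (rule integral_dominated_convergence)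
    show "f \<in> borel_measurable p"
      using borel_measurable_continuous_on_restrict[OF f] measurable_cong_sets[OF sets_p refl] by blast
    have c: "continuous_on (X \<times> X) (\<lambda>z. f (fst z) * of_real (K n (fst z) (snd z)))" for n
      using K_continuous[of n] unfolding case_prod_unfold
      by (intro continuous_intros continuous_on_compose2[OF f]) auto
    have "(\<lambda>z. f (snd z) * of_real (K n (snd z) (fst z))) \<in> borel_measurable (p \<Otimes>\<^sub>M N)" for n
      using measurable_compose[OF measurable_pair_swap' pair_measurable[OF c]] by (simp add: case_prod_unfold)
    then have m: "(\<lambda>(y, x). f x * of_real (K n x y)) \<in> borel_measurable (p \<Otimes>\<^sub>M N)" for n
      by (simp add: case_prod_unfold)
    show "(\<lambda>y. \<integral>x. f x * of_real (K n x y) \<partial>N) \<in> borel_measurable p" for n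
      by (rule sigma_finite_measure.borel_measurable_lebesgue_integral[OF _ m]) unfold_locales
    show "integrable p (\<lambda>y. B)"
      by simp
    show "AE y in p. (\<lambda>n. \<integral>x. f x * of_real (K n x y) \<partial>N) \<longlonglongrightarrow> f y"
      using pointwise_approximation[OF f] by (auto simp: space_p)
    have "norm (\<integral>x. f x * of_real (K n x y) \<partial>N) \<le> B" if y: "y \<in> X" for n y
    proof -
      have "norm (\<integral>x. f x * of_real (K n x y) \<partial>N) \<le> (\<integral>x. B * K n x y \<partial>N)"
        using y B K_nonneg
        by (intro norm_integral_le continuous_integrable continuous_intros f K_continuous_1)
          (auto simp: norm_mult space_N intro!: mult_right_mono)
      then show ?thesis
        using K_mass'[OF y] by simp
    qed
    then show "AE y in p. norm (\<integral>x. f x * of_real (K n x y) \<partial>N) \<le> B" for n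
      by (auto simp: space_p)
  qed
qed

text \<open>Tonelli together with mass 1 in the first variable. The bound does not depend on
  \<open>n\<close>, which later makes the circle means integrable in \<zeta> uniformly in the
  radius.\<close>

lemma kernel_integral_L1:
  "(\<integral>\<^sup>+x. ennreal (norm (\<integral>y. complex_of_real (K n x y) \<partial>p)) \<partial>N) \<le> emeasure p X"
proof -
  have "(\<integral>\<^sup>+x. ennreal (norm (\<integral>y. complex_of_real (K n x y) \<partial>p)) \<partial>N) \<le> (\<integral>\<^sup>+x. (\<integral>\<^sup>+y. ennreal (K n x y) \<partial>p) \<partial>N)"
  proof (rule nn_integral_mono)
    fix x assume "x \<in> space N"
    then have x: "x \<in> X"
      by (simp add: space_N)
    have "ennreal (norm (\<integral>y. complex_of_real (K n x y) \<partial>p)) \<le> (\<integral>\<^sup>+y. ennreal (norm (complex_of_real (K n x y))) \<partial>p)"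
    proof (rule integral_norm_bound_ennreal)
      have c: "continuous_on X (\<lambda>y. complex_of_real (K n x y))"
        using x by (intro continuous_intros K_continuous_2)
      obtain B where "\<And>y. y \<in> X \<Longrightarrow> norm (complex_of_real (K n x y)) \<le> B"
        using compact_bounded_continuous[OF compact c] by metis
      then show "integrable p (\<lambda>y. complex_of_real (K n x y))"
        by (intro integrable_bounded[OF p borel_measurable_continuous_on_restrict[OF c] sets_p])
          (simp add: space_restrict_space)
    qed
    also have "\<dots> = (\<integral>\<^sup>+y. ennreal (K n x y) \<partial>p)"
      using x K_nonneg by (intro nn_integral_cong) (auto simp: space_p)
    finally show "ennreal (norm (\<integral>y. complex_of_real (K n x y) \<partial>p)) \<le> (\<integral>\<^sup>+y. ennreal (K n x y) \<partial>p)" .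
  qed
  also have "\<dots> = (\<integral>\<^sup>+y. (\<integral>\<^sup>+x. ennreal (K n x y) \<partial>N) \<partial>p)"
    using pair_measurable[OF K_continuous[of n]]
    by (intro Fubini'[symmetric]) (simp add: case_prod_unfold)
  also have "\<dots> = (\<integral>\<^sup>+y. 1 \<partial>p)"
    by (intro nn_integral_cong) (simp add: K_mass space_p)
  also have "\<dots> = emeasure p X"
    by (simp add: space_p)
  finally show ?thesis .
qed

end

end

lemma (in approximate_identity) integrable_kernel:
  fixes f :: "'a \<Rightarrow> complex"
  assumes p: "finite_measure p" "sets p = sets (restrict_space borel X)" and f: "continuous_on X f"
  shows "integrable N (\<lambda>x. f x * (\<integral>y. of_real (K n x y) \<partial>p))"
proof -
  interpret p: finite_measure p
    by (rule p(1))
  interpret pair_sigma_finite N p ..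
  have c: "continuous_on (X \<times> X) (\<lambda>z. f (fst z) * of_real (K n (fst z) (snd z)))"
    using K_continuous[of n] unfolding case_prod_unfold
    by (intro continuous_intros continuous_on_compose2[OF f]) auto
  obtain B where B: "\<And>z. z \<in> X \<times> X \<Longrightarrow> norm (f (fst z) * of_real (K n (fst z) (snd z))) \<le> B"
    using compact_bounded_continuous[OF compact_Times[OF compact compact] c] by metis
  have "finite_measure (N \<Otimes>\<^sub>M p)"
    by (intro finite_measure_pair_measure p(1)) unfold_locales
  then have "integrable (N \<Otimes>\<^sub>M p) (\<lambda>(x, y). f x * of_real (K n x y))"
    unfolding case_prod_unfold using pair_measurable[OF p c] B
    by (intro finite_measure.integrable_const_bound[of _ _ B]) (auto simp: space_pair_measure space_N space_p[OF p])
  from integrable_fst[OF this] show ?thesis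
    by simp
qed

section \<open>Kernel transforms of complex measures\<close>

context approximate_identity
begin

text \<open>In the two instances below this is the Poisson integral, at radius
  \<open>radius n\<close>, of the complex measure with parts \<open>p\<close>.\<close>

definition kernel_integral :: "(nat \<Rightarrow> 'a measure) \<Rightarrow> nat \<Rightarrow> 'a \<Rightarrow> complex" where
  "kernel_integral p n x = (\<Sum>k<4. \<i> ^ k * (\<integral>y. of_real (K n x y) \<partial>p k))"

lemma kernel_integral_tendsto:
  fixes f :: "'a \<Rightarrow> complex"
  assumes p: "jordan_parts (restrict_space borel X) p \<nu>" and f: "continuous_on X f"
  shows "(\<lambda>n. \<integral>x. f x * kernel_integral p n x \<partial>N) \<longlonglongrightarrow> (\<Sum>k<4. \<i> ^ k * (\<integral>x. f x \<partial>p k))"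
proof -
  have "(\<integral>x. f x * kernel_integral p n x \<partial>N) = (\<Sum>k<4. \<i> ^ k * (\<integral>x. f x * (\<integral>y. of_real (K n x y) \<partial>p k) \<partial>N))" for n
  proof -
    have "(\<integral>x. f x * kernel_integral p n x \<partial>N) = (\<integral>x. (\<Sum>k<4. \<i> ^ k * (f x * (\<integral>y. of_real (K n x y) \<partial>p k))) \<partial>N)"
      by (simp add: kernel_integral_def sum_distrib_left mult.left_commute)
    also have "\<dots> = (\<Sum>k<4. \<integral>x. \<i> ^ k * (f x * (\<integral>y. of_real (K n x y) \<partial>p k)) \<partial>N)"
      by (intro Bochner_Integration.integral_sum integrable_mult_right integrable_kernel jordan_partsD[OF p] f) auto
    also have "\<dots> = (\<Sum>k<4. \<i> ^ k * (\<integral>x. f x * (\<integral>y. of_real (K n x y) \<partial>p k) \<partial>N))"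
      by (simp only: integral_mult_right_zero)
    finally show ?thesis .
  qed
  moreover have "(\<lambda>n. \<Sum>k<4. \<i> ^ k * (\<integral>x. f x * (\<integral>y. of_real (K n x y) \<partial>p k) \<partial>N)) \<longlonglongrightarrow> (\<Sum>k<4. \<i> ^ k * (\<integral>x. f x \<partial>p k))"
    using jordan_partsD[OF p] f by (intro tendsto_sum tendsto_mult tendsto_const weak_approximation) auto
  ultimately show ?thesis
    by simp
qed

lemma kernel_integral_L1_bounded:
  assumes p: "jordan_parts (restrict_space borel X) p \<nu>"
  obtains C where "\<And>n. (\<integral>\<^sup>+x. ennreal (norm (kernel_integral p n x)) \<partial>N) \<le> ennreal C"
proof -
  define C where "C = (\<Sum>k<4. measure (p k) X)"
  have "(\<integral>\<^sup>+x. ennreal (norm (kernel_integral p n x)) \<partial>N) \<le> ennreal C" for n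
  proof -
    have m: "(\<lambda>x. \<integral>y. complex_of_real (K n x y) \<partial>p k) \<in> borel_measurable N" if "k < 4" for k
      using borel_measurable_integrable[OF integrable_kernel[OF jordan_partsD(1,2)[OF p that], of "\<lambda>_. 1" n]] by simp
    have "(\<integral>\<^sup>+x. ennreal (norm (kernel_integral p n x)) \<partial>N)
        \<le> (\<integral>\<^sup>+x. (\<Sum>k<4. ennreal (norm (\<integral>y. complex_of_real (K n x y) \<partial>p k))) \<partial>N)"
    proof (intro nn_integral_mono)
      fix x
      have "norm (kernel_integral p n x) \<le> (\<Sum>k<4. norm (\<i> ^ k * (\<integral>y. complex_of_real (K n x y) \<partial>p k)))"
        unfolding kernel_integral_def by (rule norm_sum)
      then show "ennreal (norm (kernel_integral p n x)) \<le> (\<Sum>k<4. ennreal (norm (\<integral>y. complex_of_real (K n x y) \<partial>p k)))"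
        by (simp add: norm_mult norm_power ennreal_leI)
    qed
    also have "\<dots> = (\<Sum>k<4. \<integral>\<^sup>+x. ennreal (norm (\<integral>y. complex_of_real (K n x y) \<partial>p k)) \<partial>N)"
    proof (rule nn_integral_sum)
      fix k :: nat assume "k \<in> {..<4}"
      then have [measurable]: "(\<lambda>x. \<integral>y. complex_of_real (K n x y) \<partial>p k) \<in> borel_measurable N"
        by (intro m) simp
      show "(\<lambda>x. ennreal (norm (\<integral>y. complex_of_real (K n x y) \<partial>p k))) \<in> borel_measurable N"
        by measurable
    qed
    also have "\<dots> \<le> (\<Sum>k<4. emeasure (p k) X)"
      using jordan_partsD[OF p] by (intro sum_mono kernel_integral_L1) auto
    also have "\<dots> = (\<Sum>k<4. ennreal (measure (p k) X))"
      using jordan_partsD(1)[OF p] by (intro sum.cong) (auto simp: finite_measure.emeasure_eq_measure)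
    also have "\<dots> = ennreal C"
      by (simp add: C_def)
    finally show ?thesis .
  qed
  then show ?thesis
    using that by blast
qed

end

section \<open>The Poisson kernel of the polydisc\<close>

lemma compact_torus: "compact (torus :: (complex ^ 'n) set)"
proof -
  have "closed (torus :: (complex ^ 'n) set)"
    unfolding torus_def by (intro closed_Collect_all closed_Collect_eq continuous_intros)
  moreover have "norm \<zeta> \<le> (\<Sum>j\<in>(UNIV :: 'n set). 1)" if "\<zeta> \<in> torus" for \<zeta> :: "complex ^ 'n"
    using that unfolding torus_def norm_vec_def by (intro order_trans[OF L2_set_le_sum]) auto
  ultimately show ?thesis
    unfolding compact_eq_bounded_closed bounded_iff by blast
qed

lemma torus_measurable:
  "(\<lambda>t :: real ^ 'n. \<chi> j. cis (t $ j)) \<in> measurable borel torus_borel"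
  by (intro measurable_restrict_space2 borel_measurable_continuous_onI continuous_intros) (auto simp: torus_def)

lemma sets_torus_lebesgue [measurable_cong]: "sets torus_lebesgue = sets torus_borel"
  by (simp add: torus_lebesgue_def)

lemma space_torus_lebesgue [simp]: "space torus_lebesgue = torus"
  by (simp add: torus_lebesgue_def space_restrict_space)

lemma component_measurable: "(\<lambda>\<zeta>. \<zeta> $ j) \<in> measurable torus_borel circle_borel"
proof (rule measurable_restrict_space2)
  show "(\<lambda>\<zeta>. \<zeta> $ j) \<in> borel_measurable torus_borel"
    by (intro borel_measurable_continuous_on_restrict continuous_intros)
qed (auto simp: torus_def space_restrict_space)

lemma prod_Basis_cart:
  fixes F :: "real ^ 'n \<Rightarrow> 'b::comm_monoid_mult"
  shows "(\<Prod>b\<in>Basis. F b) = (\<Prod>j\<in>UNIV. F (axis j 1))"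
proof -
  have B: "(Basis :: (real ^ 'n) set) = range (\<lambda>j. axis j 1)"
    by (auto simp: Basis_vec_def)
  have inj: "inj (\<lambda>j :: 'n. axis j (1 :: real))"
    by (auto simp: inj_on_def axis_eq_axis)
  show ?thesis
    unfolding B by (subst prod.reindex[OF inj]) (simp add: o_def)
qed

lemma nn_integral_lborel_cart_prod:
  fixes h :: "'n::finite \<Rightarrow> real \<Rightarrow> real"
  assumes "\<And>j. h j \<in> borel_measurable borel" "\<And>j t. 0 \<le> h j t"
  shows "(\<integral>\<^sup>+x. ennreal (\<Prod>j\<in>UNIV. h j (x $ j)) \<partial>(lborel :: (real ^ 'n) measure)) = (\<Prod>j\<in>UNIV. \<integral>\<^sup>+t. ennreal (h j t) \<partial>lborel)"
proof -
  \<comment> \<open>The product formula for \<open>lborel\<close> is indexed by basis vectors; the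
    coordinate is recovered from its vector because \<open>axis\<close> is injective in the
    index.\<close>
  define f where "f b = h (THE j. b = axis j 1)" for b :: "real ^ 'n"
  have f: "f (axis j 1) = h j" for j
    by (simp add: f_def axis_eq_axis)
  have "(\<integral>\<^sup>+x. (\<Prod>b\<in>Basis. ennreal (f b (x \<bullet> b))) \<partial>(lborel :: (real ^ 'n) measure)) = (\<Prod>b\<in>Basis. \<integral>\<^sup>+t. ennreal (f b t) \<partial>lborel)"
    using assms by (intro nn_integral_lborel_prod) (auto simp: f_def)
  then show ?thesis
    using assms(2) by (simp add: prod_Basis_cart f cart_eq_inner_axis prod_ennreal)
qed

text \<open>Apart from its sigma-algebra and its space, this is all that is ever used about the
  construction of \<open>torus_lebesgue\<close> from the cube: the indicator of the cube factors,
  and so do Lebesgue measure and the normalising constant.\<close>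

lemma nn_integral_torus_prod:
  fixes g :: "'n::finite \<Rightarrow> complex \<Rightarrow> real"
  assumes g[measurable]: "\<And>j. g j \<in> borel_measurable circle_borel" and nn: "\<And>j \<xi>. norm \<xi> = 1 \<Longrightarrow> 0 \<le> g j \<xi>"
  shows "(\<integral>\<^sup>+\<zeta>. ennreal (\<Prod>j\<in>UNIV. g j (\<zeta> $ j)) \<partial>torus_lebesgue) = (\<Prod>j\<in>UNIV. \<integral>\<^sup>+\<xi>. ennreal (g j \<xi>) \<partial>circle_lebesgue)"
proof -
  have [measurable]: "cis \<in> measurable borel circle_borel"
    by (rule cis_measurable)
  have [measurable]: "(\<lambda>\<zeta>. \<zeta> $ j) \<in> measurable torus_borel circle_borel" for j :: 'n
    by (rule component_measurable)
  have [measurable]: "(\<lambda>t :: real ^ 'n. \<chi> j. cis (t $ j)) \<in> measurable borel torus_borel"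
    by (rule torus_measurable)
  let ?C = "cbox 0 (\<chi> j. 2 * pi) :: (real ^ 'n) set"
  let ?n = "CARD('n)"
  have C: "indicator ?C x = (\<Prod>j\<in>UNIV. indicator {0..2*pi} (x $ j) :: real)" for x
    by (auto simp: indicator_def mem_box_cart prod_zero_iff intro!: prod.neutral)
  have m: "emeasure lborel ?C = ennreal (2 * pi) ^ ?n"
    by (simp add: emeasure_lborel_cbox_eq prod_Basis_cart inner_axis ennreal_power)
      (auto simp: Basis_vec_def inner_axis)
  have G: "(\<lambda>\<zeta>. ennreal (\<Prod>j\<in>UNIV. g j (\<zeta> $ j))) \<in> borel_measurable torus_borel"
    by measurable
  have "(\<integral>\<^sup>+\<zeta>. ennreal (\<Prod>j\<in>UNIV. g j (\<zeta> $ j)) \<partial>torus_lebesgue)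
      = (\<integral>\<^sup>+t. ennreal (\<Prod>j\<in>UNIV. g j (cis (t $ j))) * indicator ?C t \<partial>lborel) / emeasure lborel ?C"
    unfolding torus_lebesgue_def using measurable_compose[OF torus_measurable G]
    by (subst nn_integral_distr) (simp_all add: nn_integral_uniform_measure)
  also have "(\<integral>\<^sup>+t. ennreal (\<Prod>j\<in>UNIV. g j (cis (t $ j))) * indicator ?C t \<partial>lborel)
      = (\<integral>\<^sup>+t. ennreal (\<Prod>j\<in>UNIV. g j (cis (t $ j)) * indicator {0..2*pi} (t $ j)) \<partial>(lborel :: (real ^ 'n) measure))"
  proof (intro nn_integral_cong)
    fix t :: "real ^ 'n"
    have "(indicator ?C t :: ennreal) = ennreal (indicator ?C t)"
      by (simp add: indicator_def)
    then show "ennreal (\<Prod>j\<in>UNIV. g j (cis (t $ j))) * indicator ?C t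
        = ennreal (\<Prod>j\<in>UNIV. g j (cis (t $ j)) * indicator {0..2*pi} (t $ j))"
      by (simp add: C prod.distrib ennreal_mult' nn prod_nonneg)
  qed
  also have "\<dots> = (\<Prod>j\<in>UNIV. \<integral>\<^sup>+t. ennreal (g j (cis t) * indicator {0..2*pi} t) \<partial>lborel)"
    by (intro nn_integral_lborel_cart_prod) (auto simp: nn)
  also have "\<dots> / emeasure lborel ?C = (\<Prod>j\<in>UNIV. (\<integral>\<^sup>+t. ennreal (g j (cis t) * indicator {0..2*pi} t) \<partial>lborel) / ennreal (2 * pi))"
  proof -
    have "inverse (ennreal c ^ k) = inverse (ennreal c) ^ k" if "c > 0" for c k
      using that by (simp add: ennreal_power inverse_ennreal power_inverse)
    from this[of "2 * pi" ?n] show ?thesis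
      by (simp add: m divide_ennreal_def prod.distrib)
  qed
  also have "\<dots> = (\<Prod>j\<in>UNIV. \<integral>\<^sup>+\<xi>. ennreal (g j \<xi>) \<partial>circle_lebesgue)"
  proof (intro prod.cong refl)
    fix j
    have "(\<integral>\<^sup>+t. ennreal (g j (cis t) * indicator {0..2*pi} t) \<partial>lborel) = (\<integral>\<^sup>+t. ennreal (g j (cis t)) * indicator {0..2*pi} t \<partial>lborel)"
      by (intro nn_integral_cong) (auto simp: indicator_def)
    then show "(\<integral>\<^sup>+t. ennreal (g j (cis t) * indicator {0..2*pi} t) \<partial>lborel) / ennreal (2 * pi) = (\<integral>\<^sup>+\<xi>. ennreal (g j \<xi>) \<partial>circle_lebesgue)"
      by (simp add: nn_integral_circle_lebesgue)
  qed
  finally show ?thesis .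
qed

lemma prob_space_torus_lebesgue: "prob_space (torus_lebesgue :: (complex ^ 'n) measure)"
proof
  interpret C: prob_space circle_lebesgue
    by (rule prob_space_circle_lebesgue)
  show "emeasure (torus_lebesgue :: (complex ^ 'n) measure) (space torus_lebesgue) = 1"
    using nn_integral_torus_prod[of "\<lambda>(_ :: 'n) _. 1"] C.emeasure_space_1 by simp
qed

lemma poisson_kernel_torus:
  "\<zeta> \<in> torus \<Longrightarrow> poisson_kernel z \<zeta> = (\<Prod>j\<in>UNIV. disc_kernel (z $ j) (\<zeta> $ j))"
  unfolding poisson_kernel_def torus_def by (intro prod.cong) (auto simp: disc_kernel_alt)

lemma poisson_kernel_sym:
  assumes "\<zeta> \<in> torus" "\<eta> \<in> torus"
  shows "poisson_kernel (of_real r *s \<zeta>) \<eta> = poisson_kernel (of_real r *s \<eta>) \<zeta>"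
  using assms unfolding poisson_kernel_torus[OF assms(1)] poisson_kernel_torus[OF assms(2)]
  by (intro prod.cong) (auto simp: torus_def disc_kernel_sym)

lemma poisson_kernel_rotate:
  assumes \<xi>: "norm \<xi> = 1" and \<zeta>: "\<zeta> \<in> torus"
  shows "poisson_kernel (\<xi> *s z) (\<xi> *s \<zeta>) = poisson_kernel z \<zeta>"
proof -
  have "\<xi> *s \<zeta> \<in> torus"
    using assms by (simp add: torus_def norm_mult)
  then show ?thesis
    using assms by (simp add: poisson_kernel_torus disc_kernel_rotate)
qed

lemma poisson_kernel_nonneg: "z \<in> polydisc \<Longrightarrow> \<zeta> \<in> torus \<Longrightarrow> 0 \<le> poisson_kernel z \<zeta>"
  by (auto simp: poisson_kernel_torus polydisc_def intro!: prod_nonneg disc_kernel_nonneg)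

lemma continuous_on_poisson_kernel [continuous_intros]:
  assumes f: "continuous_on S f" "continuous_on S g" and fg: "\<And>x. x \<in> S \<Longrightarrow> f x \<in> polydisc" "\<And>x. x \<in> S \<Longrightarrow> g x \<in> torus"
  shows "continuous_on S (\<lambda>x. poisson_kernel (f x) (g x))"
proof -
  have "continuous_on S (\<lambda>x. \<Prod>j\<in>UNIV. disc_kernel (f x $ j) (g x $ j))"
    using fg by (intro continuous_intros f) (auto simp: polydisc_def torus_def)
  then show ?thesis
    by (rule continuous_on_eq) (simp add: poisson_kernel_torus fg)
qed

lemma disc_kernel_measurable:
  assumes w: "norm w < 1"
  shows "disc_kernel w \<in> borel_measurable circle_borel"
  using w by (intro borel_measurable_continuous_on_restrict continuous_intros) auto

lemma nn_integral_poisson_kernel: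
  assumes z: "z \<in> polydisc"
  shows "(\<integral>\<^sup>+\<zeta>. ennreal (poisson_kernel z \<zeta>) \<partial>torus_lebesgue) = 1"
proof -
  have "(\<integral>\<^sup>+\<zeta>. ennreal (poisson_kernel z \<zeta>) \<partial>torus_lebesgue) = (\<integral>\<^sup>+\<zeta>. ennreal (\<Prod>j\<in>UNIV. disc_kernel (z $ j) (\<zeta> $ j)) \<partial>torus_lebesgue)"
    by (intro nn_integral_cong) (simp add: poisson_kernel_torus)
  also have "\<dots> = (\<Prod>j\<in>UNIV. \<integral>\<^sup>+\<xi>. ennreal (disc_kernel (z $ j) \<xi>) \<partial>circle_lebesgue)"
    using z by (intro nn_integral_torus_prod) (auto simp: polydisc_def disc_kernel_measurable disc_kernel_nonneg)
  also have "\<dots> = 1"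
    using z by (simp add: nn_integral_disc_kernel polydisc_def)
  finally show ?thesis .
qed

lemma torus_smult_polydisc: "norm w < 1 \<Longrightarrow> \<zeta> \<in> torus \<Longrightarrow> w *s \<zeta> \<in> polydisc"
  by (simp add: torus_def polydisc_def norm_mult)

text \<open>The squared distance is a sum over coordinates. In its \<open>k\<close>-th term the
  \<open>k\<close>-th factor contributes the moment \<open>2 - 2 * r\<close> of the disc kernel and
  every other factor contributes mass 1.\<close>

lemma nn_integral_poisson_kernel_dist:
  fixes \<eta> :: "complex ^ 'n" and r :: real
  assumes \<eta>: "\<eta> \<in> torus" and r: "0 \<le> r" "r < 1"
  shows "(\<integral>\<^sup>+\<zeta>. ennreal (poisson_kernel (of_real r *s \<eta>) \<zeta> * (dist \<zeta> \<eta>)\<^sup>2) \<partial>torus_lebesgue) = ennreal (CARD('n) * (2 - 2 * r))"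
proof -
  have 1: "norm (\<eta> $ j) = 1" for j
    using \<eta> by (simp add: torus_def)
  have w: "norm (of_real r * \<eta> $ j) < 1" for j
    using r 1 by (simp add: norm_mult)
  define g where "g k j \<xi> = disc_kernel (of_real r * \<eta> $ j) \<xi> * (if j = k then (dist \<xi> (\<eta> $ k))\<^sup>2 else 1)" for k j \<xi>
  have g_cont: "continuous_on (sphere 0 1) (g k j)" for k j
    unfolding g_def using w by (cases "j = k") (auto intro!: continuous_intros)
  have g_m: "g k j \<in> borel_measurable circle_borel" for k j
    by (rule borel_measurable_continuous_on_restrict[OF g_cont])
  have g_nn: "0 \<le> g k j \<xi>" for k j \<xi>
    unfolding g_def using w by (auto intro!: mult_nonneg_nonneg disc_kernel_nonneg)
  have [measurable]: "(\<lambda>\<zeta>. \<Prod>j\<in>UNIV. g k j (\<zeta> $ j)) \<in> borel_measurable torus_borel" for k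
    using measurable_compose[OF component_measurable g_m] by (intro borel_measurable_prod) auto
  have "poisson_kernel (of_real r *s \<eta>) \<zeta> * (dist \<zeta> \<eta>)\<^sup>2 = (\<Sum>k\<in>UNIV. \<Prod>j\<in>UNIV. g k j (\<zeta> $ j))" if \<zeta>: "\<zeta> \<in> torus" for \<zeta>
  proof -
    have "(dist \<zeta> \<eta>)\<^sup>2 = (\<Sum>k\<in>UNIV. (dist (\<zeta> $ k) (\<eta> $ k))\<^sup>2)"
      by (simp add: dist_vec_def L2_set_def sum_nonneg)
    moreover have "(\<Prod>j\<in>UNIV. g k j (\<zeta> $ j)) = poisson_kernel (of_real r *s \<eta>) \<zeta> * (dist (\<zeta> $ k) (\<eta> $ k))\<^sup>2" for k
    proof -
      have "(\<Prod>j\<in>UNIV. g k j (\<zeta> $ j)) = (\<Prod>j\<in>UNIV. disc_kernel (of_real r * \<eta> $ j) (\<zeta> $ j)) *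
          (\<Prod>j\<in>UNIV. if j = k then (dist (\<zeta> $ j) (\<eta> $ k))\<^sup>2 else 1)"
        by (simp only: g_def prod.distrib)
      then show ?thesis
        using \<zeta> by (simp add: poisson_kernel_torus prod.delta)
    qed
    ultimately show ?thesis
      by (simp add: sum_distrib_left)
  qed
  then have "(\<integral>\<^sup>+\<zeta>. ennreal (poisson_kernel (of_real r *s \<eta>) \<zeta> * (dist \<zeta> \<eta>)\<^sup>2) \<partial>torus_lebesgue)
      = (\<integral>\<^sup>+\<zeta>. (\<Sum>k\<in>UNIV. ennreal (\<Prod>j\<in>UNIV. g k j (\<zeta> $ j))) \<partial>torus_lebesgue)"
    using g_nn by (intro nn_integral_cong) (simp add: prod_nonneg)
  also have "\<dots> = (\<Sum>k\<in>UNIV. \<integral>\<^sup>+\<zeta>. ennreal (\<Prod>j\<in>UNIV. g k j (\<zeta> $ j)) \<partial>torus_lebesgue)"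
    by (intro nn_integral_sum) measurable
  also have "\<dots> = (\<Sum>k\<in>UNIV. \<Prod>j\<in>UNIV. \<integral>\<^sup>+\<xi>. ennreal (g k j \<xi>) \<partial>circle_lebesgue)"
    by (intro sum.cong nn_integral_torus_prod g_m g_nn refl)
  also have "\<dots> = (\<Sum>k\<in>(UNIV :: 'n set). \<Prod>j\<in>UNIV. if j = k then ennreal (2 - 2 * r) else 1)"
    using nn_integral_disc_kernel_dist[OF 1 r] nn_integral_disc_kernel[OF w]
    by (intro sum.cong prod.cong) (auto simp: g_def)
  also have "\<dots> = ennreal (CARD('n) * (2 - 2 * r))"
    using r by (simp add: prod.delta ennreal_mult ennreal_of_nat_eq_real_of_nat)
  finally show ?thesis .
qed

text \<open>A sequence of radii suffices for the limits and keeps the supremum of the circle means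
  measurable. The offset 2, rather than 1, makes \<open>radius 0\<close> positive, so that all radii
  lie in the open interval over which \<open>slice_bounded\<close> takes its supremum.\<close>

definition radius :: "nat \<Rightarrow> real" where
  "radius n = 1 - 1 / (real n + 2)"

lemma radius: "0 < radius n" "radius n < 1" "0 \<le> radius n"
  by (auto simp: radius_def field_simps)

lemma radius_tendsto: "radius \<longlonglongrightarrow> 1"
  unfolding radius_def by real_asymp

lemma mono_radius: "mono radius"
  unfolding radius_def by (intro monoI) (auto simp: field_simps)

text \<open>The first variable is the dilated one. Kernel symmetry moves the integration to the
  boundary slot, where mass and second moment are known.\<close>

interpretation torus: approximate_identity "torus_lebesgue :: (complex ^ 'n) measure" torus
  "\<lambda>n \<zeta>. poisson_kernel (of_real (radius n) *s \<zeta>)" "\<lambda>n. CARD('n) * (2 - 2 * radius n)"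
proof (intro approximate_identity.intro approximate_identity_axioms.intro)
  show "prob_space (torus_lebesgue :: (complex ^ 'n) measure)"
    by (rule prob_space_torus_lebesgue)
  show "compact (torus :: (complex ^ 'n) set)"
    by (rule compact_torus)
  fix n
  have pd: "of_real (radius n) *s \<zeta> \<in> polydisc" if "\<zeta> \<in> torus" for \<zeta> :: "complex ^ 'n"
    using radius[of n] that by (intro torus_smult_polydisc) auto
  show "continuous_on (torus \<times> torus) (\<lambda>(\<zeta>, \<eta>). poisson_kernel (of_real (radius n) *s \<zeta>) (\<eta> :: complex ^ 'n))"
    unfolding case_prod_unfold vector_scalar_mult_def
    by (intro continuous_intros) (use pd in \<open>auto simp: vector_scalar_mult_def\<close>)
  show "0 \<le> poisson_kernel (of_real (radius n) *s \<zeta>) \<eta>" if "\<zeta> \<in> torus" "\<eta> \<in> torus" for \<zeta> \<eta> :: "complex ^ 'n"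
    using that pd by (intro poisson_kernel_nonneg)
  show "(\<integral>\<^sup>+\<zeta>. ennreal (poisson_kernel (of_real (radius n) *s \<zeta>) \<eta>) \<partial>torus_lebesgue) = 1"
    if "\<eta> \<in> torus" for \<eta> :: "complex ^ 'n"
  proof -
    have "(\<integral>\<^sup>+\<zeta>. ennreal (poisson_kernel (of_real (radius n) *s \<zeta>) \<eta>) \<partial>torus_lebesgue)
       = (\<integral>\<^sup>+\<zeta>. ennreal (poisson_kernel (of_real (radius n) *s \<eta>) \<zeta>) \<partial>torus_lebesgue)"
      using that by (intro nn_integral_cong) (simp add: poisson_kernel_sym)
    then show ?thesis
      using that pd by (simp add: nn_integral_poisson_kernel)
  qed
  show "(\<integral>\<^sup>+\<zeta>. ennreal (poisson_kernel (of_real (radius n) *s \<zeta>) \<eta> * (dist \<zeta> \<eta>)\<^sup>2) \<partial>torus_lebesgue) \<le> ennreal (CARD('n) * (2 - 2 * radius n))"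
    if "\<eta> \<in> torus" for \<eta> :: "complex ^ 'n"
  proof -
    have "(\<integral>\<^sup>+\<zeta>. ennreal (poisson_kernel (of_real (radius n) *s \<zeta>) \<eta> * (dist \<zeta> \<eta>)\<^sup>2) \<partial>torus_lebesgue)
       = (\<integral>\<^sup>+\<zeta>. ennreal (poisson_kernel (of_real (radius n) *s \<eta>) \<zeta> * (dist \<zeta> \<eta>)\<^sup>2) \<partial>torus_lebesgue)"
      using that by (intro nn_integral_cong) (simp add: poisson_kernel_sym)
    then show ?thesis
      using that radius[of n] by (simp add: nn_integral_poisson_kernel_dist)
  qed
  show "0 \<le> CARD('n) * (2 - 2 * radius n)"
    using radius[of n] by simp
next
  have "(\<lambda>n. CARD('n) * (2 - 2 * radius n)) \<longlonglongrightarrow> real CARD('n) * (2 - 2 * 1)"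
    by (intro tendsto_intros radius_tendsto)
  then show "(\<lambda>n. CARD('n) * (2 - 2 * radius n)) \<longlonglongrightarrow> 0"
    by simp
qed (rule sets_torus_lebesgue)

interpretation circle: approximate_identity circle_lebesgue "sphere 0 1"
  "\<lambda>n \<xi>. disc_kernel (of_real (radius n) * \<xi>)" "\<lambda>n. 2 - 2 * radius n"
proof (intro approximate_identity.intro approximate_identity_axioms.intro)
  show "prob_space circle_lebesgue"
    by (rule prob_space_circle_lebesgue)
  show "compact (sphere 0 1 :: complex set)"
    by simp
  fix n
  have pd: "norm (of_real (radius n) * \<xi>) < 1" if "\<xi> \<in> sphere 0 1" for \<xi> :: complex
    using radius[of n] that by (simp add: norm_mult)
  show "continuous_on (sphere 0 1 \<times> sphere 0 1) (\<lambda>(\<xi>, \<eta>). disc_kernel (of_real (radius n) * \<xi>) \<eta>)"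
    unfolding case_prod_unfold by (intro continuous_intros) (use pd in auto)
  show "0 \<le> disc_kernel (of_real (radius n) * \<xi>) \<eta>" if "\<xi> \<in> sphere 0 1" "\<eta> \<in> sphere 0 1" for \<xi> \<eta>
    using that pd by (intro disc_kernel_nonneg)
  show "(\<integral>\<^sup>+\<xi>. ennreal (disc_kernel (of_real (radius n) * \<xi>) \<eta>) \<partial>circle_lebesgue) = 1"
    if "\<eta> \<in> sphere 0 1" for \<eta>
  proof -
    have "(\<integral>\<^sup>+\<xi>. ennreal (disc_kernel (of_real (radius n) * \<xi>) \<eta>) \<partial>circle_lebesgue)
       = (\<integral>\<^sup>+\<xi>. ennreal (disc_kernel (of_real (radius n) * \<eta>) \<xi>) \<partial>circle_lebesgue)"
      using that by (intro nn_integral_cong) (simp add: disc_kernel_sym)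
    then show ?thesis
      using that pd by (simp add: nn_integral_disc_kernel)
  qed
  show "(\<integral>\<^sup>+\<xi>. ennreal (disc_kernel (of_real (radius n) * \<xi>) \<eta> * (dist \<xi> \<eta>)\<^sup>2) \<partial>circle_lebesgue) \<le> ennreal (2 - 2 * radius n)"
    if "\<eta> \<in> sphere 0 1" for \<eta>
  proof -
    have "(\<integral>\<^sup>+\<xi>. ennreal (disc_kernel (of_real (radius n) * \<xi>) \<eta> * (dist \<xi> \<eta>)\<^sup>2) \<partial>circle_lebesgue)
       = (\<integral>\<^sup>+\<xi>. ennreal (disc_kernel (of_real (radius n) * \<eta>) \<xi> * (dist \<xi> \<eta>)\<^sup>2) \<partial>circle_lebesgue)"
      using that by (intro nn_integral_cong) (simp add: disc_kernel_sym)
    then show ?thesis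
      using that radius[of n] by (simp add: nn_integral_disc_kernel_dist)
  qed
  show "0 \<le> 2 - 2 * radius n"
    using radius[of n] by simp
next
  have "(\<lambda>n. 2 - 2 * radius n) \<longlonglongrightarrow> 2 - 2 * 1"
    by (intro tendsto_intros radius_tendsto)
  then show "(\<lambda>n. 2 - 2 * radius n) \<longlonglongrightarrow> 0"
    by simp
qed (rule sets_circle_lebesgue)

section \<open>Slices of pluriharmonic functions\<close>

lemma open_polydisc: "open (polydisc :: (complex ^ 'n) set)"
proof -
  have "(polydisc :: (complex ^ 'n) set) = (\<Inter>j. {z. norm (z $ j) < 1})"
    by (auto simp: polydisc_def)
  also have "open \<dots>"
    by (intro open_INT ballI open_Collect_less continuous_intros) simp
  finally show ?thesis .
qed

lemma directional_deriv_eq: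
  assumes "(f has_derivative f') (at z)"
  shows "directional_deriv v f z = f' v"
proof -
  have "(f has_derivative f') (at (z + 0 *\<^sub>R v))"
    using assms by simp
  then have "((\<lambda>t. f (z + t *\<^sub>R v)) has_derivative (\<lambda>t. f' (t *\<^sub>R v))) (at 0)"
    by (rule has_derivative_compose[rotated]) (auto intro!: derivative_eq_intros)
  moreover have "f' (t *\<^sub>R v) = t *\<^sub>R f' v" for t
    using has_derivative_linear[OF assms] by (rule linear_scale)
  ultimately have "((\<lambda>t. f (z + t *\<^sub>R v)) has_vector_derivative f' v) (at 0)"
    by (simp add: has_vector_derivative_def)
  then show ?thesis
    unfolding directional_deriv_def by (rule vector_derivative_at)
qed

section \<open>The Levi form\<close>

lemma smult_i_axis: "\<i> *s axis k 1 = axis k \<i>"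
  by (simp add: vec_eq_iff axis_def)

lemma complex_smult_eq: "c *s v = Re c *\<^sub>R v + Im c *\<^sub>R (\<i> *s v)"
  for v :: "complex ^ 'n"
  by (simp add: vec_eq_iff complex_eq_iff)

text \<open>The complex Hessian form: \<open>levi_form B v w\<close> is \<open>4 \<Sum>\<^sub>j\<^sub>k v\<^sub>j (cnj w)\<^sub>k \<partial>\<^sub>j \<partial>bar\<^sub>k u\<close> when \<open>B\<close> is the second
  real derivative of \<open>u\<close>.\<close>
definition levi_form :: "(complex ^ 'n \<Rightarrow> complex ^ 'n \<Rightarrow> complex) \<Rightarrow> complex ^ 'n \<Rightarrow> complex ^ 'n \<Rightarrow> complex" where
  "levi_form B v w = B v w + \<i> * B v (\<i> *s w) - \<i> * B (\<i> *s v) w + B (\<i> *s v) (\<i> *s w)"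

text \<open>The four terms keep, up to the factor 4, the part of a real bilinear form that is
  complex linear in the first argument and conjugate linear in the second.\<close>

lemma levi_form_smult:
  fixes B :: "complex ^ 'n \<Rightarrow> complex ^ 'n \<Rightarrow> complex"
  assumes "bounded_bilinear B"
  shows "levi_form B (c *s v) w = c * levi_form B v w" "levi_form B v (c *s w) = cnj c * levi_form B v w"
proof -
  interpret B: bounded_bilinear B by fact
  have i: "\<i> *s (c *s v) = Re c *\<^sub>R (\<i> *s v) - Im c *\<^sub>R v" for v :: "complex ^ 'n"
    by (simp add: vec_eq_iff complex_eq_iff)
  show "levi_form B (c *s v) w = c * levi_form B v w" "levi_form B v (c *s w) = cnj c * levi_form B v w"
    unfolding levi_form_def unfolding i unfolding complex_smult_eq[of c v] complex_smult_eq[of c w]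
    by (simp_all add: B.add_left B.add_right B.diff_left B.diff_right B.scaleR_left B.scaleR_right complex_eq_iff algebra_simps)
qed

lemma levi_form_sum:
  fixes B :: "complex ^ 'n \<Rightarrow> complex ^ 'n \<Rightarrow> complex" and f :: "'a \<Rightarrow> complex ^ 'n"
  assumes "bounded_bilinear B"
  shows "levi_form B (sum f S) w = (\<Sum>j\<in>S. levi_form B (f j) w)" "levi_form B v (sum f S) = (\<Sum>j\<in>S. levi_form B v (f j))"
proof -
  interpret B: bounded_bilinear B by fact
  have i: "\<i> *s (sum f S) = (\<Sum>j\<in>S. \<i> *s f j)" for f :: "'a \<Rightarrow> complex ^ 'n"
    by (simp add: vec_eq_iff sum_distrib_left)
  show "levi_form B (sum f S) w = (\<Sum>j\<in>S. levi_form B (f j) w)" "levi_form B v (sum f S) = (\<Sum>j\<in>S. levi_form B v (f j))"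
    unfolding levi_form_def i
    by (simp_all add: B.sum_left B.sum_right sum.distrib sum_subtractf sum_distrib_left)
qed

text \<open>Pluriharmonicity speaks only of coordinate directions; sesquilinearity carries the
  vanishing to the direction \<zeta> of a slice.\<close>

lemma levi_form_zeroI:
  fixes B :: "complex ^ 'n \<Rightarrow> complex ^ 'n \<Rightarrow> complex"
  assumes B: "bounded_bilinear B" and 0: "\<And>j k. levi_form B (axis j 1) (axis k 1) = 0"
  shows "levi_form B v w = 0"
proof -
  have "levi_form B v w = levi_form B (\<Sum>j\<in>UNIV. v $ j *s axis j 1) (\<Sum>k\<in>UNIV. w $ k *s axis k 1)"
    by (simp add: basis_expansion)
  also have "\<dots> = 0"
    by (simp add: levi_form_sum[OF B] levi_form_smult[OF B] 0)
  finally show ?thesis .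
qed

text \<open>Each of the two Wirtinger operators contributes a factor 1/2, whence the division by
  4.\<close>

lemma wirtinger_eq_levi_form:
  fixes u :: "complex ^ 'n \<Rightarrow> complex"
  assumes S: "open S" "z \<in> S"
    and u': "\<And>x. x \<in> S \<Longrightarrow> (u has_derivative blinfun_apply (u' x)) (at x)"
    and u'': "(u' has_derivative blinfun_apply u'') (at z)"
  shows "wirtinger j (wirtinger_bar k u) z = levi_form (\<lambda>v. blinfun_apply (blinfun_apply u'' v)) (axis j 1) (axis k 1) / 4"
proof -
  have b: "wirtinger_bar k u x = (blinfun_apply (u' x) (axis k 1) + \<i> * blinfun_apply (u' x) (axis k \<i>)) / 2" if "x \<in> S" for x
    unfolding wirtinger_bar_def using directional_deriv_eq[OF u'[OF that]] by simp
  have "((\<lambda>x. (blinfun_apply (u' x) (axis k 1) + \<i> * blinfun_apply (u' x) (axis k \<i>)) / 2) has_derivative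
      (\<lambda>v. (blinfun_apply (blinfun_apply u'' v) (axis k 1) + \<i> * blinfun_apply (blinfun_apply u'' v) (axis k \<i>)) / 2)) (at z)"
    by (auto intro!: derivative_eq_intros u'' simp: blinfun.zero_right)
  then have "(wirtinger_bar k u has_derivative
      (\<lambda>v. (blinfun_apply (blinfun_apply u'' v) (axis k 1) + \<i> * blinfun_apply (blinfun_apply u'' v) (axis k \<i>)) / 2)) (at z)"
    by (rule has_derivative_transform_within_open[OF _ S]) (simp add: b)
  note d = directional_deriv_eq[OF this]
  show ?thesis
    unfolding wirtinger_def levi_form_def smult_i_axis d by (simp add: field_simps)
qed

text \<open>The hypothesis on \<open>D\<close> is the Cauchy-Riemann equation.\<close>

lemma has_field_derivativeI_linear:
  fixes f :: "complex \<Rightarrow> complex"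
  assumes f: "(f has_derivative D) (at z)" and D: "D \<i> = \<i> * D 1"
  shows "(f has_field_derivative D 1) (at z)"
proof -
  interpret linear D
    using f by (rule has_derivative_linear)
  have "D d = D 1 * d" for d
  proof -
    have "D d = D (Re d *\<^sub>R 1 + Im d *\<^sub>R \<i>)"
      by (rule arg_cong[of _ _ D]) (simp add: complex_eq_iff)
    also have "\<dots> = Re d *\<^sub>R D 1 + Im d *\<^sub>R D \<i>"
      by (simp only: add scale)
    also have "\<dots> = D 1 * d"
      by (simp add: D complex_eq_iff algebra_simps)
    finally show ?thesis .
  qed
  then have "D = (*) (D 1)"
    by (rule ext)
  then show ?thesis
    using f unfolding has_field_derivative_def by simp
qed

text \<open>With \<open>h\<close> the slice, \<open>p\<close> and \<open>q\<close> are its partial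
  derivatives in the real and imaginary directions, and \<open>g\<close> is its derivative with
  respect to the conjugate variable. Pluriharmonicity makes \<open>cnj g\<close> holomorphic; a
  primitive \<open>H\<close> exists on the disc, and subtracting \<open>cnj H\<close> from
  \<open>h\<close> removes the conjugate derivative altogether.\<close>

lemma pluriharmonic_slice_decomposition:
  fixes u :: "complex ^ 'n \<Rightarrow> complex"
  assumes u: "pluriharmonic_on polydisc u" and \<zeta>: "\<zeta> \<in> torus"
  obtains G H where "G holomorphic_on ball 0 1" "H holomorphic_on ball 0 1"
    "\<And>w. norm w < 1 \<Longrightarrow> u (w *s \<zeta>) = G w + cnj (H w)"
proof -
  obtain u' u'' where u': "\<And>x. x \<in> polydisc \<Longrightarrow> (u has_derivative blinfun_apply (u' x)) (at x)"
    and u'': "\<And>x. x \<in> polydisc \<Longrightarrow> (u' has_derivative blinfun_apply (u'' x)) (at x)"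
    using u unfolding pluriharmonic_on_def C2_on_def by blast
  have levi: "levi_form (\<lambda>v. blinfun_apply (blinfun_apply (u'' z) v)) v w = 0" if z: "z \<in> polydisc" for z v w
  proof (rule levi_form_zeroI)
    show "bounded_bilinear (\<lambda>v. blinfun_apply (blinfun_apply (u'' z) v))"
      by (rule bounded_bilinear.comp1[OF bounded_bilinear_blinfun_apply blinfun.bounded_linear_right])
    fix j k
    have "wirtinger j (wirtinger_bar k u) z = 0"
      using u z unfolding pluriharmonic_on_def by blast
    then show "levi_form (\<lambda>v. blinfun_apply (blinfun_apply (u'' z) v)) (axis j 1) (axis k 1) = 0"
      by (simp add: wirtinger_eq_levi_form[OF open_polydisc z u' u''[OF z]])
  qed
  have lin: "bounded_linear (\<lambda>w. w *s \<zeta>)"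
  proof (intro linear_conv_bounded_linear[THEN iffD1] linearI)
    show "(b + c) *s \<zeta> = b *s \<zeta> + c *s \<zeta>" for b c
      by (simp add: vec_eq_iff algebra_simps)
    show "(r *\<^sub>R b) *s \<zeta> = r *\<^sub>R (b *s \<zeta>)" for r b
      by (simp add: vec_eq_iff)
  qed
  define h where "h w = u (w *s \<zeta>)" for w
  define p q where "p w = blinfun_apply (u' (w *s \<zeta>)) \<zeta>" and "q w = blinfun_apply (u' (w *s \<zeta>)) (\<i> *s \<zeta>)" for w
  define g where "g w = (p w + \<i> * q w) / 2" for w
  have pd: "w *s \<zeta> \<in> polydisc" if "norm w < 1" for w
    using torus_smult_polydisc[OF that \<zeta>] .
  have dlin: "((\<lambda>w. w *s \<zeta>) has_derivative (\<lambda>d. d *s \<zeta>)) (at w)" for w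
    using lin by (rule bounded_linear_imp_has_derivative)
  have h': "(h has_derivative (\<lambda>d. Re d *\<^sub>R p w + Im d *\<^sub>R q w)) (at w)" if w: "norm w < 1" for w
  proof -
    have "(h has_derivative (\<lambda>d. blinfun_apply (u' (w *s \<zeta>)) (d *s \<zeta>))) (at w)"
      unfolding h_def by (rule has_derivative_compose[OF dlin u'[OF pd[OF w]]])
    moreover have "blinfun_apply (u' (w *s \<zeta>)) (d *s \<zeta>) = Re d *\<^sub>R p w + Im d *\<^sub>R q w" for d
      unfolding complex_smult_eq[of d \<zeta>] p_def q_def by (simp only: blinfun.add_right blinfun.scaleR_right)
    ultimately show ?thesis
      by simp
  qed
  have g': "((\<lambda>w. cnj (g w)) has_field_derivative
      cnj ((blinfun_apply (blinfun_apply (u'' (w *s \<zeta>)) \<zeta>) \<zeta> + \<i> * blinfun_apply (blinfun_apply (u'' (w *s \<zeta>)) \<zeta>) (\<i> *s \<zeta>)) / 2)) (at w)"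
    if w: "norm w < 1" for w
  proof -
    define B where "B v = blinfun_apply (blinfun_apply (u'' (w *s \<zeta>)) v)" for v
    have du: "((\<lambda>w. u' (w *s \<zeta>)) has_derivative (\<lambda>d. blinfun_apply (u'' (w *s \<zeta>)) (d *s \<zeta>))) (at w)"
      by (rule has_derivative_compose[OF dlin u''[OF pd[OF w]]])
    have "(g has_derivative (\<lambda>d. (B (d *s \<zeta>) \<zeta> + \<i> * B (d *s \<zeta>) (\<i> *s \<zeta>)) / 2)) (at w)"
      unfolding g_def p_def q_def B_def
      by (auto intro!: derivative_eq_intros du simp: blinfun.zero_right)
    then have "((\<lambda>w. cnj (g w)) has_derivative (\<lambda>d. cnj ((B (d *s \<zeta>) \<zeta> + \<i> * B (d *s \<zeta>) (\<i> *s \<zeta>)) / 2))) (at w)"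
      by (rule has_derivative_cnj)
    \<comment> \<open>The vanishing of the Levi form at the pair \<zeta>, \<zeta>, rearranged and
      conjugated, is the Cauchy-Riemann equation for \<open>cnj g\<close>.\<close>
    moreover have "cnj ((B (\<i> *s \<zeta>) \<zeta> + \<i> * B (\<i> *s \<zeta>) (\<i> *s \<zeta>)) / 2) = \<i> * cnj ((B (1 *s \<zeta>) \<zeta> + \<i> * B (1 *s \<zeta>) (\<i> *s \<zeta>)) / 2)"
      using levi[OF pd[OF w], of \<zeta> \<zeta>] unfolding levi_form_def B_def[symmetric]
      by (simp add: complex_eq_iff)
    ultimately have "((\<lambda>w. cnj (g w)) has_field_derivative cnj ((B (1 *s \<zeta>) \<zeta> + \<i> * B (1 *s \<zeta>) (\<i> *s \<zeta>)) / 2)) (at w)"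
      by (rule has_field_derivativeI_linear)
    then show ?thesis
      by (simp add: B_def)
  qed
  then have "\<exists>f'. ((\<lambda>w. cnj (g w)) has_field_derivative f') (at w)" if "norm w < 1" for w
    using that by blast
  then have "(\<lambda>w. cnj (g w)) holomorphic_on ball 0 1"
    unfolding holomorphic_on_open[OF open_ball] by auto
  then obtain H where H: "\<And>w. w \<in> ball 0 1 \<Longrightarrow> (H has_field_derivative cnj (g w)) (at w within ball 0 1)"
    using holomorphic_convex_primitive'[OF convex_ball open_ball] by blast
  have H': "(H has_field_derivative cnj (g w)) (at w)" if "norm w < 1" for w
    using H[of w] that by (simp add: at_within_open[OF _ open_ball])
  show ?thesis
  proof (rule that[of "\<lambda>w. h w - cnj (H w)" H])
    show "H holomorphic_on ball 0 1"
      unfolding holomorphic_on_open[OF open_ball] using H' mem_ball_0 by blast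
    have "((\<lambda>w. h w - cnj (H w)) has_field_derivative (Re 1 *\<^sub>R p w + Im 1 *\<^sub>R q w) - cnj (cnj (g w) * 1)) (at w)"
      if w: "norm w < 1" for w
    proof (rule has_field_derivativeI_linear)
      show "((\<lambda>w. h w - cnj (H w)) has_derivative (\<lambda>d. (Re d *\<^sub>R p w + Im d *\<^sub>R q w) - cnj (cnj (g w) * d))) (at w)"
        using H'[OF w] unfolding has_field_derivative_def
        by (intro has_derivative_diff h' w has_derivative_cnj)
      show "(Re \<i> *\<^sub>R p w + Im \<i> *\<^sub>R q w) - cnj (cnj (g w) * \<i>) = \<i> * ((Re 1 *\<^sub>R p w + Im 1 *\<^sub>R q w) - cnj (cnj (g w) * 1))"
        by (simp add: g_def complex_eq_iff field_simps)
    qed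
    then show "(\<lambda>w. h w - cnj (H w)) holomorphic_on ball 0 1"
      unfolding holomorphic_on_open[OF open_ball] using mem_ball_0 by blast
  qed (simp add: h_def)
qed

lemma pluriharmonic_slice_continuous:
  fixes u :: "complex ^ 'n \<Rightarrow> complex"
  assumes u: "pluriharmonic_on polydisc u" and \<zeta>: "\<zeta> \<in> torus"
  shows "continuous_on (ball 0 1) (\<lambda>w. u (w *s \<zeta>))"
proof -
  obtain G H where GH: "G holomorphic_on ball 0 1" "H holomorphic_on ball 0 1"
    "\<And>w. norm w < 1 \<Longrightarrow> u (w *s \<zeta>) = G w + cnj (H w)"
    by (rule pluriharmonic_slice_decomposition[OF u \<zeta>]) blast
  have "continuous_on (ball 0 1) (\<lambda>w. G w + cnj (H w))"
    using GH by (intro continuous_intros holomorphic_on_imp_continuous_on)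
  then show ?thesis
    by (rule continuous_on_eq) (simp add: GH(3))
qed

text \<open>\<open>G\<close> and \<open>H\<close> are controlled only inside the open disc; dilation
  by \<open>s < 1\<close> makes them continuous on the closed disc, where the Poisson formula
  applies.\<close>

lemma pluriharmonic_slice_poisson:
  fixes u :: "complex ^ 'n \<Rightarrow> complex"
  assumes u: "pluriharmonic_on polydisc u" and \<zeta>: "\<zeta> \<in> torus"
    and s: "0 \<le> s" "s < 1" and w: "norm w < 1"
  shows "(\<integral>\<xi>. of_real (disc_kernel w \<xi>) * u ((of_real s * \<xi>) *s \<zeta>) \<partial>circle_lebesgue) = u ((of_real s * w) *s \<zeta>)"
proof -
  obtain G H where GH: "G holomorphic_on ball 0 1" "H holomorphic_on ball 0 1"
    "\<And>w. norm w < 1 \<Longrightarrow> u (w *s \<zeta>) = G w + cnj (H w)"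
    by (rule pluriharmonic_slice_decomposition[OF u \<zeta>]) blast
  have lt: "norm (of_real s * \<xi>) < 1" if "norm \<xi> \<le> 1" for \<xi> :: complex
  proof -
    have "norm (of_real s * \<xi>) \<le> s * 1"
      unfolding norm_mult using that s by (intro mult_mono) auto
    then show ?thesis
      using s by simp
  qed
  have c: "continuous_on (cball 0 1) (\<lambda>\<xi>. F (of_real s * \<xi>))" if "F holomorphic_on ball 0 1" for F
    using lt by (intro continuous_on_compose2[OF holomorphic_on_imp_continuous_on[OF that]] continuous_intros) auto
  have h: "(\<lambda>\<xi>. F (of_real s * \<xi>)) holomorphic_on ball 0 1" if F: "F holomorphic_on ball 0 1" for F
  proof (rule holomorphic_on_compose_gen[of "\<lambda>\<xi>. of_real s * \<xi>" "ball 0 1" F "ball 0 1", unfolded o_def])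
    show "(\<lambda>\<xi> :: complex. of_real s * \<xi>) ` ball 0 1 \<subseteq> ball 0 1"
      using lt by (auto simp: less_imp_le)
  qed (intro holomorphic_intros F)+
  have "(\<integral>\<xi>. of_real (disc_kernel w \<xi>) * u ((of_real s * \<xi>) *s \<zeta>) \<partial>circle_lebesgue)
      = (\<integral>\<xi>. of_real (disc_kernel w \<xi>) * (G (of_real s * \<xi>) + cnj (H (of_real s * \<xi>))) \<partial>circle_lebesgue)"
    by (intro Bochner_Integration.integral_cong refl) (simp add: GH(3) lt)
  also have "\<dots> = G (of_real s * w) + cnj (H (of_real s * w))"
    using GH w by (intro poisson_formula_harmonic c h)
  also have "\<dots> = u ((of_real s * w) *s \<zeta>)"
    using w by (simp add: GH(3) lt)
  finally show ?thesis .
qed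

section \<open>Herglotz representation\<close>

text \<open>Helly's theorem is available for probability distributions on the line, so the circle is unrolled to
  \<open>[0, 2\<pi>]\<close>; the density 1 is added to keep the total masses away from zero.\<close>
lemma circle_sequence_weak_limit:
  fixes q :: "nat \<Rightarrow> complex \<Rightarrow> real"
  assumes cont: "\<And>n. continuous_on (sphere 0 1) (q n)" and nn: "\<And>n \<xi>. norm \<xi> = 1 \<Longrightarrow> 0 \<le> q n \<xi>"
    and C: "\<And>n. (\<integral>\<xi>. q n \<xi> \<partial>circle_lebesgue) \<le> C"
  obtains \<sigma> a where "strict_mono (\<sigma> :: nat \<Rightarrow> nat)" "finite_measure a" "sets a = sets circle_borel"
    "\<And>\<phi> :: complex \<Rightarrow> complex. continuous_on (sphere 0 1) \<phi> \<Longrightarrow>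
      (\<lambda>n. \<integral>\<xi>. \<phi> \<xi> * of_real (q (\<sigma> n) \<xi>) \<partial>circle_lebesgue) \<longlonglongrightarrow> (\<integral>\<xi>. \<phi> \<xi> \<partial>a) - (\<integral>\<xi>. \<phi> \<xi> \<partial>circle_lebesgue)"
proof -
  have cis_m [measurable]: "cis \<in> measurable borel circle_borel"
    by (rule cis_measurable)
  define U where "U = uniform_measure lborel {0..2 * pi}"
  have sets_U [measurable_cong]: "sets U = sets borel"
    by (simp add: U_def)
  have cl: "circle_lebesgue = distr U circle_borel cis"
    by (simp add: circle_lebesgue_def U_def)
  have int_U: "(\<integral>\<xi>. g \<xi> \<partial>circle_lebesgue) = (\<integral>t. g (cis t) \<partial>U)"
    if "g \<in> borel_measurable circle_borel" for g :: "complex \<Rightarrow> complex"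
    unfolding cl using that by (subst integral_distr) auto
  define M where "M n = (\<integral>\<xi>. q n \<xi> + 1 \<partial>circle_lebesgue)" for n
  have M_eq: "M n = (\<integral>\<xi>. q n \<xi> \<partial>circle_lebesgue) + 1" for n
    using circle.continuous_integrable[OF cont] circle.prob_space by (simp add: M_def)
  have q_int_nn: "0 \<le> (\<integral>\<xi>. q n \<xi> \<partial>circle_lebesgue)" for n
    using nn by (intro integral_nonneg_AE AE_I2) auto
  have M: "M n \<in> {1..C + 1}" for n
    using C[of n] q_int_nn[of n] by (simp add: M_eq)
  \<comment> \<open>The masses lie in a compact interval bounded away from 0. Their convergence is
    secured first, Helly's theorem then refines the subsequence.\<close>
  obtain m \<sigma>1 where \<sigma>1: "strict_mono (\<sigma>1 :: nat \<Rightarrow> nat)" "(M \<circ> \<sigma>1) \<longlonglongrightarrow> m" and m: "m \<in> {1..C + 1}"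
    using compact_Icc[of 1 "C + 1"] M unfolding compact_def by metis
  define d where "d n t = (q n (cis t) + 1) / M n" for n t
  have q_m: "q n \<in> borel_measurable circle_borel" for n
    by (rule borel_measurable_continuous_on_restrict[OF cont])
  have qcis [measurable]: "(\<lambda>t. q n (cis t)) \<in> borel_measurable borel" for n
    using measurable_compose[OF cis_m q_m] .
  have d_m [measurable]: "d n \<in> borel_measurable borel" for n
    unfolding d_def by measurable
  have d_nn: "0 \<le> d n t" for n t
    using M[of n] nn[of "cis t" n] by (simp add: d_def)
  define \<mu> where "\<mu> n = density U (\<lambda>t. ennreal (d n t))" for n
  have int_\<mu>: "(\<integral>t. \<phi> (cis t) \<partial>\<mu> n) = (\<integral>\<xi>. \<phi> \<xi> * of_real (q n \<xi> + 1) \<partial>circle_lebesgue) / of_real (M n)"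
    if \<phi>: "\<phi> \<in> borel_measurable circle_borel" for \<phi> :: "complex \<Rightarrow> complex" and n
  proof -
    have [measurable]: "(\<lambda>t. \<phi> (cis t)) \<in> borel_measurable borel"
      using measurable_compose[OF cis_m \<phi>] .
    have "(\<integral>t. \<phi> (cis t) \<partial>\<mu> n) = (\<integral>t. d n t *\<^sub>R \<phi> (cis t) \<partial>U)"
      unfolding \<mu>_def using d_nn by (intro integral_density) auto
    also have "\<dots> = (\<integral>t. (\<phi> (cis t) * of_real (q n (cis t) + 1)) / of_real (M n) \<partial>U)"
      by (intro Bochner_Integration.integral_cong refl) (simp add: d_def scaleR_conv_of_real)
    also have "\<dots> = (\<integral>t. \<phi> (cis t) * of_real (q n (cis t) + 1) \<partial>U) / of_real (M n)"
      by simp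
    also have "(\<integral>t. \<phi> (cis t) * of_real (q n (cis t) + 1) \<partial>U) = (\<integral>\<xi>. \<phi> \<xi> * of_real (q n \<xi> + 1) \<partial>circle_lebesgue)"
    proof (rule int_U[symmetric])
      note [measurable] = \<phi> q_m
      show "(\<lambda>\<xi>. \<phi> \<xi> * of_real (q n \<xi> + 1)) \<in> borel_measurable circle_borel"
        by measurable
    qed
    finally show ?thesis .
  qed
  have real_dist: "real_distribution (\<mu> n)" for n
  proof -
    have "emeasure (\<mu> n) (space (\<mu> n)) = (\<integral>\<^sup>+t. ennreal (d n t) \<partial>U)"
      unfolding \<mu>_def by (subst emeasure_density) (auto intro!: nn_integral_cong)
    also have "\<dots> = (\<integral>\<^sup>+\<xi>. ennreal ((q n \<xi> + 1) / M n) \<partial>circle_lebesgue)"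
      unfolding cl using q_m by (subst nn_integral_distr) (auto simp: d_def)
    also have "\<dots> = ennreal (\<integral>\<xi>. (q n \<xi> + 1) / M n \<partial>circle_lebesgue)"
      using nn M[of n] by (intro nn_integral_eq_integral circle.continuous_integrable continuous_intros cont AE_I2) auto
    also have "(\<integral>\<xi>. (q n \<xi> + 1) / M n \<partial>circle_lebesgue) = 1"
      using M[of n] by (simp add: M_def[symmetric])
    finally have "prob_space (\<mu> n)"
      by (intro prob_spaceI) simp
    then show ?thesis
      by (intro real_distribution.intro real_distribution_axioms.intro) (simp_all add: \<mu>_def U_def)
  qed
  have "tight \<mu>"
    unfolding tight_def
  proof (intro conjI allI impI)
    fix \<epsilon> :: real assume \<epsilon>: "\<epsilon> > 0"
    \<comment> \<open>Tightness is formulated with intervals open on the left, so the left end is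
      moved below 0.\<close>
    have "measure (\<mu> n) {-1<..2*pi} = 1" for n
    proof -
      interpret \<mu>: real_distribution "\<mu> n"
        by (rule real_dist)
      have "AE t in U. t \<in> {-1<..2*pi}"
        unfolding U_def by (intro AE_uniform_measureI AE_I2) auto
      then have "AE t in \<mu> n. t \<in> {-1<..2*pi}"
        unfolding \<mu>_def by (subst AE_density) auto
      then show ?thesis
        by (subst \<mu>.prob_eq_1) (auto simp: \<mu>.events_eq_borel)
    qed
    moreover have "(-1 :: real) < 2 * pi"
      using pi_gt_zero by linarith
    ultimately show "\<exists>a b. a < b \<and> (\<forall>n. 1 - \<epsilon> < measure (\<mu> n) {a<..b})"
      using \<epsilon> by (intro exI[of _ "-1"] exI[of _ "2*pi"]) auto
  qed (rule real_dist)
  from tight_imp_convergent_subsubsequence[OF this \<sigma>1(1)] obtain r L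
    where r: "strict_mono (r :: nat \<Rightarrow> nat)" and L: "real_distribution L" "weak_conv_m (\<mu> \<circ> \<sigma>1 \<circ> r) L"
    by blast
  interpret L: real_distribution L
    by (rule L(1))
  have [measurable]: "cis \<in> measurable L circle_borel"
    using cis_m by (simp add: measurable_cong_sets[OF L.events_eq_borel refl])
  define \<sigma> where "\<sigma> = \<sigma>1 \<circ> r"
  \<comment> \<open>The factor \<open>m\<close> undoes the normalisation to probability laws. The
    limit still contains the added density 1, which accounts for the subtracted Lebesgue integral in
    the conclusion.\<close>
  define a where "a = density (distr L circle_borel cis) (\<lambda>_. ennreal m)"
  have \<sigma>: "strict_mono \<sigma>"
    unfolding \<sigma>_def by (intro strict_mono_o \<sigma>1 r)
  have Mlim: "(\<lambda>n. M (\<sigma> n)) \<longlonglongrightarrow> m"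
    using LIMSEQ_subseq_LIMSEQ[OF \<sigma>1(2) r] by (simp add: \<sigma>_def o_def)
  show ?thesis
  proof (rule that[of \<sigma> a])
    show "strict_mono \<sigma>"
      by fact
    show "finite_measure a"
    proof
      have "emeasure a (space a) = ennreal m * emeasure (distr L circle_borel cis) (space circle_borel)"
        unfolding a_def using sets.top[of circle_borel]
        by (subst emeasure_density_const) (auto simp: space_restrict_space)
      also have "\<dots> = ennreal m"
        using prob_space.emeasure_space_1[OF L.prob_space_distr[OF \<open>cis \<in> measurable L circle_borel\<close>]] by simp
      finally show "emeasure a (space a) \<noteq> \<infinity>"
        by simp
    qed
    show "sets a = sets circle_borel"
      by (simp add: a_def)
    fix \<phi> :: "complex \<Rightarrow> complex" assume \<phi>: "continuous_on (sphere 0 1) \<phi>"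
    have \<phi>m [measurable]: "\<phi> \<in> borel_measurable circle_borel"
      by (rule borel_measurable_continuous_on_restrict[OF \<phi>])
    obtain B where B: "\<And>\<xi>. \<xi> \<in> sphere 0 1 \<Longrightarrow> norm (\<phi> \<xi>) \<le> B"
      using compact_bounded_continuous[OF compact_sphere \<phi>] by metis
    \<comment> \<open>The endpoints 0 and \<open>2 * pi\<close> cause no trouble: the unrolled test
      function is continuous and bounded on the whole line, and the limit law is wrapped back by
      \<open>cis\<close>.\<close>
    have "continuous_on UNIV (\<lambda>t. \<phi> (cis t))"
      by (intro continuous_on_compose2[OF \<phi>] continuous_intros) auto
    then have "isCont (\<lambda>t. \<phi> (cis t)) x" for x
      by (simp add: continuous_on_eq_continuous_at)
    then have "(\<lambda>n. \<integral>t. \<phi> (cis t) \<partial>(\<mu> \<circ> \<sigma>1 \<circ> r) n) \<longlonglongrightarrow> (\<integral>t. \<phi> (cis t) \<partial>L)"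
      using B by (intro weak_conv_imp_integral_bdd_continuous_conv[OF _ L(1,2), where B = B]) (auto simp: real_dist)
    then have "(\<lambda>n. of_real (M (\<sigma> n)) * (\<integral>t. \<phi> (cis t) \<partial>\<mu> (\<sigma> n))) \<longlonglongrightarrow> of_real m * (\<integral>t. \<phi> (cis t) \<partial>L)"
      by (intro tendsto_mult tendsto_of_real Mlim) (simp add: \<sigma>_def o_def)
    also have "(\<lambda>n. of_real (M (\<sigma> n)) * (\<integral>t. \<phi> (cis t) \<partial>\<mu> (\<sigma> n))) = (\<lambda>n. \<integral>\<xi>. \<phi> \<xi> * of_real (q (\<sigma> n) \<xi> + 1) \<partial>circle_lebesgue)"
    proof
      fix n
      have "M (\<sigma> n) \<noteq> 0"
        using M[of "\<sigma> n"] by auto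
      then show "of_real (M (\<sigma> n)) * (\<integral>t. \<phi> (cis t) \<partial>\<mu> (\<sigma> n)) = (\<integral>\<xi>. \<phi> \<xi> * of_real (q (\<sigma> n) \<xi> + 1) \<partial>circle_lebesgue)"
        by (simp add: int_\<mu>)
    qed
    also have "of_real m * (\<integral>t. \<phi> (cis t) \<partial>L) = (\<integral>\<xi>. \<phi> \<xi> \<partial>a)"
      unfolding a_def using m by (simp add: integral_density integral_distr scaleR_conv_of_real)
    finally have "(\<lambda>n. (\<integral>\<xi>. \<phi> \<xi> * of_real (q (\<sigma> n) \<xi> + 1) \<partial>circle_lebesgue) - (\<integral>\<xi>. \<phi> \<xi> \<partial>circle_lebesgue))
        \<longlonglongrightarrow> (\<integral>\<xi>. \<phi> \<xi> \<partial>a) - (\<integral>\<xi>. \<phi> \<xi> \<partial>circle_lebesgue)"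
      by (intro tendsto_diff tendsto_const)
    moreover have "(\<integral>\<xi>. \<phi> \<xi> * of_real (q (\<sigma> n) \<xi> + 1) \<partial>circle_lebesgue) - (\<integral>\<xi>. \<phi> \<xi> \<partial>circle_lebesgue)
        = (\<integral>\<xi>. \<phi> \<xi> * of_real (q (\<sigma> n) \<xi>) \<partial>circle_lebesgue)" for n
    proof -
      have "integrable circle_lebesgue (\<lambda>\<xi>. \<phi> \<xi> * of_real (q (\<sigma> n) \<xi> + 1))" "integrable circle_lebesgue \<phi>"
        by (intro circle.continuous_integrable continuous_intros \<phi> cont)+
      then show ?thesis
        by (subst Bochner_Integration.integral_diff[symmetric]) (auto simp: distrib_left)
    qed
    ultimately show "(\<lambda>n. \<integral>\<xi>. \<phi> \<xi> * of_real (q (\<sigma> n) \<xi>) \<partial>circle_lebesgue) \<longlonglongrightarrow> (\<integral>\<xi>. \<phi> \<xi> \<partial>a) - (\<integral>\<xi>. \<phi> \<xi> \<partial>circle_lebesgue)"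
      by simp
  qed
qed

text \<open>Subsequences are extracted one after the other, since a single \<sigma> has to serve all
  four quarter densities of a complex function.\<close>

lemma circle_sequences_weak_limit:
  fixes q :: "nat \<Rightarrow> nat \<Rightarrow> complex \<Rightarrow> real"
  assumes cont: "\<And>k n. continuous_on (sphere 0 1) (q k n)" and nn: "\<And>k n \<xi>. norm \<xi> = 1 \<Longrightarrow> 0 \<le> q k n \<xi>"
    and C: "\<And>k n. (\<integral>\<xi>. q k n \<xi> \<partial>circle_lebesgue) \<le> C"
  shows "\<exists>\<sigma> p. strict_mono (\<sigma> :: nat \<Rightarrow> nat) \<and> (\<forall>k<K. finite_measure (p k) \<and> sets (p k) = sets circle_borel \<and>
    (\<forall>\<phi> :: complex \<Rightarrow> complex. continuous_on (sphere 0 1) \<phi> \<longrightarrow>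
      (\<lambda>n. \<integral>\<xi>. \<phi> \<xi> * of_real (q k (\<sigma> n) \<xi>) \<partial>circle_lebesgue) \<longlonglongrightarrow> (\<integral>\<xi>. \<phi> \<xi> \<partial>p k) - (\<integral>\<xi>. \<phi> \<xi> \<partial>circle_lebesgue)))"
proof (induction K)
  case 0
  show ?case
    by (intro exI[of _ "\<lambda>n. n"]) (simp add: strict_mono_def)
next
  case (Suc K)
  then obtain \<sigma> p where \<sigma>: "strict_mono (\<sigma> :: nat \<Rightarrow> nat)"
    and p: "\<And>k. k < K \<Longrightarrow> finite_measure (p k) \<and> sets (p k) = sets circle_borel"
    and lim: "\<And>k \<phi>. k < K \<Longrightarrow> continuous_on (sphere 0 1) \<phi> \<Longrightarrow>
      (\<lambda>n. \<integral>\<xi>. \<phi> \<xi> * of_real (q k (\<sigma> n) \<xi>) \<partial>circle_lebesgue) \<longlonglongrightarrow> (\<integral>\<xi>. \<phi> \<xi> \<partial>p k) - (\<integral>\<xi>. \<phi> \<xi> \<partial>circle_lebesgue :: complex)"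
    by blast
  obtain \<tau> a where \<tau>: "strict_mono (\<tau> :: nat \<Rightarrow> nat)" and a: "finite_measure a" "sets a = sets circle_borel"
    and lim_a: "\<And>\<phi> :: complex \<Rightarrow> complex. continuous_on (sphere 0 1) \<phi> \<Longrightarrow>
      (\<lambda>n. \<integral>\<xi>. \<phi> \<xi> * of_real (q K (\<sigma> (\<tau> n)) \<xi>) \<partial>circle_lebesgue) \<longlonglongrightarrow> (\<integral>\<xi>. \<phi> \<xi> \<partial>a) - (\<integral>\<xi>. \<phi> \<xi> \<partial>circle_lebesgue)"
    by (rule circle_sequence_weak_limit[of "\<lambda>n. q K (\<sigma> n)" C]) (auto intro: cont nn C)
  show ?case
  proof (intro exI[of _ "\<sigma> \<circ> \<tau>"] exI[of _ "p(K := a)"] conjI allI impI)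
    show "strict_mono (\<sigma> \<circ> \<tau>)"
      by (intro strict_mono_o \<sigma> \<tau>)
    fix k assume k: "k < Suc K"
    then show "finite_measure ((p(K := a)) k)" "sets ((p(K := a)) k) = sets circle_borel"
      using p a by (auto simp: less_Suc_eq)
    fix \<phi> :: "complex \<Rightarrow> complex" assume \<phi>: "continuous_on (sphere 0 1) \<phi>"
    show "(\<lambda>n. \<integral>\<xi>. \<phi> \<xi> * of_real (q k ((\<sigma> \<circ> \<tau>) n) \<xi>) \<partial>circle_lebesgue) \<longlonglongrightarrow> (\<integral>\<xi>. \<phi> \<xi> \<partial>(p(K := a)) k) - (\<integral>\<xi>. \<phi> \<xi> \<partial>circle_lebesgue)"
    proof (cases "k = K")
      case True
      then show ?thesis
        using lim_a[OF \<phi>] by simp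
    next
      case False
      then show ?thesis
        using k LIMSEQ_subseq_LIMSEQ[OF lim[OF _ \<phi>] \<tau>, of k] by (simp add: o_def)
    qed
  qed
qed

lemma complex_quarter_decomposition:
  "(\<Sum>k<4. \<i> ^ k * of_real (max 0 (Re (z / \<i> ^ k)))) = z"
  by (simp add: sum_lessThan_4 power3_eq_cube complex_eq_iff max_def)

text \<open>The constant densities added in the compactness argument cancel because the fourth roots of unity
  sum to zero.\<close>
lemma poisson_representation:
  fixes h :: "complex \<Rightarrow> complex"
  assumes cont: "continuous_on (ball 0 1) h"
    and poisson: "\<And>s w. 0 \<le> s \<Longrightarrow> s < 1 \<Longrightarrow> norm w < 1 \<Longrightarrow>
      (\<integral>\<xi>. of_real (disc_kernel w \<xi>) * h (of_real s * \<xi>) \<partial>circle_lebesgue) = h (of_real s * w)"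
    and C: "\<And>n. (\<integral>\<^sup>+\<xi>. ennreal (norm (h (of_real (radius n) * \<xi>))) \<partial>circle_lebesgue) \<le> ennreal C"
  obtains p where "\<And>k. k < 4 \<Longrightarrow> finite_measure (p k)" "\<And>k. k < 4 \<Longrightarrow> sets (p k) = sets circle_borel"
    "\<And>w. norm w < 1 \<Longrightarrow> h w = (\<Sum>k<4. \<i> ^ k * (\<integral>\<xi>. of_real (disc_kernel w \<xi>) \<partial>p k))"
proof -
  \<comment> \<open>The four nonnegative densities of \<open>h\<close> on the circle of radius
    \<open>radius n\<close>; each is at most the modulus of \<open>h\<close>, hence of bounded
    mass.\<close>
  define q where "q k n \<xi> = max 0 (Re (h (of_real (radius n) * \<xi>) / \<i> ^ k))" for k n \<xi>
  have h_cont: "continuous_on (sphere 0 1) (\<lambda>\<xi>. h (of_real (radius n) * \<xi>))" for n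
    using radius[of n] by (intro continuous_on_compose2[OF cont] continuous_intros) (auto simp: norm_mult)
  have q_cont: "continuous_on (sphere 0 1) (q k n)" for k n
    unfolding q_def by (intro continuous_intros h_cont) auto
  have q_nn: "0 \<le> q k n \<xi>" for k n \<xi>
    by (simp add: q_def)
  have q_le: "q k n \<xi> \<le> norm (h (of_real (radius n) * \<xi>))" for k n \<xi>
    using complex_Re_le_cmod[of "h (of_real (radius n) * \<xi>) / \<i> ^ k"]
    by (simp add: q_def norm_divide norm_power)
  \<comment> \<open>The maximum with 0 is needed because \<open>ennreal C\<close> says nothing about
    the sign of \<open>C\<close>.\<close>
  have C': "(\<integral>\<xi>. q k n \<xi> \<partial>circle_lebesgue) \<le> max 0 C" for k n
  proof -
    have "(\<integral>\<xi>. q k n \<xi> \<partial>circle_lebesgue) = enn2real (\<integral>\<^sup>+\<xi>. ennreal (q k n \<xi>) \<partial>circle_lebesgue)"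
      by (intro integral_eq_nn_integral circle.continuous_measurable q_cont) (simp add: q_def)
    also have "(\<integral>\<^sup>+\<xi>. ennreal (q k n \<xi>) \<partial>circle_lebesgue) \<le> ennreal (max 0 C)"
    proof -
      have "(\<integral>\<^sup>+\<xi>. ennreal (q k n \<xi>) \<partial>circle_lebesgue) \<le> (\<integral>\<^sup>+\<xi>. ennreal (norm (h (of_real (radius n) * \<xi>))) \<partial>circle_lebesgue)"
        by (intro nn_integral_mono ennreal_leI q_le)
      also have "\<dots> \<le> ennreal (max 0 C)"
        using C[of n] by (rule order_trans) (intro ennreal_leI, simp)
      finally show ?thesis .
    qed
    then have "enn2real (\<integral>\<^sup>+\<xi>. ennreal (q k n \<xi>) \<partial>circle_lebesgue) \<le> enn2real (ennreal (max 0 C))"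
      by (intro enn2real_mono) auto
    finally show ?thesis
      by (simp only: enn2real_ennreal max.cobounded1)
  qed
  obtain \<sigma> p where \<sigma>: "strict_mono (\<sigma> :: nat \<Rightarrow> nat)"
    and p: "\<And>k. k < 4 \<Longrightarrow> finite_measure (p k)" "\<And>k. k < 4 \<Longrightarrow> sets (p k) = sets circle_borel"
    and lim: "\<And>k \<phi>. k < 4 \<Longrightarrow> continuous_on (sphere 0 1) \<phi> \<Longrightarrow>
      (\<lambda>n. \<integral>\<xi>. \<phi> \<xi> * of_real (q k (\<sigma> n) \<xi>) \<partial>circle_lebesgue) \<longlonglongrightarrow> (\<integral>\<xi>. \<phi> \<xi> \<partial>p k) - (\<integral>\<xi>. \<phi> \<xi> \<partial>circle_lebesgue :: complex)"
    using circle_sequences_weak_limit[of q "max 0 C" 4, OF q_cont q_nn C'] by blast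
  show ?thesis
  proof (rule that[of p])
    fix w :: complex assume w: "norm w < 1"
    let ?P = "\<lambda>\<xi>. complex_of_real (disc_kernel w \<xi>)"
    have P: "continuous_on (sphere 0 1) ?P"
      using w by (intro continuous_intros) auto
    \<comment> \<open>Test function is the Poisson kernel at a fixed \<open>w\<close>. The
      recombined integrals equal \<open>h\<close> at
      \<open>of_real (radius (\<sigma> n)) * w\<close>, which tends to \<open>h w\<close> by
      continuity, while the weak limits give the representing integrals.\<close>
    have "(\<lambda>n. \<Sum>k<4. \<i> ^ k * (\<integral>\<xi>. ?P \<xi> * of_real (q k (\<sigma> n) \<xi>) \<partial>circle_lebesgue))
        \<longlonglongrightarrow> (\<Sum>k<4. \<i> ^ k * ((\<integral>\<xi>. ?P \<xi> \<partial>p k) - (\<integral>\<xi>. ?P \<xi> \<partial>circle_lebesgue)))"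
      by (intro tendsto_sum tendsto_mult tendsto_const lim P) simp
    also have "(\<Sum>k<4. \<i> ^ k * ((\<integral>\<xi>. ?P \<xi> \<partial>p k) - (\<integral>\<xi>. ?P \<xi> \<partial>circle_lebesgue))) = (\<Sum>k<4. \<i> ^ k * (\<integral>\<xi>. ?P \<xi> \<partial>p k))"
      by (simp add: sum_lessThan_4 power3_eq_cube algebra_simps)
    also have "(\<lambda>n. \<Sum>k<4. \<i> ^ k * (\<integral>\<xi>. ?P \<xi> * of_real (q k (\<sigma> n) \<xi>) \<partial>circle_lebesgue)) = (\<lambda>n. h (of_real (radius (\<sigma> n)) * w))"
    proof
      fix n
      have "(\<Sum>k<4. \<i> ^ k * (\<integral>\<xi>. ?P \<xi> * of_real (q k (\<sigma> n) \<xi>) \<partial>circle_lebesgue))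
          = (\<integral>\<xi>. (\<Sum>k<4. \<i> ^ k * (?P \<xi> * of_real (q k (\<sigma> n) \<xi>))) \<partial>circle_lebesgue)"
      proof -
        have "integrable circle_lebesgue (\<lambda>\<xi>. \<i> ^ k * (?P \<xi> * of_real (q k (\<sigma> n) \<xi>)))" for k
          by (intro circle.continuous_integrable continuous_intros P q_cont)
        then show ?thesis
          by (subst Bochner_Integration.integral_sum) auto
      qed
      also have "\<dots> = (\<integral>\<xi>. ?P \<xi> * h (of_real (radius (\<sigma> n)) * \<xi>) \<partial>circle_lebesgue)"
      proof (intro Bochner_Integration.integral_cong refl)
        fix \<xi>
        have "(\<Sum>k<4. \<i> ^ k * (?P \<xi> * of_real (q k (\<sigma> n) \<xi>))) = ?P \<xi> * (\<Sum>k<4. \<i> ^ k * of_real (q k (\<sigma> n) \<xi>))"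
          by (simp add: sum_distrib_left mult.left_commute)
        then show "(\<Sum>k<4. \<i> ^ k * (?P \<xi> * of_real (q k (\<sigma> n) \<xi>))) = ?P \<xi> * h (of_real (radius (\<sigma> n)) * \<xi>)"
          unfolding q_def by (simp only: complex_quarter_decomposition)
      qed
      also have "\<dots> = h (of_real (radius (\<sigma> n)) * w)"
        using radius[of "\<sigma> n"] w by (intro poisson)
      finally show "(\<Sum>k<4. \<i> ^ k * (\<integral>\<xi>. ?P \<xi> * of_real (q k (\<sigma> n) \<xi>) \<partial>circle_lebesgue)) = h (of_real (radius (\<sigma> n)) * w)" .
    qed
    finally have 1: "(\<lambda>n. h (of_real (radius (\<sigma> n)) * w)) \<longlonglongrightarrow> (\<Sum>k<4. \<i> ^ k * (\<integral>\<xi>. ?P \<xi> \<partial>p k))" .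
    have "isCont h w"
      using cont w by (simp add: continuous_on_eq_continuous_at)
    moreover have "(\<lambda>n. of_real (radius (\<sigma> n)) * w) \<longlonglongrightarrow> of_real 1 * w"
      using LIMSEQ_subseq_LIMSEQ[OF radius_tendsto \<sigma>] by (intro tendsto_intros) (simp add: o_def)
    ultimately have "(\<lambda>n. h (of_real (radius (\<sigma> n)) * w)) \<longlonglongrightarrow> h w"
      by (auto intro: isCont_tendsto_compose)
    with 1 show "h w = (\<Sum>k<4. \<i> ^ k * (\<integral>\<xi>. ?P \<xi> \<partial>p k))"
      using LIMSEQ_unique by blast
  qed (use p in auto)
qed

section \<open>Rotation invariance of Haar measure on the torus\<close>

lemma poisson_integral_eq:
  assumes p: "jordan_parts torus_borel p \<mu>" and z: "z \<in> polydisc"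
  shows "poisson_integral \<mu> z = (\<Sum>k<4. \<i> ^ k * (\<integral>\<eta>. of_real (poisson_kernel z \<eta>) \<partial>p k))"
proof -
  have c: "continuous_on torus (\<lambda>\<eta>. complex_of_real (poisson_kernel z \<eta>))"
    using z by (intro continuous_intros) auto
  obtain B where "\<And>\<eta>. \<eta> \<in> torus \<Longrightarrow> norm (complex_of_real (poisson_kernel z \<eta>)) \<le> B"
    using compact_bounded_continuous[OF compact_torus c] by metis
  then show ?thesis
    unfolding poisson_integral_def
    by (intro complex_measure_integral_eq[OF p borel_measurable_continuous_on_restrict[OF c], of B])
      (simp add: space_restrict_space)
qed

lemma torus_smult: "norm \<xi> = 1 \<Longrightarrow> \<zeta> \<in> torus \<Longrightarrow> \<xi> *s \<zeta> \<in> torus"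
  by (simp add: torus_def norm_mult)

lemma integral_poisson_kernel:
  assumes z: "z \<in> polydisc"
  shows "(\<integral>\<zeta>. complex_of_real (poisson_kernel z \<zeta>) \<partial>torus_lebesgue) = 1"
proof -
  have "(\<integral>\<zeta>. poisson_kernel z \<zeta> \<partial>torus_lebesgue) = enn2real (\<integral>\<^sup>+\<zeta>. ennreal (poisson_kernel z \<zeta>) \<partial>torus_lebesgue)"
    using z poisson_kernel_nonneg[OF z]
    by (intro integral_eq_nn_integral torus.continuous_measurable continuous_intros) auto
  then show ?thesis
    using z by (simp add: nn_integral_poisson_kernel)
qed

lemma continuous_on_smult [continuous_intros]:
  fixes g :: "'a::topological_space \<Rightarrow> complex ^ 'n"
  assumes "continuous_on S f" "continuous_on S g"
  shows "continuous_on S (\<lambda>x. f x *s g x)"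
  unfolding vector_scalar_mult_def by (intro continuous_intros assms)

text \<open>Haar measure and its rotations both have Poisson integral 1, hence they coincide.\<close>
lemma torus_lebesgue_rotation:
  fixes g :: "complex ^ 'n \<Rightarrow> complex"
  assumes \<xi>: "norm \<xi> = 1" and g: "continuous_on torus g"
  shows "(\<integral>\<zeta>. g (\<xi> *s \<zeta>) \<partial>torus_lebesgue) = (\<integral>\<zeta>. g \<zeta> \<partial>torus_lebesgue)"
proof -
  define p where "p = distr (torus_lebesgue :: (complex ^ 'n) measure) torus_borel (\<lambda>\<zeta>. \<xi> *s \<zeta>)"
  have "(\<lambda>\<zeta>. \<xi> *s \<zeta>) \<in> measurable torus_borel (torus_borel :: (complex ^ 'n) measure)"
    using torus_smult[OF \<xi>]
    by (intro measurable_restrict_space2 borel_measurable_continuous_on_restrict continuous_intros) (auto simp: space_restrict_space)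
  then have rot: "(\<lambda>\<zeta>. \<xi> *s \<zeta>) \<in> measurable torus_lebesgue (torus_borel :: (complex ^ 'n) measure)"
    by (simp add: measurable_cong_sets[OF sets_torus_lebesgue refl])
  have int_p: "(\<integral>\<zeta>. f \<zeta> \<partial>p) = (\<integral>\<zeta>. f (\<xi> *s \<zeta>) \<partial>torus_lebesgue)" if "continuous_on torus f" for f :: "complex ^ 'n \<Rightarrow> complex"
    unfolding p_def using rot borel_measurable_continuous_on_restrict[OF that] by (rule integral_distr)
  have "finite_measure p"
    unfolding p_def by (intro torus.finite_measure_distr rot)
  moreover have "sets p = sets torus_borel"
    by (simp add: p_def)
  ultimately have 1: "(\<lambda>n. \<integral>x. g x * (\<integral>y. of_real (poisson_kernel (of_real (radius n) *s x) y) \<partial>p) \<partial>torus_lebesgue) \<longlonglongrightarrow> (\<integral>y. g y \<partial>p)"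
    using g by (rule torus.weak_approximation)
  have 2: "(\<lambda>n. \<integral>x. g x * (\<integral>y. of_real (poisson_kernel (of_real (radius n) *s x) y) \<partial>torus_lebesgue) \<partial>torus_lebesgue) \<longlonglongrightarrow> (\<integral>y. g y \<partial>torus_lebesgue)"
    using torus.finite_measure_axioms sets_torus_lebesgue g by (rule torus.weak_approximation)
  have "(\<integral>y. complex_of_real (poisson_kernel (of_real (radius n) *s x) y) \<partial>p) = (\<integral>y. of_real (poisson_kernel (of_real (radius n) *s x) y) \<partial>torus_lebesgue)"
    if x: "x \<in> torus" for n and x :: "complex ^ 'n"
  proof -
    let ?z = "of_real (radius n) *s x"
    have z: "?z \<in> polydisc" "cnj \<xi> *s ?z \<in> polydisc"
      using x \<xi> radius[of n] by (auto simp: torus_def polydisc_def norm_mult)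
    have "(\<integral>y. complex_of_real (poisson_kernel ?z y) \<partial>p) = (\<integral>y. complex_of_real (poisson_kernel ?z (\<xi> *s y)) \<partial>torus_lebesgue)"
      using z by (intro int_p continuous_intros) auto
    \<comment> \<open>The kernel is unchanged when both arguments are rotated, so the rotation of
      the variable becomes the inverse rotation \<open>cnj \<xi>\<close> of the evaluation
      point.\<close>
    also have "\<dots> = (\<integral>y. complex_of_real (poisson_kernel (cnj \<xi> *s ?z) y) \<partial>torus_lebesgue)"
    proof (intro Bochner_Integration.integral_cong refl)
      fix y :: "complex ^ 'n" assume "y \<in> space torus_lebesgue"
      then have eq: "poisson_kernel (\<xi> *s (cnj \<xi> *s ?z)) (\<xi> *s y) = poisson_kernel (cnj \<xi> *s ?z) y"
        using \<xi> by (intro poisson_kernel_rotate) auto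
      have "\<xi> * cnj \<xi> = 1"
        using \<xi> complex_norm_square[of \<xi>] by simp
      then have "\<xi> *s (cnj \<xi> *s ?z) = ?z"
        by (simp only: vector_smult_assoc mult.assoc[symmetric] mult_1_left)
      from eq[unfolded this] show "complex_of_real (poisson_kernel ?z (\<xi> *s y)) = of_real (poisson_kernel (cnj \<xi> *s ?z) y)"
        by (rule arg_cong)
    qed
    finally show ?thesis
      by (simp only: integral_poisson_kernel[OF z(1)] integral_poisson_kernel[OF z(2)])
  qed
  then have "(\<integral>x. g x * (\<integral>y. of_real (poisson_kernel (of_real (radius n) *s x) y) \<partial>p) \<partial>torus_lebesgue)
      = (\<integral>x. g x * (\<integral>y. of_real (poisson_kernel (of_real (radius n) *s x) y) \<partial>torus_lebesgue) \<partial>torus_lebesgue)" for n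
    by (intro Bochner_Integration.integral_cong) auto
  then have "(\<integral>y. g y \<partial>p) = (\<integral>y. g y \<partial>torus_lebesgue)"
    using 1 2 LIMSEQ_unique by simp
  then show ?thesis
    by (simp add: int_p[OF g])
qed

lemma torus_lebesgue_rotation_norm:
  fixes g :: "complex ^ 'n \<Rightarrow> complex"
  assumes \<xi>: "norm \<xi> = 1" and g: "continuous_on torus g"
  shows "(\<integral>\<^sup>+\<zeta>. ennreal (norm (g (\<xi> *s \<zeta>))) \<partial>torus_lebesgue) = (\<integral>\<^sup>+\<zeta>. ennreal (norm (g \<zeta>)) \<partial>torus_lebesgue)"
proof -
  have c: "continuous_on torus (\<lambda>\<zeta>. norm (g \<zeta>))" "continuous_on torus (\<lambda>\<zeta>. norm (g (\<xi> *s \<zeta>)))"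
    using torus_smult[OF \<xi>] by (auto intro!: continuous_intros g continuous_on_compose2[OF g])
  have "complex_of_real (\<integral>\<zeta>. norm (g (\<xi> *s \<zeta>)) \<partial>torus_lebesgue) = of_real (\<integral>\<zeta>. norm (g \<zeta>) \<partial>torus_lebesgue)"
    using torus_lebesgue_rotation[OF \<xi>, of "\<lambda>\<zeta>. of_real (norm (g \<zeta>))"] c by (simp add: continuous_on_of_real)
  then have "(\<integral>\<zeta>. norm (g (\<xi> *s \<zeta>)) \<partial>torus_lebesgue) = (\<integral>\<zeta>. norm (g \<zeta>) \<partial>torus_lebesgue)"
    by (metis of_real_eq_iff)
  then show ?thesis
    using c by (subst (1 2) nn_integral_eq_integral) (auto intro: torus.continuous_integrable)
qed

section \<open>Slice measures\<close>

locale slice =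
  fixes \<mu> :: "(complex ^ 'n) set \<Rightarrow> complex" and \<zeta> :: "complex ^ 'n"
  assumes pluriharmonic: "pluriharmonic_on polydisc (poisson_integral \<mu>)" and \<zeta>: "\<zeta> \<in> torus"
begin

abbreviation orbit :: "complex \<Rightarrow> complex ^ 'n" where
  "orbit \<xi> \<equiv> \<xi> *s \<zeta>"

text \<open>A left inverse of \<open>orbit\<close> read off from one coordinate;
  \<open>undefined\<close> merely names some index. It is defined on the whole torus, so the slice
  measure can be pushed forward to the circle along it.\<close>

definition coordinate :: "complex ^ 'n \<Rightarrow> complex" where
  "coordinate \<eta> = \<eta> $ undefined * cnj (\<zeta> $ undefined)"

lemma coordinate_orbit [simp]: "coordinate (orbit \<xi>) = \<xi>"
  using \<zeta> complex_norm_square[of "\<zeta> $ undefined"] by (simp add: coordinate_def torus_def mult.assoc)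

lemma norm_coordinate: "\<eta> \<in> torus \<Longrightarrow> norm (coordinate \<eta>) = 1"
  using \<zeta> by (simp add: coordinate_def torus_def norm_mult)

lemma orbit_measurable: "orbit \<in> measurable circle_borel torus_borel"
  using torus_smult[OF _ \<zeta>]
  by (intro measurable_restrict_space2 borel_measurable_continuous_on_restrict continuous_intros) (auto simp: space_restrict_space)

lemma coordinate_measurable: "coordinate \<in> measurable torus_borel circle_borel"
proof (rule measurable_restrict_space2)
  show "coordinate \<in> borel_measurable torus_borel"
    unfolding coordinate_def[abs_def] by (intro borel_measurable_continuous_on_restrict continuous_intros)
qed (auto simp: space_restrict_space norm_coordinate)

lemma orbit_circle_measurable: "orbit ` sphere 0 1 \<in> sets torus_borel"
proof -
  have "compact (orbit ` sphere 0 1)"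
    by (intro compact_continuous_image continuous_intros compact_sphere)
  moreover have "orbit ` sphere 0 1 \<subseteq> torus"
    using torus_smult[OF _ \<zeta>] by auto
  ultimately show ?thesis
    by (simp add: sets_restrict_space_iff compact_imp_closed borel_closed compact_torus)
qed

text \<open>Images of measurable sets need not be measurable in general; here they become preimages
  under \<open>coordinate\<close> within the compact orbit.\<close>

lemma orbit_image_eq: "B \<subseteq> sphere 0 1 \<Longrightarrow> orbit ` B = orbit ` sphere 0 1 \<inter> (coordinate -` B \<inter> space torus_borel)"
  using torus_smult[OF _ \<zeta>] by (auto simp: space_restrict_space)

lemma orbit_image_measurable: "B \<in> sets circle_borel \<Longrightarrow> orbit ` B \<in> sets torus_borel"
  using orbit_circle_measurable measurable_sets[OF coordinate_measurable, of B] sets.sets_into_space[of B circle_borel]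
  by (subst orbit_image_eq) (auto simp: space_restrict_space)

lemma slice_function_alt: "slice_function \<mu> \<zeta> w = poisson_integral \<mu> (orbit w)"
  by (simp add: slice_function_def)

text \<open>The Poisson representation of the slice function yields four measures on the circle,
  which \<open>orbit\<close> carries to the torus.\<close>

lemma slice_measure_exists:
  assumes "slice_bounded \<mu> \<zeta>"
  shows "\<exists>\<nu>. is_slice_measure \<mu> \<zeta> \<nu>"
proof -
  let ?S = "SUP r \<in> {0<..<1 :: real}. \<integral>\<^sup>+\<xi>. ennreal (norm (slice_function \<mu> \<zeta> (of_real r * \<xi>))) \<partial>circle_lebesgue"
  have S: "?S < \<infinity>"
    using assms by (simp add: slice_bounded_def)
  then obtain C where C: "?S = ennreal C"
    by (cases ?S rule: ennreal_cases) auto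
  have bound: "(\<integral>\<^sup>+\<xi>. ennreal (norm (slice_function \<mu> \<zeta> (of_real (radius n) * \<xi>))) \<partial>circle_lebesgue) \<le> ennreal C" for n
    unfolding C[symmetric] using radius[of n] by (intro SUP_upper) auto
  obtain p where p: "\<And>k. k < 4 \<Longrightarrow> finite_measure (p k)" "\<And>k. k < 4 \<Longrightarrow> sets (p k) = sets circle_borel"
    and rep: "\<And>w. norm w < 1 \<Longrightarrow> slice_function \<mu> \<zeta> w = (\<Sum>k<4. \<i> ^ k * (\<integral>\<xi>. of_real (disc_kernel w \<xi>) \<partial>p k))"
  proof (rule poisson_representation[of "slice_function \<mu> \<zeta>" C])
    show "continuous_on (ball 0 1) (slice_function \<mu> \<zeta>)"
      using pluriharmonic_slice_continuous[OF pluriharmonic \<zeta>] by (simp add: slice_function_def[abs_def])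
    show "(\<integral>\<xi>. of_real (disc_kernel w \<xi>) * slice_function \<mu> \<zeta> (of_real s * \<xi>) \<partial>circle_lebesgue) = slice_function \<mu> \<zeta> (of_real s * w)"
      if "0 \<le> s" "s < 1" "norm w < 1" for s w
      unfolding slice_function_alt using pluriharmonic_slice_poisson[OF pluriharmonic \<zeta> that] .
  qed (use bound in auto)
  \<comment> \<open>The value 0 off the sigma-algebra is required by \<open>complex_measure\<close>;
    it also settles the support condition, which ranges over all sets, for the non-measurable
    ones.\<close>
  define \<nu> where "\<nu> A = (if A \<in> sets torus_borel then \<Sum>k<4. \<i> ^ k * complex_of_real (measure (distr (p k) torus_borel orbit) A) else 0)" for A
  have orbit_p: "orbit \<in> measurable (p k) torus_borel" if "k < 4" for k
    using orbit_measurable measurable_cong_sets[OF p(2)[OF that] refl] by blast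
  have space_p: "space (p k) = sphere 0 1" if "k < 4" for k
    using sets_eq_imp_space_eq[OF p(2)[OF that]] by (simp add: space_restrict_space)
  have \<nu>_eq: "\<nu> A = (\<Sum>k<4. \<i> ^ k * complex_of_real (measure (p k) (orbit -` A \<inter> sphere 0 1)))" if "A \<in> sets torus_borel" for A
    using that orbit_p space_p by (simp add: \<nu>_def measure_distr)
  have "is_slice_measure \<mu> \<zeta> \<nu>"
    unfolding is_slice_measure_def
  proof (intro conjI allI impI ballI)
    show "complex_measure torus_borel \<nu>"
    proof (rule complex_measureI)
      show "jordan_parts torus_borel (\<lambda>k. distr (p k) torus_borel orbit) \<nu>"
        unfolding jordan_parts_def using p(1) orbit_p
        by (auto simp: \<nu>_def intro!: finite_measure.finite_measure_distr)
    qed (simp add: \<nu>_def)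
    fix A assume "A \<inter> orbit ` sphere 0 1 = {}"
    then have "orbit -` A \<inter> sphere 0 1 = {}"
      by auto
    then show "\<nu> A = 0"
      by (cases "A \<in> sets torus_borel") (simp_all add: \<nu>_eq, simp add: \<nu>_def)
  next
    fix w :: complex assume w: "w \<in> ball 0 1"
    have inj: "orbit -` orbit ` B \<inter> sphere 0 1 = B" if "B \<subseteq> sphere 0 1" for B
    proof -
      have "inj orbit"
        by (rule inj_on_inverseI[of _ coordinate]) simp
      then show ?thesis
        using that by (auto simp: inj_vimage_image_eq)
    qed
    have parts: "jordan_parts circle_borel p (\<lambda>B. \<nu> (orbit ` B))"
      unfolding jordan_parts_def
    proof (intro conjI allI impI ballI)
      fix B assume B: "B \<in> sets circle_borel"
      then have "B \<subseteq> sphere 0 1"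
        using sets.sets_into_space[OF B] by (simp add: space_restrict_space)
      then show "\<nu> (orbit ` B) = (\<Sum>k<4. \<i> ^ k * complex_of_real (measure (p k) B))"
        by (simp only: \<nu>_eq[OF orbit_image_measurable[OF B]] inj)
    qed (use p in auto)
    have c: "continuous_on (sphere 0 1) (\<lambda>\<xi>. complex_of_real (disc_kernel w \<xi>))"
      using w by (intro continuous_intros) auto
    show "slice_function \<mu> \<zeta> w = complex_measure_integral circle_borel (\<lambda>B. \<nu> (orbit ` B))
          (\<lambda>\<xi>. of_real ((1 - (norm w)\<^sup>2) / (norm (\<xi> - w))\<^sup>2))"
      using complex_measure_integral_continuous[OF parts compact_sphere c] rep[of w] w
      by (simp add: disc_kernel_def)
  qed
  then show ?thesis
    by blast
qed

text \<open>Transported to the circle, \<nu> has the slice function as its Poisson integral, and the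
  approximate identity of the circle recovers it. The result holds for every \<nu> satisfying the
  description, so it also gives uniqueness.\<close>

lemma slice_measure_integral_tendsto:
  fixes f :: "complex ^ 'n \<Rightarrow> complex"
  assumes \<nu>: "is_slice_measure \<mu> \<zeta> \<nu>" and f: "continuous_on torus f"
  shows "(\<lambda>n. \<integral>\<xi>. f (orbit \<xi>) * poisson_integral \<mu> ((of_real (radius n) * \<xi>) *s \<zeta>) \<partial>circle_lebesgue)
    \<longlonglongrightarrow> complex_measure_integral torus_borel \<nu> f"
proof -
  obtain p where p: "jordan_parts torus_borel p \<nu>"
    using \<nu> complex_measure_jordan_parts unfolding is_slice_measure_def by blast
  have off: "\<nu> A = 0" if "A \<inter> orbit ` sphere 0 1 = {}" for A
    using \<nu> that unfolding is_slice_measure_def by blast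
  \<comment> \<open>The description says only that \<nu> vanishes on sets missing the orbit;
    additivity turns this into concentration on the orbit.\<close>
  have concentrated: "\<nu> A = \<nu> (A \<inter> orbit ` sphere 0 1)" if A: "A \<in> sets torus_borel" for A
  proof -
    have "\<nu> ((A \<inter> orbit ` sphere 0 1) \<union> (A - orbit ` sphere 0 1)) = \<nu> (A \<inter> orbit ` sphere 0 1) + \<nu> (A - orbit ` sphere 0 1)"
      using A orbit_circle_measurable by (intro jordan_parts_additive[OF p]) auto
    moreover have "\<nu> (A - orbit ` sphere 0 1) = 0"
      by (intro off) auto
    moreover have "(A \<inter> orbit ` sphere 0 1) \<union> (A - orbit ` sphere 0 1) = A"
      by blast
    ultimately show ?thesis
      by simp
  qed
  let ?\<kappa> = "\<lambda>B. \<nu> (orbit ` B)"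
  have \<kappa>: "?\<kappa> B = \<nu> (coordinate -` B \<inter> space torus_borel)" if B: "B \<in> sets circle_borel" for B
  proof -
    have "B \<subseteq> sphere 0 1"
      using sets.sets_into_space[OF B] by (simp add: space_restrict_space)
    then show ?thesis
      using concentrated[OF measurable_sets[OF coordinate_measurable B]] orbit_image_eq[of B] by (simp add: Int_commute)
  qed
  define q where "q k = distr (p k) circle_borel coordinate" for k
  have q: "jordan_parts circle_borel q ?\<kappa>"
    unfolding q_def using jordan_parts_distr[OF p coordinate_measurable \<kappa>] .
  have fo: "continuous_on (sphere 0 1) (\<lambda>\<xi>. f (orbit \<xi>))"
    using torus_smult[OF _ \<zeta>] by (intro continuous_on_compose2[OF f] continuous_intros) auto
  have proj: "(\<lambda>\<eta>. orbit (coordinate \<eta>)) \<in> measurable torus_borel torus_borel"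
    using measurable_compose[OF coordinate_measurable orbit_measurable] .
  obtain B where B: "\<And>\<eta>. \<eta> \<in> torus \<Longrightarrow> norm (f \<eta>) \<le> B"
    using compact_bounded_continuous[OF compact_torus f] by metis
  \<comment> \<open>The retraction of the torus onto the orbit fixes the set on which \<nu> is
    concentrated, hence preserves \<nu>.\<close>
  have "complex_measure_integral torus_borel \<nu> f = complex_measure_integral torus_borel \<nu> (\<lambda>\<eta>. f (orbit (coordinate \<eta>)))"
  proof (rule complex_measure_integral_distr[OF p proj _ borel_measurable_continuous_on_restrict[OF f], of _ B])
    fix A assume A: "A \<in> sets (torus_borel :: (complex ^ 'n) measure)"
    have "(\<lambda>\<eta>. orbit (coordinate \<eta>)) -` A \<inter> space torus_borel \<inter> orbit ` sphere 0 1 = A \<inter> orbit ` sphere 0 1"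
      using torus_smult[OF _ \<zeta>] by (auto simp: space_restrict_space)
    then show "\<nu> A = \<nu> ((\<lambda>\<eta>. orbit (coordinate \<eta>)) -` A \<inter> space torus_borel)"
      using concentrated[OF A] concentrated[OF measurable_sets[OF proj A]] by simp
  qed (simp add: B space_restrict_space)
  also have "\<dots> = complex_measure_integral circle_borel ?\<kappa> (\<lambda>\<xi>. f (orbit \<xi>))"
    using B torus_smult[OF _ \<zeta>]
    by (intro complex_measure_integral_distr[OF p coordinate_measurable \<kappa> borel_measurable_continuous_on_restrict[OF fo], of B, symmetric])
      (auto simp: space_restrict_space)
  also have "\<dots> = (\<Sum>k<4. \<i> ^ k * (\<integral>\<xi>. f (orbit \<xi>) \<partial>q k))"
    by (rule complex_measure_integral_continuous[OF q compact_sphere fo])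
  finally have "(\<lambda>n. \<integral>\<xi>. f (orbit \<xi>) * circle.kernel_integral q n \<xi> \<partial>circle_lebesgue) \<longlonglongrightarrow> complex_measure_integral torus_borel \<nu> f"
    using circle.kernel_integral_tendsto[OF q fo] by simp
  moreover have "circle.kernel_integral q n \<xi> = poisson_integral \<mu> ((of_real (radius n) * \<xi>) *s \<zeta>)" if "norm \<xi> = 1" for n \<xi>
  proof -
    let ?w = "of_real (radius n) * \<xi>"
    have w: "norm ?w < 1"
      using that radius[of n] by (simp add: norm_mult)
    then have "poisson_integral \<mu> (?w *s \<zeta>) = complex_measure_integral circle_borel ?\<kappa> (\<lambda>\<xi>. of_real (disc_kernel ?w \<xi>))"
      using \<nu> unfolding is_slice_measure_def slice_function_def disc_kernel_def by (simp add: mem_ball_0)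
    also have "\<dots> = (\<Sum>k<4. \<i> ^ k * (\<integral>\<xi>. of_real (disc_kernel ?w \<xi>) \<partial>q k))"
      using w by (intro complex_measure_integral_continuous[OF q compact_sphere] continuous_intros) auto
    finally show ?thesis
      by (simp add: circle.kernel_integral_def)
  qed
  then have "(\<integral>\<xi>. f (orbit \<xi>) * circle.kernel_integral q n \<xi> \<partial>circle_lebesgue)
      = (\<integral>\<xi>. f (orbit \<xi>) * poisson_integral \<mu> ((of_real (radius n) * \<xi>) *s \<zeta>) \<partial>circle_lebesgue)" for n
    by (intro Bochner_Integration.integral_cong) auto
  ultimately show ?thesis
    by simp
qed

text \<open>The approximating circle integrals involve only \<mu>, \<zeta> and \<open>f\<close>, so
  both measures integrate every continuous function alike. Off the sigma-algebra both are normalised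
  to 0.\<close>

lemma slice_measure_unique:
  assumes \<nu>: "is_slice_measure \<mu> \<zeta> \<nu>" and \<nu>': "is_slice_measure \<mu> \<zeta> \<nu>'"
  shows "\<nu> = \<nu>'"
proof
  fix A
  obtain p where p: "jordan_parts torus_borel p \<nu>"
    using \<nu> complex_measure_jordan_parts unfolding is_slice_measure_def by blast
  obtain q where q: "jordan_parts torus_borel q \<nu>'"
    using \<nu>' complex_measure_jordan_parts unfolding is_slice_measure_def by blast
  have "(\<Sum>k<4. \<i> ^ k * (\<integral>x. f x \<partial>p k)) = (\<Sum>k<4. \<i> ^ k * (\<integral>x. f x \<partial>q k))" if f: "continuous_on torus f" for f
    using LIMSEQ_unique[OF slice_measure_integral_tendsto[OF \<nu> f] slice_measure_integral_tendsto[OF \<nu>' f]]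
    by (simp add: complex_measure_integral_continuous[OF p compact_torus f] complex_measure_integral_continuous[OF q compact_torus f])
  then have "\<nu> A = \<nu>' A" if "A \<in> sets torus_borel"
    using that by (intro complex_measure_eqI_continuous[OF compact_torus p q])
  moreover have "\<nu> A = \<nu>' A" if "A \<notin> sets torus_borel"
    using that \<nu> \<nu>' unfolding is_slice_measure_def complex_measure_def by simp
  ultimately show "\<nu> A = \<nu>' A"
    by blast
qed

lemma slice_measure_ex1:
  "slice_bounded \<mu> \<zeta> \<Longrightarrow> \<exists>!\<nu>. is_slice_measure \<mu> \<zeta> \<nu>"
  using slice_measure_exists slice_measure_unique by blast

lemma is_slice_measure_slice_measure:
  "slice_bounded \<mu> \<zeta> \<Longrightarrow> is_slice_measure \<mu> \<zeta> (slice_measure \<mu> \<zeta>)"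
  using theI'[OF slice_measure_ex1] by (simp add: slice_measure_def)

section \<open>Circle means of a slice\<close>

definition circle_mean :: "real \<Rightarrow> ennreal" where
  "circle_mean r = (\<integral>\<^sup>+\<xi>. ennreal (norm (slice_function \<mu> \<zeta> (of_real r * \<xi>))) \<partial>circle_lebesgue)"

text \<open>The slice at radius \<open>r\<close> is a Poisson average of its values at radius
  \<open>s\<close>. Taking absolute values inside and integrating over the circle loses nothing
  more, as the kernel has mass 1 in either variable.\<close>

lemma circle_mean_mono:
  assumes r: "0 \<le> r" "r \<le> s" "s < 1"
  shows "circle_mean r \<le> circle_mean s"
proof (cases "r = s")
  case False
  \<comment> \<open>The case \<open>r = s\<close> is set apart so that \<open>s > 0\<close> and
    \<open>t < 1\<close>, as the Poisson kernel requires.\<close>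
  define t where "t = r / s"
  have t: "0 \<le> t" "t < 1" "r = s * t"
    using r False by (auto simp: t_def)
  let ?h = "slice_function \<mu> \<zeta>"
  have h_cont: "continuous_on (sphere 0 1) (\<lambda>\<omega>. ?h (of_real s * \<omega>))"
    using r by (intro continuous_on_compose2[OF pluriharmonic_slice_continuous[OF pluriharmonic \<zeta>, folded slice_function_def]] continuous_intros)
      (auto simp: norm_mult)
  have lt: "norm (of_real t * \<xi>) < 1" if "norm \<xi> = 1" for \<xi> :: complex
    using t that by (simp add: norm_mult)
  interpret pair_sigma_finite circle_lebesgue circle_lebesgue ..
  have c: "continuous_on (sphere 0 1 \<times> sphere 0 1) (\<lambda>z. disc_kernel (of_real t * fst z) (snd z) * norm (?h (of_real s * snd z)))"
    using lt by (intro continuous_intros continuous_on_compose2[OF h_cont]) auto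
  have "(\<lambda>z. disc_kernel (of_real t * fst z) (snd z) * norm (?h (of_real s * snd z))) \<in> borel_measurable (circle_lebesgue \<Otimes>\<^sub>M circle_lebesgue)"
    using borel_measurable_continuous_on_Times[OF compact_sphere compact_sphere c]
      measurable_cong_sets[OF sets_pair_measure_cong[OF sets_circle_lebesgue sets_circle_lebesgue] refl] by blast
  then have m: "(\<lambda>(\<xi>, \<omega>). ennreal (disc_kernel (of_real t * \<xi>) \<omega> * norm (?h (of_real s * \<omega>)))) \<in> borel_measurable (circle_lebesgue \<Otimes>\<^sub>M circle_lebesgue)"
    by (simp add: case_prod_unfold)
  have "circle_mean r \<le> (\<integral>\<^sup>+\<xi>. (\<integral>\<^sup>+\<omega>. ennreal (disc_kernel (of_real t * \<xi>) \<omega> * norm (?h (of_real s * \<omega>))) \<partial>circle_lebesgue) \<partial>circle_lebesgue)"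
    unfolding circle_mean_def
  proof (intro nn_integral_mono)
    fix \<xi> assume "\<xi> \<in> space circle_lebesgue"
    then have \<xi>: "norm \<xi> = 1"
      by simp
    have "?h (of_real r * \<xi>) = ?h (of_real s * (of_real t * \<xi>))"
      by (simp add: t(3) mult.assoc)
    also have "\<dots> = (\<integral>\<omega>. of_real (disc_kernel (of_real t * \<xi>) \<omega>) * ?h (of_real s * \<omega>) \<partial>circle_lebesgue)"
      unfolding slice_function_def using r by (intro pluriharmonic_slice_poisson[OF pluriharmonic \<zeta>, symmetric] lt \<xi>) auto
    finally have "ennreal (norm (?h (of_real r * \<xi>))) = ennreal (norm (\<integral>\<omega>. of_real (disc_kernel (of_real t * \<xi>) \<omega>) * ?h (of_real s * \<omega>) \<partial>circle_lebesgue))"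
      by simp
    also have "\<dots> \<le> (\<integral>\<^sup>+\<omega>. ennreal (norm (of_real (disc_kernel (of_real t * \<xi>) \<omega>) * ?h (of_real s * \<omega>))) \<partial>circle_lebesgue)"
      using lt[OF \<xi>] by (intro integral_norm_bound_ennreal circle.continuous_integrable continuous_intros h_cont) auto
    also have "\<dots> = (\<integral>\<^sup>+\<omega>. ennreal (disc_kernel (of_real t * \<xi>) \<omega> * norm (?h (of_real s * \<omega>))) \<partial>circle_lebesgue)"
      using disc_kernel_nonneg[OF lt[OF \<xi>]] by (simp add: norm_mult)
    finally show "ennreal (norm (?h (of_real r * \<xi>))) \<le> (\<integral>\<^sup>+\<omega>. ennreal (disc_kernel (of_real t * \<xi>) \<omega> * norm (?h (of_real s * \<omega>))) \<partial>circle_lebesgue)" .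
  qed
  also have "\<dots> = (\<integral>\<^sup>+\<omega>. (\<integral>\<^sup>+\<xi>. ennreal (disc_kernel (of_real t * \<xi>) \<omega> * norm (?h (of_real s * \<omega>))) \<partial>circle_lebesgue) \<partial>circle_lebesgue)"
    by (rule Fubini'[OF m, symmetric])
  also have "\<dots> = circle_mean s"
    unfolding circle_mean_def
  proof (intro nn_integral_cong)
    fix \<omega> assume "\<omega> \<in> space circle_lebesgue"
    then have \<omega>: "norm \<omega> = 1"
      by simp
    have "(\<integral>\<^sup>+\<xi>. ennreal (disc_kernel (of_real t * \<xi>) \<omega> * norm (?h (of_real s * \<omega>))) \<partial>circle_lebesgue)
        = (\<integral>\<^sup>+\<xi>. ennreal (disc_kernel (of_real t * \<omega>) \<xi>) * ennreal (norm (?h (of_real s * \<omega>))) \<partial>circle_lebesgue)"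
      using \<omega> by (intro nn_integral_cong) (simp add: disc_kernel_sym ennreal_mult'')
    also have "\<dots> = (\<integral>\<^sup>+\<xi>. ennreal (disc_kernel (of_real t * \<omega>) \<xi>) \<partial>circle_lebesgue) * ennreal (norm (?h (of_real s * \<omega>)))"
      using disc_kernel_measurable[OF lt[OF \<omega>]] sets_circle_lebesgue
      by (intro nn_integral_multc) (auto simp: measurable_cong_sets[OF sets_circle_lebesgue refl])
    finally show "(\<integral>\<^sup>+\<xi>. ennreal (disc_kernel (of_real t * \<xi>) \<omega> * norm (?h (of_real s * \<omega>))) \<partial>circle_lebesgue) = ennreal (norm (?h (of_real s * \<omega>)))"
      by (simp add: nn_integral_disc_kernel[OF lt[OF \<omega>]])
  qed
  finally show ?thesis .
qed simp

text \<open>Monotonicity in the radius reduces the uncountable supremum to a sequence, so that the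
  condition becomes measurable in \<zeta>.\<close>

lemma slice_bounded_iff: "slice_bounded \<mu> \<zeta> \<longleftrightarrow> (SUP n. circle_mean (radius n)) < \<infinity>"
proof -
  have "(SUP r \<in> {0<..<1}. circle_mean r) = (SUP n. circle_mean (radius n))"
  proof (rule antisym)
    show "(SUP r \<in> {0<..<1}. circle_mean r) \<le> (SUP n. circle_mean (radius n))"
    proof (rule SUP_mono)
      fix r :: real assume "r \<in> {0<..<1}"
      then have "\<forall>\<^sub>F n in sequentially. r < radius n"
        by (intro order_tendstoD(1)[OF radius_tendsto]) auto
      then obtain n where "r < radius n"
        using eventually_happens'[OF sequentially_bot] by blast
      then show "\<exists>n\<in>UNIV. circle_mean r \<le> circle_mean (radius n)"
        using \<open>r \<in> {0<..<1}\<close> radius[of n] by (intro bexI[of _ n] circle_mean_mono) auto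
    qed
    show "(SUP n. circle_mean (radius n)) \<le> (SUP r \<in> {0<..<1}. circle_mean r)"
      using radius by (intro SUP_subset_mono SUP_mono) auto
  qed
  then show ?thesis
    by (simp add: slice_bounded_def circle_mean_def)
qed

end

section \<open>The disintegration formula\<close>

lemma pluriharmonic_continuous:
  assumes "pluriharmonic_on polydisc u"
  shows "continuous_on polydisc u"
proof -
  obtain u' where "\<And>x. x \<in> polydisc \<Longrightarrow> (u has_derivative blinfun_apply (u' x)) (at x)"
    using assms unfolding pluriharmonic_on_def C2_on_def by blast
  then show ?thesis
    by (intro continuous_at_imp_continuous_on ballI has_derivative_continuous) blast
qed

theorem proposition2p3:
  fixes \<mu> :: "(complex ^ 'n) set \<Rightarrow> complex"
  assumes "CARD('n) \<ge> 2"
    and "pluriharmonic_measure \<mu>"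
  shows "(AE \<zeta> in torus_lebesgue. slice_bounded \<mu> \<zeta> \<and> (\<exists>!\<nu>. is_slice_measure \<mu> \<zeta> \<nu>)) \<and>
    (\<forall>f :: complex ^ 'n \<Rightarrow> complex. continuous_on torus f \<longrightarrow>
       integrable torus_lebesgue
         (\<lambda>\<zeta>. complex_measure_integral torus_borel (slice_measure \<mu> \<zeta>) f) \<and>
       complex_measure_integral torus_borel \<mu> f =
         (\<integral>\<zeta>. complex_measure_integral torus_borel (slice_measure \<mu> \<zeta>) f \<partial>torus_lebesgue))"
proof -
  let ?N = "torus_lebesgue :: (complex ^ 'n) measure"
  define u where "u = poisson_integral \<mu>"
  have ph: "pluriharmonic_on polydisc (poisson_integral \<mu>)"
    using assms(2) by (simp add: pluriharmonic_measure_def)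
  have slice: "slice \<mu> \<zeta>" if "\<zeta> \<in> torus" for \<zeta>
    using ph that by (rule slice.intro)
  obtain p where p: "jordan_parts torus_borel p \<mu>"
    using assms(2) complex_measure_jordan_parts unfolding pluriharmonic_measure_def by blast
  define U where "U n \<zeta> = u (of_real (radius n) *s \<zeta>)" for n \<zeta>
  have U_eq: "U n (\<xi> *s \<zeta>) = u ((of_real (radius n) * \<xi>) *s \<zeta>)" for n \<xi> \<zeta>
    by (simp add: U_def vector_smult_assoc)
  have U_cont: "continuous_on torus (U n)" for n
    unfolding U_def u_def using radius[of n]
    by (intro continuous_on_compose2[OF pluriharmonic_continuous[OF ph]] continuous_intros)
      (auto intro!: torus_smult_polydisc)
  have U_kernel: "U n \<zeta> = torus.kernel_integral p n \<zeta>" if "\<zeta> \<in> torus" for n \<zeta>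
    unfolding U_def u_def torus.kernel_integral_def using that radius[of n]
    by (intro poisson_integral_eq[OF p] torus_smult_polydisc) auto
  have rot_cont: "continuous_on (torus \<times> sphere 0 1) (\<lambda>z. g (snd z *s fst z))"
    if "continuous_on torus g" for g :: "complex ^ 'n \<Rightarrow> complex"
    by (intro continuous_on_compose2[OF that] continuous_intros) (auto intro: torus_smult)
  interpret pair_sigma_finite ?N circle_lebesgue ..
  have sets_pair: "sets (?N \<Otimes>\<^sub>M circle_lebesgue) = sets (torus_borel \<Otimes>\<^sub>M circle_borel)"
    by (intro sets_pair_measure_cong sets_torus_lebesgue sets_circle_lebesgue)
  have rot_m: "(\<lambda>(\<zeta>, \<xi>). g (\<xi> *s \<zeta>)) \<in> borel_measurable (?N \<Otimes>\<^sub>M circle_lebesgue)"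
    if "continuous_on torus g" for g :: "complex ^ 'n \<Rightarrow> complex"
    unfolding case_prod_unfold measurable_cong_sets[OF sets_pair refl]
    by (rule borel_measurable_continuous_on_Times[OF compact_torus compact_sphere rot_cont[OF that]])

  define S where "S n \<zeta> = (\<integral>\<^sup>+\<xi>. ennreal (norm (U n (\<xi> *s \<zeta>))) \<partial>circle_lebesgue)" for n \<zeta>
  have S_eq: "S n \<zeta> = slice.circle_mean \<mu> \<zeta> (radius n)" if "\<zeta> \<in> torus" for n \<zeta>
    by (simp add: S_def U_eq u_def slice.circle_mean_def[OF slice[OF that]] slice_function_def)
  have S_m [measurable]: "S n \<in> borel_measurable ?N" for n
    unfolding S_def using rot_m[OF U_cont[of n]]
    by (intro circle.borel_measurable_nn_integral) (simp add: case_prod_unfold)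
  define T where "T \<zeta> = (SUP n. S n \<zeta>)" for \<zeta>
  have T_m [measurable]: "T \<in> borel_measurable ?N"
    unfolding T_def by measurable
  have bounded_iff: "slice_bounded \<mu> \<zeta> \<longleftrightarrow> T \<zeta> < \<infinity>" if "\<zeta> \<in> torus" for \<zeta>
    using slice.slice_bounded_iff[OF slice[OF that]] by (simp add: T_def S_eq[OF that])
  obtain C where C: "\<And>n. (\<integral>\<^sup>+\<zeta>. ennreal (norm (torus.kernel_integral p n \<zeta>)) \<partial>?N) \<le> ennreal C"
    using torus.kernel_integral_L1_bounded[OF p] by blast
  have S_int: "(\<integral>\<^sup>+\<zeta>. S n \<zeta> \<partial>?N) \<le> ennreal C" for n
  proof -
    \<comment> \<open>For each fixed \<xi> the rotation drops out of the torus integral, leaving the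
      norm of \<open>U n\<close> in \<open>L\<^sup>1\<close>, which is bounded by the total mass of
      the four parts of \<mu>.\<close>
    have "(\<integral>\<^sup>+\<zeta>. S n \<zeta> \<partial>?N) = (\<integral>\<^sup>+\<xi>. (\<integral>\<^sup>+\<zeta>. ennreal (norm (U n (\<xi> *s \<zeta>))) \<partial>?N) \<partial>circle_lebesgue)"
      unfolding S_def using rot_m[OF U_cont[of n]]
      by (intro Fubini'[symmetric]) (simp add: case_prod_unfold)
    also have "\<dots> = (\<integral>\<^sup>+\<xi>. (\<integral>\<^sup>+\<zeta>. ennreal (norm (U n \<zeta>)) \<partial>?N) \<partial>circle_lebesgue)"
      by (intro nn_integral_cong torus_lebesgue_rotation_norm U_cont) simp
    also have "\<dots> = (\<integral>\<^sup>+\<zeta>. ennreal (norm (U n \<zeta>)) \<partial>?N)"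
      by (simp add: circle.emeasure_space_1[simplified])
    also have "\<dots> = (\<integral>\<^sup>+\<zeta>. ennreal (norm (torus.kernel_integral p n \<zeta>)) \<partial>?N)"
      by (intro nn_integral_cong) (simp add: U_kernel)
    also have "\<dots> \<le> ennreal C"
      by (rule C)
    finally show ?thesis .
  qed
  have "(\<integral>\<^sup>+\<zeta>. T \<zeta> \<partial>?N) = (SUP n. \<integral>\<^sup>+\<zeta>. S n \<zeta> \<partial>?N)"
    unfolding T_def
  proof (rule nn_integral_monotone_convergence_SUP_AE)
    \<comment> \<open>The almost-everywhere form is used because monotonicity is available only for
      \<zeta> on the torus.\<close>
    show "AE \<zeta> in ?N. S n \<zeta> \<le> S (Suc n) \<zeta>" for n
    proof (rule AE_I2)
      fix \<zeta> assume "\<zeta> \<in> space ?N"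
      then have "\<zeta> \<in> torus"
        by simp
      then show "S n \<zeta> \<le> S (Suc n) \<zeta>"
        using radius monoD[OF mono_radius, of n "Suc n"] by (simp add: S_eq slice.circle_mean_mono[OF slice])
    qed
  qed measurable
  also have "\<dots> \<le> ennreal C"
    by (intro SUP_least S_int)
  finally have T_int: "(\<integral>\<^sup>+\<zeta>. T \<zeta> \<partial>?N) < \<infinity>"
    by (simp add: le_less_trans)
  then have T_AE: "AE \<zeta> in ?N. T \<zeta> < \<infinity>"
    using nn_integral_PInf_AE[OF T_m] by (auto simp: less_top)
  have AE_good: "AE \<zeta> in ?N. slice_bounded \<mu> \<zeta> \<and> (\<exists>!\<nu>. is_slice_measure \<mu> \<zeta> \<nu>)"
    using T_AE AE_space
  proof eventually_elim
    case (elim \<zeta>)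
    then have "\<zeta> \<in> torus"
      by simp
    then show ?case
      using elim bounded_iff slice.slice_measure_ex1[OF slice] by blast
  qed

  have main: "integrable ?N (\<lambda>\<zeta>. complex_measure_integral torus_borel (slice_measure \<mu> \<zeta>) f) \<and>
       complex_measure_integral torus_borel \<mu> f =
         (\<integral>\<zeta>. complex_measure_integral torus_borel (slice_measure \<mu> \<zeta>) f \<partial>?N)"
    if f: "continuous_on torus f" for f :: "complex ^ 'n \<Rightarrow> complex"
  proof -
    define L where "L \<zeta> = complex_measure_integral torus_borel (slice_measure \<mu> \<zeta>) f" for \<zeta>
    define F where "F n \<zeta> = (\<integral>\<xi>. f (\<xi> *s \<zeta>) * U n (\<xi> *s \<zeta>) \<partial>circle_lebesgue)" for n \<zeta>
    have fU: "continuous_on torus (\<lambda>\<zeta>. f \<zeta> * U n \<zeta>)" for n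
      by (intro continuous_intros f U_cont)
    have F_m [measurable]: "F n \<in> borel_measurable ?N" for n
      unfolding F_def using rot_m[OF fU[of n]] by (rule circle.borel_measurable_lebesgue_integral)
    obtain B where B: "B > 0" "\<And>\<zeta>. \<zeta> \<in> torus \<Longrightarrow> norm (f \<zeta>) \<le> B"
      using compact_bounded_continuous[OF compact_torus f] by metis
    \<comment> \<open>Fubini followed by rotation leaves an inner integral independent of \<xi>, so
      the average over the circle disappears.\<close>
    have F_int: "(\<integral>\<zeta>. F n \<zeta> \<partial>?N) = (\<integral>\<zeta>. f \<zeta> * U n \<zeta> \<partial>?N)" for n
    proof -
      obtain D where D: "\<And>\<zeta>. \<zeta> \<in> torus \<Longrightarrow> norm (f \<zeta> * U n \<zeta>) \<le> D"
        using compact_bounded_continuous[OF compact_torus fU] by metis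
      have "finite_measure (?N \<Otimes>\<^sub>M circle_lebesgue)"
        by (intro finite_measure_pair_measure) unfold_locales
      then have "integrable (?N \<Otimes>\<^sub>M circle_lebesgue) (\<lambda>(\<zeta>, \<xi>). f (\<xi> *s \<zeta>) * U n (\<xi> *s \<zeta>))"
        using rot_m[OF fU[of n]] D
        by (intro finite_measure.integrable_const_bound[of _ _ D])
          (auto simp: space_pair_measure case_prod_unfold torus_smult)
      then have "(\<integral>\<zeta>. F n \<zeta> \<partial>?N) = (\<integral>\<xi>. (\<integral>\<zeta>. f (\<xi> *s \<zeta>) * U n (\<xi> *s \<zeta>) \<partial>?N) \<partial>circle_lebesgue)"
        unfolding F_def by (rule Fubini_integral[symmetric])
      also have "\<dots> = (\<integral>\<xi>. (\<integral>\<zeta>. f \<zeta> * U n \<zeta> \<partial>?N) \<partial>circle_lebesgue)"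
        by (intro Bochner_Integration.integral_cong refl torus_lebesgue_rotation fU) simp
      finally show ?thesis
        using circle.prob_space by simp
    qed
    have F_le: "norm (F n \<zeta>) \<le> B * enn2real (T \<zeta>)" if \<zeta>: "\<zeta> \<in> torus" "T \<zeta> < \<infinity>" for n \<zeta>
    proof -
      have c: "continuous_on (sphere 0 1) (\<lambda>\<xi>. U n (\<xi> *s \<zeta>))" "continuous_on (sphere 0 1) (\<lambda>\<xi>. f (\<xi> *s \<zeta>))"
        using \<zeta> by (auto intro!: continuous_on_compose2[OF U_cont] continuous_on_compose2[OF f] continuous_intros torus_smult)
      have "ennreal (norm (F n \<zeta>)) \<le> (\<integral>\<^sup>+\<xi>. ennreal (norm (f (\<xi> *s \<zeta>) * U n (\<xi> *s \<zeta>))) \<partial>circle_lebesgue)"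
        unfolding F_def by (intro integral_norm_bound_ennreal circle.continuous_integrable continuous_intros c)
      also have "\<dots> \<le> (\<integral>\<^sup>+\<xi>. ennreal B * ennreal (norm (U n (\<xi> *s \<zeta>))) \<partial>circle_lebesgue)"
        using B \<zeta> by (intro nn_integral_mono)
          (auto simp: norm_mult ennreal_mult[symmetric] torus_smult intro!: ennreal_leI mult_right_mono)
      also have "\<dots> = ennreal B * S n \<zeta>"
        unfolding S_def using c by (intro nn_integral_cmult) (auto intro!: measurable_compose[OF _ measurable_ennreal] circle.continuous_measurable continuous_intros)
      also have "\<dots> \<le> ennreal B * T \<zeta>"
        unfolding T_def by (intro mult_left_mono SUP_upper) auto
      also have "\<dots> = ennreal (B * enn2real (T \<zeta>))"
        using \<zeta> B by (simp add: ennreal_mult ennreal_enn2real_if)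
      finally show ?thesis
        using B by (subst (asm) ennreal_le_iff) auto
    qed
    have L_bounded: "(\<lambda>n. F n \<zeta>) \<longlonglongrightarrow> L \<zeta>" if \<zeta>: "\<zeta> \<in> torus" "T \<zeta> < \<infinity>" for \<zeta>
    proof -
      interpret slice \<mu> \<zeta>
        using slice \<zeta>(1) by blast
      show ?thesis
        unfolding L_def F_def U_eq u_def using that bounded_iff f
        by (intro slice_measure_integral_tendsto is_slice_measure_slice_measure) auto
    qed
    \<comment> \<open>The zero measure used as default makes \<open>L\<close> vanish on the
      exceptional set, so that \<open>L\<close> is determined at every point of the torus and not
      only almost everywhere.\<close>
    have L_unbounded: "L \<zeta> = 0" if "\<zeta> \<in> torus" "\<not> T \<zeta> < \<infinity>" for \<zeta>
    proof -
      have "jordan_parts torus_borel (\<lambda>_. null_measure (torus_borel :: (complex ^ 'n) measure)) (\<lambda>_. 0)"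
        by (auto simp: jordan_parts_def intro!: finite_measureI)
      from complex_measure_integral_continuous[OF this compact_torus f] show ?thesis
        using that bounded_iff by (simp add: L_def slice_measure_def)
    qed
    \<comment> \<open>With the default value known, \<open>L\<close> is an everywhere pointwise
      limit of the functions \<open>F n\<close> cut off to the measurable set where \<open>T\<close>
      is finite.\<close>
    have L_m: "L \<in> borel_measurable ?N"
    proof (rule borel_measurable_LIMSEQ_metric)
      show "(\<lambda>\<zeta>. if T \<zeta> < \<infinity> then F n \<zeta> else 0) \<in> borel_measurable ?N" for n
        by measurable
      show "(\<lambda>n. if T \<zeta> < \<infinity> then F n \<zeta> else 0) \<longlonglongrightarrow> L \<zeta>" if "\<zeta> \<in> space ?N" for \<zeta>
        using that L_bounded L_unbounded by (cases "T \<zeta> < \<infinity>") auto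
    qed
    \<comment> \<open>\<open>enn2real\<close> sends infinity to 0, which can only lower the integral
      of \<open>T\<close>; the domination \<open>F_le\<close> is claimed only where \<open>T\<close>
      is finite.\<close>
    have w: "integrable ?N (\<lambda>\<zeta>. B * enn2real (T \<zeta>))"
    proof -
      have "(\<integral>\<^sup>+\<zeta>. ennreal (norm (enn2real (T \<zeta>))) \<partial>?N) \<le> (\<integral>\<^sup>+\<zeta>. T \<zeta> \<partial>?N)"
        by (intro nn_integral_mono) (auto simp: ennreal_enn2real_if)
      then have "integrable ?N (\<lambda>\<zeta>. enn2real (T \<zeta>))"
        using T_int by (intro integrableI_bounded) (auto intro: le_less_trans)
      then show ?thesis
        by simp
    qed
    have lim_AE: "AE \<zeta> in ?N. (\<lambda>n. F n \<zeta>) \<longlonglongrightarrow> L \<zeta>"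
      using T_AE AE_space by eventually_elim (simp add: L_bounded)
    have F_AE: "AE \<zeta> in ?N. norm (F n \<zeta>) \<le> B * enn2real (T \<zeta>)" for n
      using T_AE AE_space by eventually_elim (simp add: F_le)
    have "integrable ?N L"
      by (rule integrable_dominated_convergence[OF L_m F_m w lim_AE F_AE])
    moreover have "(\<lambda>n. \<integral>\<zeta>. F n \<zeta> \<partial>?N) \<longlonglongrightarrow> (\<integral>\<zeta>. L \<zeta> \<partial>?N)"
      by (rule integral_dominated_convergence[OF L_m F_m w lim_AE F_AE])
    moreover have "(\<lambda>n. \<integral>\<zeta>. F n \<zeta> \<partial>?N) \<longlonglongrightarrow> complex_measure_integral torus_borel \<mu> f"
    proof -
      have "(\<integral>\<zeta>. F n \<zeta> \<partial>?N) = (\<integral>\<zeta>. f \<zeta> * torus.kernel_integral p n \<zeta> \<partial>?N)" for n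
        unfolding F_int by (intro Bochner_Integration.integral_cong refl) (simp add: U_kernel)
      then show ?thesis
        using torus.kernel_integral_tendsto[OF p f] complex_measure_integral_continuous[OF p compact_torus f] by simp
    qed
    ultimately show ?thesis
      using LIMSEQ_unique unfolding L_def by blast
  qed
  show ?thesis
    using AE_good main by blast
qed

end
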